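(* Let $G$ be a locally compact group and $K<G$ a compact subgroup such that $(G,K)$ is a Gelfand pair. Then $G$ admits a co-compact amenable subgroup $P<G$ such that $G=KP$.
   Context: Locally compact groups are Hausdorff. For a locally compact group $G$, let $\mathscr{M}^{\mathrm{b}}(G)$ be the space of bounded (Radon) measures on $G$; it is an algebra under convolution, i.e. the product of two measures $\mu,\nu$ is the push-forward of $\mu\times\nu$ under the multiplication map $G\times G\to G$. Given a compact subgroup $K<G$, the pair $(G,K)$ is called a Gelfand pair if the algebra $\mathscr{M}^{\mathrm{b}}(G)^{K,K}$ of bi-$K$-invariant bounded measures (invariant under left and right translations by elements of $K$) is commutative. A subgroup $P<G$ is co-compact if $G/P$ is compact. A subgroup is amenable if it is amenable as a topological group for the topology induced from $G$. *)

theory Defs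
  imports "HOL-Analysis.Analysis" "HOL-Algebra.Coset"
begin

section \<open>Topological groups and coset spaces\<close>

definition topological_group :: "('a, 'b) monoid_scheme \<Rightarrow> 'a topology \<Rightarrow> bool" where
  "topological_group G T \<longleftrightarrow>
     group G \<and> topspace T = carrier G \<and>
     continuous_map (prod_topology T T) T (\<lambda>(x, y). x \<otimes>\<^bsub>G\<^esub> y) \<and>
     continuous_map T T (\<lambda>x. inv\<^bsub>G\<^esub> x)"

definition locally_compact_group :: "('a, 'b) monoid_scheme \<Rightarrow> 'a topology \<Rightarrow> bool" where
  "locally_compact_group G T \<longleftrightarrow>
     topological_group G T \<and> Hausdorff_space T \<and> locally_compact_space T"

definition quotient_topology :: "'a topology \<Rightarrow> ('a \<Rightarrow> 'b) \<Rightarrow> 'b topology" where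
  "quotient_topology X f =
     topology (\<lambda>U. U \<subseteq> f ` topspace X \<and> openin X {x \<in> topspace X. f x \<in> U})"

lemma istopology_quotient:
  "istopology (\<lambda>U. U \<subseteq> f ` topspace X \<and> openin X {x \<in> topspace X. f x \<in> U})"
proof -
  have "{x \<in> topspace X. f x \<in> S \<inter> S'} =
      {x \<in> topspace X. f x \<in> S} \<inter> {x \<in> topspace X. f x \<in> S'}" for S S'
    by auto
  moreover have "{x \<in> topspace X. f x \<in> \<Union>\<K>} = (\<Union>K\<in>\<K>. {x \<in> topspace X. f x \<in> K})" for \<K>
    by auto
  ultimately show ?thesis
    unfolding istopology_def by (auto intro!: openin_Int openin_Union)
qed

lemma openin_quotient_topology:
  "openin (quotient_topology X f) U \<longleftrightarrow>
     U \<subseteq> f ` topspace X \<and> openin X {x \<in> topspace X. f x \<in> U}"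
  unfolding quotient_topology_def topology_inverse'[OF istopology_quotient] ..

lemma topspace_quotient_topology: "topspace (quotient_topology X f) = f ` topspace X"
proof -
  have "{x \<in> topspace X. f x \<in> f ` topspace X} = topspace X"
    by auto
  then have "openin (quotient_topology X f) (f ` topspace X)"
    by (simp add: openin_quotient_topology)
  then show ?thesis
    by (metis openin_quotient_topology openin_subset openin_topspace subset_antisym)
qed

lemma quotient_map_quotient_topology: "quotient_map X (quotient_topology X f) f"
  by (auto simp: quotient_map_def topspace_quotient_topology openin_quotient_topology)

definition coset_space :: "('a, 'b) monoid_scheme \<Rightarrow> 'a topology \<Rightarrow> 'a set \<Rightarrow> 'a set topology" where
  "coset_space G T P = quotient_topology T (\<lambda>g. g <#\<^bsub>G\<^esub> P)"

definition cocompact_subgroup :: "('a, 'b) monoid_scheme \<Rightarrow> 'a topology \<Rightarrow> 'a set \<Rightarrow> bool" where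
  "cocompact_subgroup G T P \<longleftrightarrow> subgroup P G \<and> compact_space (coset_space G T P)"


section \<open>Amenability\<close>

text \<open>
  The bounded real functions whose orbit map under left translation is continuous for the
  supremum norm. On a group that is not locally compact (for instance a subgroup that is not
  closed), amenability refers to means on this space, and not on all bounded continuous functions.
\<close>

definition uniform_functions :: "('a, 'b) monoid_scheme \<Rightarrow> 'a topology \<Rightarrow> ('a \<Rightarrow> real) set" where
  "uniform_functions G T = {f.
     bounded (f ` carrier G) \<and>
     (\<forall>\<epsilon>>0. \<exists>V. openin T V \<and> \<one>\<^bsub>G\<^esub> \<in> V \<and>
        (\<forall>v\<in>V. \<forall>x\<in>carrier G. \<bar>f (v \<otimes>\<^bsub>G\<^esub> x) - f x\<bar> < \<epsilon>))}"

text \<open>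
  Positivity only looks at values on the carrier; together with linearity this makes a mean
  independent of the values of a function outside the carrier.
\<close>

definition left_invariant_mean ::
    "('a, 'b) monoid_scheme \<Rightarrow> 'a topology \<Rightarrow> (('a \<Rightarrow> real) \<Rightarrow> real) \<Rightarrow> bool" where
  "left_invariant_mean G T m \<longleftrightarrow>
     (\<forall>f\<in>uniform_functions G T. \<forall>g\<in>uniform_functions G T. m (\<lambda>x. f x + g x) = m f + m g) \<and>
     (\<forall>f\<in>uniform_functions G T. \<forall>c. m (\<lambda>x. c * f x) = c * m f) \<and>
     (\<forall>f\<in>uniform_functions G T. (\<forall>x\<in>carrier G. f x \<ge> 0) \<longrightarrow> m f \<ge> 0) \<and>
     m (\<lambda>x. 1) = 1 \<and>
     (\<forall>f\<in>uniform_functions G T. \<forall>g\<in>carrier G. m (\<lambda>x. f (g \<otimes>\<^bsub>G\<^esub> x)) = m f)"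

definition amenable_group :: "('a, 'b) monoid_scheme \<Rightarrow> 'a topology \<Rightarrow> bool" where
  "amenable_group G T \<longleftrightarrow> topological_group G T \<and> (\<exists>m. left_invariant_mean G T m)"

definition amenable_subgroup :: "('a, 'b) monoid_scheme \<Rightarrow> 'a topology \<Rightarrow> 'a set \<Rightarrow> bool" where
  "amenable_subgroup G T P \<longleftrightarrow>
     subgroup P G \<and> amenable_group (G\<lparr>carrier := P\<rparr>) (subtopology T P)"


section \<open>Bounded Radon measures\<close>

text \<open>
  Radon measures are taken in the sense of Bourbaki: a bounded (complex) Radon measure on a
  locally compact Hausdorff space \<open>X\<close> is a linear functional on the space of continuous
  compactly supported functions that is bounded for the supremum norm. Only the values of such a
  functional on \<open>compactly_supported X\<close> matter, and functions matter only on \<open>topspace X\<close>.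
\<close>

definition compactly_supported :: "'a topology \<Rightarrow> ('a \<Rightarrow> 'c::real_normed_vector) set" where
  "compactly_supported X = {f. continuous_map X euclidean f \<and>
     (\<exists>C. compactin X C \<and> (\<forall>x\<in>topspace X - C. f x = 0))}"

definition bounded_measures :: "'a topology \<Rightarrow> (('a \<Rightarrow> complex) \<Rightarrow> complex) set" where
  "bounded_measures X = {\<mu>.
     (\<forall>f\<in>compactly_supported X. \<forall>g\<in>compactly_supported X.
        \<mu> (\<lambda>x. f x + g x) = \<mu> f + \<mu> g) \<and>
     (\<forall>f\<in>compactly_supported X. \<forall>c. \<mu> (\<lambda>x. c * f x) = c * \<mu> f) \<and>
     (\<exists>B. \<forall>f\<in>compactly_supported X. norm (\<mu> f) \<le> B * (SUP x\<in>topspace X. norm (f x)))}"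

text \<open>
  The integral of a bounded continuous function \<open>h\<close> that need not have compact support: the limit
  of \<open>\<mu> (\<phi> h)\<close> along cut-off functions \<open>\<phi>\<close> that equal one on larger and larger compact sets.
  The limit exists because a bounded measure has arbitrarily small mass outside compact sets.
\<close>

definition measure_integral ::
    "'a topology \<Rightarrow> (('a \<Rightarrow> complex) \<Rightarrow> complex) \<Rightarrow> ('a \<Rightarrow> complex) \<Rightarrow> complex" where
  "measure_integral X \<mu> h = (THE L. \<forall>\<epsilon>>0. \<exists>C. compactin X C \<and>
     (\<forall>\<phi>::'a \<Rightarrow> real. \<phi> \<in> compactly_supported X \<longrightarrow>
        (\<forall>x\<in>topspace X. 0 \<le> \<phi> x \<and> \<phi> x \<le> 1) \<longrightarrow> (\<forall>x\<in>C. \<phi> x = 1) \<longrightarrow>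
        norm (\<mu> (\<lambda>x. complex_of_real (\<phi> x) * h x) - L) < \<epsilon>))"

definition push_forward ::
    "'a topology \<Rightarrow> ('a \<Rightarrow> 'c) \<Rightarrow> (('a \<Rightarrow> complex) \<Rightarrow> complex) \<Rightarrow> ('c \<Rightarrow> complex) \<Rightarrow> complex" where
  "push_forward X p \<mu> f = measure_integral X \<mu> (\<lambda>x. f (p x))"

text \<open>
  The iterated integral of a compactly supported function; this is the unique Radon measure on
  the product space that sends \<open>(x, y) \<mapsto> f x * g y\<close> to \<open>\<mu> f * \<nu> g\<close>.
\<close>

definition product_measure ::
    "(('a \<Rightarrow> complex) \<Rightarrow> complex) \<Rightarrow> (('c \<Rightarrow> complex) \<Rightarrow> complex) \<Rightarrow>
     ('a \<times> 'c \<Rightarrow> complex) \<Rightarrow> complex" where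
  "product_measure \<mu> \<nu> F = \<mu> (\<lambda>x. \<nu> (\<lambda>y. F (x, y)))"

definition convolution ::
    "('a, 'b) monoid_scheme \<Rightarrow> 'a topology \<Rightarrow> (('a \<Rightarrow> complex) \<Rightarrow> complex) \<Rightarrow>
     (('a \<Rightarrow> complex) \<Rightarrow> complex) \<Rightarrow> ('a \<Rightarrow> complex) \<Rightarrow> complex" where
  "convolution G T \<mu> \<nu> =
     push_forward (prod_topology T T) (\<lambda>(x, y). x \<otimes>\<^bsub>G\<^esub> y) (product_measure \<mu> \<nu>)"


section \<open>Gelfand pairs\<close>

definition bi_invariant_measures ::
    "('a, 'b) monoid_scheme \<Rightarrow> 'a topology \<Rightarrow> 'a set \<Rightarrow> (('a \<Rightarrow> complex) \<Rightarrow> complex) set" where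
  "bi_invariant_measures G T K = {\<mu> \<in> bounded_measures T.
     \<forall>k\<in>K. \<forall>f\<in>compactly_supported T.
       \<mu> (\<lambda>x. f (k \<otimes>\<^bsub>G\<^esub> x)) = \<mu> f \<and> \<mu> (\<lambda>x. f (x \<otimes>\<^bsub>G\<^esub> k)) = \<mu> f}"

definition gelfand_pair :: "('a, 'b) monoid_scheme \<Rightarrow> 'a topology \<Rightarrow> 'a set \<Rightarrow> bool" where
  "gelfand_pair G T K \<longleftrightarrow>
     (\<forall>\<mu>\<in>bi_invariant_measures G T K. \<forall>\<nu>\<in>bi_invariant_measures G T K.
        \<forall>f\<in>compactly_supported T. convolution G T \<mu> \<nu> f = convolution G T \<nu> \<mu> f)"

end

theory Submission
  imports Defs
begin

text \<open>
  The group acts on the compact convex set of means on its uniform functions; let \<open>V\<close> be a minimal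
  closed convex invariant subset. For a Gelfand pair, the operators \<open>y \<mapsto> haar * g * y\<close> on the
  \<open>K\<close>-fixed means in \<open>V\<close> commute, so they have a common fixed point \<open>e\<close>, and minimality gives
  \<open>haar * y = e\<close> for every \<open>y\<close> in \<open>V\<close>. An extreme point \<open>x\<close> of \<open>V\<close> satisfies \<open>x * x = x\<close>; extremality
  then concentrates the mean \<open>x\<close> on its own stabiliser \<open>P\<close>. Hence \<open>e\<close> is the image of the Haar
  measure on each orbit \<open>K h x\<close>, so that \<open>G x = K x\<close>, that is \<open>G = K P\<close>; and \<open>x\<close>, which is concentrated
  on \<open>P\<close> and fixed by \<open>P\<close>, restricts to an invariant mean on \<open>P\<close>. The Haar measure of \<open>K\<close> is
  obtained from the same minimal sets.
\<close>

section \<open>Compact convex sets of functionals\<close>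

text \<open>Means are only finitely additive, so assertions about where \<open>x\<close> lives are
  made through the functions \<open>orbit_fn x f\<close>. These are invariant under right
  translation by \<open>P\<close> and, by the definition of the stabiliser, separate its cosets.
  Extremality says, for one \<open>f\<close> at a time, that the deviation of
  \<open>orbit_fn x f\<close> from \<open>x f\<close> has \<open>x\<close>-mean 0. Passing to
  statements about points needs the compactness of \<open>K\<close>: finitely many orbit functions
  separate a point from a compact set by a uniform gap, and a finite sum of functions of mean 0 has
  mean 0. Uniform functions are used because the product of two means requires
  \<open>orbit_fn w f\<close> to lie again in the domain of a mean. The product is continuous in its
  left factor; in the right factor continuity is proved only for point means and for the Haar mean.
  This is why \<open>x * x = x\<close> is obtained from the right convolution \<open>y * x\<close>,
  which is continuous in \<open>y\<close> and commutes with the group action. Functions on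
  \<open>P\<close> are extended to the group only up to an error, so the mean on \<open>P\<close> is
  defined as an upper integral.\<close>

lemma compact_functions_imp_closed:
  fixes S :: "('x \<Rightarrow> real) set"
  assumes "compact S"
  shows "closed S"
proof -
  have "Hausdorff_space (product_topology (\<lambda>i::'x. euclideanreal) UNIV)"
    by (simp add: Hausdorff_space_product_topology)
  then show ?thesis
    using assms compactin_imp_closedin by (fastforce simp: euclidean_product_topology)
qed

text \<open>Zorn's lemma is applied to complements in \<open>C\<close>, so that a maximal complement
  gives a minimal set; compactness keeps the intersection of a chain nonempty. Since
  \<open>Q\<close> need only survive intersections, the same argument yields minimal faces, minimal
  sets for a commuting family and irreducible invariant sets.\<close>

lemma minimal_compact_set:
  fixes C :: "('x \<Rightarrow> real) set"
  assumes C: "compact C" "C \<noteq> {}" "Q C"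
    and Inter: "\<And>\<S>. \<S> \<noteq> {} \<Longrightarrow> (\<And>S. S \<in> \<S> \<Longrightarrow> Q S) \<Longrightarrow> Q (\<Inter>\<S>)"
  obtains S where "compact S" "S \<noteq> {}" "S \<subseteq> C" "Q S"
    "\<And>S'. compact S' \<Longrightarrow> S' \<noteq> {} \<Longrightarrow> S' \<subseteq> S \<Longrightarrow> Q S' \<Longrightarrow> S' = S"
proof -
  define \<A> where "\<A> = {X. X \<subseteq> C \<and> (\<exists>S. compact S \<and> S \<noteq> {} \<and> S \<subseteq> C \<and> Q S \<and> X = C - S)}"
  have "\<exists>M\<in>\<A>. \<forall>X\<in>\<A>. M \<subseteq> X \<longrightarrow> X = M"
  proof (rule subset_Zorn_nonempty)
    show "\<A> \<noteq> {}"
      using C by (auto simp: \<A>_def)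
  next
    fix \<C> assume ne: "\<C> \<noteq> {}" and chain: "subset.chain \<A> \<C>"
    define \<S> where "\<S> = (\<lambda>X. C - X) ` \<C>"
    have sub: "\<C> \<subseteq> \<A>" and tot: "\<And>X Y. X \<in> \<C> \<Longrightarrow> Y \<in> \<C> \<Longrightarrow> X \<subseteq> Y \<or> Y \<subseteq> X"
      using chain by (auto simp: subset_chain_def)
    have S: "compact S \<and> S \<noteq> {} \<and> S \<subseteq> C \<and> Q S" if SS: "S \<in> \<S>" for S
    proof -
      obtain X where X: "X \<in> \<C>" "S = C - X"
        using SS by (auto simp: \<S>_def)
      with sub have "X \<in> \<A>" by blast
      with X(2)
      obtain S0 where S0: "compact S0 \<and> S0 \<noteq> {} \<and> S0 \<subseteq> C \<and> Q S0" "S = C - (C - S0)"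
        by (auto simp: \<A>_def)
      then have "S = S0" by blast
      with S0 show ?thesis by simp
    qed
    have Sne: "\<S> \<noteq> {}" using ne by (simp add: \<S>_def)
    have tot': "X \<subseteq> Y \<or> Y \<subseteq> X" if "X \<in> \<S>" "Y \<in> \<S>" for X Y
      using that tot by (fastforce simp: \<S>_def)
    \<comment> \<open>A finite nonempty part of a chain has its intersection in the chain; this is
      the input for the finite intersection property.\<close>
    have fin: "B \<noteq> {} \<Longrightarrow> B \<subseteq> \<S> \<Longrightarrow> \<Inter>B \<in> \<S>" if "finite B" for B
      using that
    proof (induction B rule: finite_induct)
      case (insert b B)
      show ?case
      proof (cases "B = {}")
        case False
        then have "\<Inter>B \<in> \<S>" "b \<in> \<S>" using insert by auto
        then show ?thesis using tot'[of b "\<Inter>B"]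
          by (metis Inter_insert inf.absorb1 inf.absorb2)
      qed (use insert in auto)
    qed simp
    have "C \<inter> \<Inter>\<S> \<noteq> {}"
    proof -
      have "closed a" if "a \<in> \<S>" for a
        using S[OF that] by (simp add: compact_functions_imp_closed)
      moreover have "C \<inter> \<Inter>B \<noteq> {}" if "B \<subseteq> \<S>" "finite B" for B
      proof (cases "B = {}")
        case False
        then have "\<Inter>B \<in> \<S>" using fin that by blast
        from S[OF this] show ?thesis by blast
      qed (use C in auto)
      ultimately show ?thesis
        using C(1) unfolding compact_fip by blast
    qed
    moreover have "\<Inter>\<S> \<subseteq> C" using Sne S by blast
    moreover have "compact (\<Inter>\<S>)"
    proof -
      have "closed (\<Inter>\<S>)"
        using S by (intro closed_Inter) (auto intro: compact_functions_imp_closed)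
      then have "compact (C \<inter> \<Inter>\<S>)" by (rule compact_Int_closed[OF C(1)])
      then show ?thesis using \<open>\<Inter>\<S> \<subseteq> C\<close> by (simp add: inf.absorb2)
    qed
    moreover have "Q (\<Inter>\<S>)"
      using Sne S by (intro Inter) auto
    moreover have "\<Union>\<C> = C - \<Inter>\<S>"
      using sub ne by (auto simp: \<S>_def \<A>_def)
    ultimately show "\<Union>\<C> \<in> \<A>"
      unfolding \<A>_def by blast
  qed
  then obtain M where M: "M \<in> \<A>" "\<And>X. X \<in> \<A> \<Longrightarrow> M \<subseteq> X \<Longrightarrow> X = M"
    by blast
  then obtain S where S: "compact S" "S \<noteq> {}" "S \<subseteq> C" "Q S" "M = C - S"
    by (auto simp: \<A>_def)
  show thesis
  proof (rule that[OF S(1-4)])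
    fix S' assume S': "compact S'" "S' \<noteq> {}" "S' \<subseteq> S" "Q S'"
    then have "C - S' \<in> \<A>"
      using S(3) unfolding \<A>_def by blast
    then have "C - S' = M"
      by (rule M(2)) (use S S' in auto)
    then show "S' = S"
      using S S' by blast
  qed
qed

section \<open>Convex combinations and extreme points\<close>

definition mix :: "real \<Rightarrow> ('x \<Rightarrow> real) \<Rightarrow> ('x \<Rightarrow> real) \<Rightarrow> 'x \<Rightarrow> real" where
  "mix c p q = (\<lambda>\<phi>. c * p \<phi> + (1 - c) * q \<phi>)"

definition convex_family :: "('x \<Rightarrow> real) set \<Rightarrow> bool" where
  "convex_family V \<longleftrightarrow> (\<forall>p\<in>V. \<forall>q\<in>V. \<forall>c. 0 \<le> c \<and> c \<le> 1 \<longrightarrow> mix c p q \<in> V)"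

definition extreme_in :: "('x \<Rightarrow> real) set \<Rightarrow> ('x \<Rightarrow> real) \<Rightarrow> bool" where
  "extreme_in V e \<longleftrightarrow>
     e \<in> V \<and> (\<forall>p\<in>V. \<forall>q\<in>V. \<forall>c. 0 < c \<and> c < 1 \<and> mix c p q = e \<longrightarrow> p = e \<and> q = e)"

lemma convex_familyD: "convex_family V \<Longrightarrow> p \<in> V \<Longrightarrow> q \<in> V \<Longrightarrow> 0 \<le> c \<Longrightarrow> c \<le> 1 \<Longrightarrow> mix c p q \<in> V"
  by (simp add: convex_family_def)

lemma extreme_inD:
  "extreme_in V e \<Longrightarrow> mix c p q = e \<Longrightarrow> p \<in> V \<Longrightarrow> q \<in> V \<Longrightarrow> 0 < c \<Longrightarrow> c < 1 \<Longrightarrow> p = e \<and> q = e"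
  unfolding extreme_in_def by blast

lemma convex_family_Inter: "(\<And>S. S \<in> \<S> \<Longrightarrow> convex_family S) \<Longrightarrow> convex_family (\<Inter>\<S>)"
  by (simp add: convex_family_def)

text \<open>The induction splits off one point and rescales the other weights by their sum
  \<open>s\<close>; when that sum is 0 these weights all vanish and no division is made.\<close>

lemma convex_family_sum:
  assumes "convex_family V" "finite I" "\<And>i. i \<in> I \<Longrightarrow> p i \<in> V" "\<And>i. i \<in> I \<Longrightarrow> (0::real) \<le> l i" "sum l I = 1"
  shows "(\<lambda>\<phi>. \<Sum>i\<in>I. l i * p i \<phi>) \<in> V"
  using assms(2-)
proof (induction I arbitrary: l rule: finite_induct)
  case (insert i I)
  show ?case
  proof (cases "sum l I = 0")
    case True
    then have "\<forall>j\<in>I. l j = 0"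
      using insert by (subst (asm) sum_nonneg_eq_0_iff) auto
    then have "(\<lambda>\<phi>. \<Sum>j\<in>insert i I. l j * p j \<phi>) = p i"
      using insert True by auto
    then show ?thesis using insert by simp
  next
    case False
    define s where "s = sum l I"
    have s: "s > 0" "l i = 1 - s"
      using False insert by (auto simp: s_def less_le sum_nonneg)
    have "(\<lambda>\<phi>. \<Sum>j\<in>I. (l j / s) * p j \<phi>) \<in> V"
      using insert s by (intro insert.IH) (auto simp: s_def sum_divide_distrib[symmetric])
    then have "mix (l i) (p i) (\<lambda>\<phi>. \<Sum>j\<in>I. (l j / s) * p j \<phi>) \<in> V"
      using insert.prems(1) insert.prems(2)[of i] s by (intro convex_familyD[OF assms(1)]) auto
    also have "mix (l i) (p i) (\<lambda>\<phi>. \<Sum>j\<in>I. (l j / s) * p j \<phi>) =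
        (\<lambda>\<phi>. \<Sum>j\<in>insert i I. l j * p j \<phi>)"
    proof
      fix \<phi>
      have "(\<Sum>j\<in>I. (l j / s) * p j \<phi>) = (\<Sum>j\<in>I. l j * p j \<phi>) / s"
        by (simp add: sum_divide_distrib)
      then show "mix (l i) (p i) (\<lambda>\<phi>. \<Sum>j\<in>I. (l j / s) * p j \<phi>) \<phi> = (\<Sum>j\<in>insert i I. l j * p j \<phi>)"
        using s insert.hyps by (simp add: mix_def)
    qed
    finally show ?thesis .
  qed
qed simp

lemma continuous_on_eval [continuous_intros]: "continuous_on S (\<lambda>p::'x \<Rightarrow> real. p \<phi>)"
  by (rule continuous_on_subset[OF continuous_on_product_coordinates subset_UNIV])

lemma continuous_on_mix [continuous_intros]:
  fixes f g :: "'y::topological_space \<Rightarrow> 'x \<Rightarrow> real"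
  assumes "continuous_on S f" "continuous_on S g"
  shows "continuous_on S (\<lambda>y. mix c (f y) (g y))"
  unfolding mix_def
  by (rule continuous_on_coordinatewise_then_product)
     (intro continuous_on_add continuous_on_mult continuous_on_const
      continuous_on_product_then_coordinatewise[OF assms(1)]
      continuous_on_product_then_coordinatewise[OF assms(2)])

text \<open>A minimal nonempty compact face is a single point: each evaluation attains a minimum on
  it, and the minimisers form a face again, hence the whole face. The predicate \<open>Q\<close> is
  the face property.\<close>

lemma extreme_exists:
  fixes V :: "('x \<Rightarrow> real) set"
  assumes "compact V" "V \<noteq> {}"
  obtains e where "extreme_in V e"
proof -
  define Q where "Q F \<longleftrightarrow> (\<forall>p\<in>V. \<forall>q\<in>V. \<forall>c. 0 < c \<and> c < 1 \<and> mix c p q \<in> F \<longrightarrow> p \<in> F \<and> q \<in> F)" for F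
  obtain F where F: "compact F" "F \<noteq> {}" "F \<subseteq> V" "Q F"
    and min: "\<And>F'. compact F' \<Longrightarrow> F' \<noteq> {} \<Longrightarrow> F' \<subseteq> F \<Longrightarrow> Q F' \<Longrightarrow> F' = F"
  proof (rule minimal_compact_set[of V Q])
    show "Q V" by (simp add: Q_def)
    show "Q (\<Inter>\<S>)" if "\<S> \<noteq> {}" "\<And>S. S \<in> \<S> \<Longrightarrow> Q S" for \<S>
      using that unfolding Q_def by blast
  qed (use assms in auto)
  have single: "p = q" if "p \<in> F" "q \<in> F" for p q
  proof
    fix \<phi>
    obtain r where r: "r \<in> F" "\<And>s. s \<in> F \<Longrightarrow> r \<phi> \<le> s \<phi>"
      using continuous_attains_inf[OF F(1,2) continuous_on_eval[of F \<phi>]] by blast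
    define F' where "F' = {s \<in> F. s \<phi> = r \<phi>}"
    have "F' = F"
    proof (rule min)
      show "compact F'"
        using continuous_closed_preimage_constant[OF continuous_on_eval[of F \<phi>] compact_functions_imp_closed[OF F(1)], of "r \<phi>"]
          compact_Int_closed[OF F(1)] unfolding F'_def
        by (metis (no_types, lifting) inf.absorb_iff2 mem_Collect_eq subsetI)
      show "F' \<noteq> {}" "F' \<subseteq> F" using r by (auto simp: F'_def)
      show "Q F'"
        unfolding Q_def
      proof (intro ballI allI impI)
        fix p q c assume pq: "p \<in> V" "q \<in> V" "0 < c \<and> c < 1 \<and> mix c p q \<in> F'"
        then have "p \<in> F" "q \<in> F" using F(4) by (auto simp: Q_def F'_def)
        then have ge: "r \<phi> \<le> p \<phi>" "r \<phi> \<le> q \<phi>" using r by auto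
        have "c * (p \<phi> - r \<phi>) + (1 - c) * (q \<phi> - r \<phi>) = 0"
          using pq by (simp add: F'_def mix_def algebra_simps)
        moreover have "c * (p \<phi> - r \<phi>) \<ge> 0" "(1 - c) * (q \<phi> - r \<phi>) \<ge> 0"
          using ge pq by auto
        ultimately have "c * (p \<phi> - r \<phi>) = 0" "(1 - c) * (q \<phi> - r \<phi>) = 0"
          by linarith+
        then show "p \<in> F' \<and> q \<in> F'"
          using pq \<open>p \<in> F\<close> \<open>q \<in> F\<close> by (auto simp: F'_def)
      qed
    qed
    then have "p \<in> F'" "q \<in> F'" using that by auto
    then show "p \<phi> = q \<phi>"
      by (simp add: F'_def)
  qed
  obtain e where e: "e \<in> F" using F by blast
  have "extreme_in V e"
    unfolding extreme_in_def using e F single unfolding Q_def by blast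
  then show thesis using that by blast
qed

section \<open>Affine maps and common fixed points\<close>

definition affine_map_on :: "('x \<Rightarrow> real) set \<Rightarrow> (('x \<Rightarrow> real) \<Rightarrow> ('y \<Rightarrow> real)) \<Rightarrow> bool" where
  "affine_map_on V t \<longleftrightarrow> (\<forall>p\<in>V. \<forall>q\<in>V. \<forall>c. t (mix c p q) = mix c (t p) (t q))"

lemma convex_family_image:
  assumes "convex_family V" "affine_map_on V t"
  shows "convex_family (t ` V)"
  unfolding convex_family_def
proof (intro ballI allI impI)
  fix p q and c :: real assume "p \<in> t ` V" "q \<in> t ` V" and c: "0 \<le> c \<and> c \<le> 1"
  then obtain p' q' where pq: "p' \<in> V" "q' \<in> V" "p = t p'" "q = t q'" by blast
  then have "mix c p q = t (mix c p' q')"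
    using assms(2) by (simp add: affine_map_on_def)
  moreover have "mix c p' q' \<in> V"
    using convex_familyD[OF assms(1)] pq c by blast
  ultimately show "mix c p q \<in> t ` V" by (rule image_eqI)
qed

text \<open>The interchange law for averages; it makes the average of two affine maps
  affine.\<close>

lemma mix_mix: "mix c (mix d p q) (mix d p' q') = mix d (mix c p p') (mix c q q')"
  by (rule ext) (simp add: mix_def algebra_simps)

text \<open>On a minimal invariant set, the average of \<open>t\<close> and the identity is onto; an extreme point is
  hence an average \<open>(t y + y) / 2\<close>, which forces \<open>t y = y\<close>.\<close>
theorem markov_kakutani:
  fixes V :: "('x \<Rightarrow> real) set"
  assumes V: "compact V" "V \<noteq> {}" "convex_family V"
    and cont: "\<And>i. i \<in> I \<Longrightarrow> continuous_on V (t i)"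
    and aff: "\<And>i. i \<in> I \<Longrightarrow> affine_map_on V (t i)"
    and maps: "\<And>i p. i \<in> I \<Longrightarrow> p \<in> V \<Longrightarrow> t i p \<in> V"
    and comm: "\<And>i j p. i \<in> I \<Longrightarrow> j \<in> I \<Longrightarrow> p \<in> V \<Longrightarrow> t i (t j p) = t j (t i p)"
  obtains e where "e \<in> V" "\<And>i. i \<in> I \<Longrightarrow> t i e = e"
proof -
  define Q where "Q W \<longleftrightarrow> convex_family W \<and> (\<forall>i\<in>I. \<forall>p\<in>W. t i p \<in> W)" for W
  obtain W where W: "compact W" "W \<noteq> {}" "W \<subseteq> V" "Q W"
    and min: "\<And>W'. compact W' \<Longrightarrow> W' \<noteq> {} \<Longrightarrow> W' \<subseteq> W \<Longrightarrow> Q W' \<Longrightarrow> W' = W"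
  proof (rule minimal_compact_set[of V Q])
    show "Q V" using V maps by (simp add: Q_def)
    show "Q (\<Inter>\<S>)" if "\<S> \<noteq> {}" "\<And>S. S \<in> \<S> \<Longrightarrow> Q S" for \<S>
      using that convex_family_Inter[of \<S>] unfolding Q_def by simp
  qed (use V in auto)
  obtain e where e: "extreme_in W e"
    using extreme_exists[OF W(1,2)] by blast
  have "t i e = e" if i: "i \<in> I" for i
  proof -
    define s where "s p = mix (1/2) (t i p) p" for p
    have sub: "s ` W \<subseteq> W"
      using W i by (auto simp: s_def Q_def intro!: convex_familyD)
    \<comment> \<open>Commutativity enters here: \<open>s\<close> commutes with every
      \<open>t j\<close>, so the image of \<open>W\<close> under \<open>s\<close> is again stable
      under the whole family.\<close>
    have ts: "t j (s p) = s (t j p)" if "j \<in> I" "p \<in> W" for j p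
    proof -
      have pt: "p \<in> V" "t i p \<in> V" using that W i by (auto simp: Q_def)
      then have "t j (mix (1/2) (t i p) p) = mix (1/2) (t j (t i p)) (t j p)"
        using aff[OF that(1)] unfolding affine_map_on_def by blast
      then show ?thesis
        using comm[OF that(1) i pt(1)] by (simp only: s_def)
    qed
    have "s ` W = W"
    proof (rule min)
      show "compact (s ` W)"
        unfolding s_def
        by (intro compact_continuous_image continuous_on_mix continuous_on_id W(1)
            continuous_on_subset[OF cont[OF i] W(3)])
      have "affine_map_on W s"
        unfolding affine_map_on_def
      proof (intro ballI allI)
        fix p q c assume "p \<in> W" "q \<in> W"
        then have "t i (mix c p q) = mix c (t i p) (t i q)"
          using aff[OF i] W(3) unfolding affine_map_on_def by blast
        then show "s (mix c p q) = mix c (s p) (s q)"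
          by (simp only: s_def mix_mix)
      qed
      then have "convex_family (s ` W)"
        using W(4) by (auto simp: Q_def intro: convex_family_image)
      then show "Q (s ` W)"
        using ts W(4) unfolding Q_def by (auto intro!: image_eqI[OF ts])
    qed (use W sub in auto)
    then obtain y where y: "y \<in> W" "e = s y"
      using e by (metis extreme_in_def imageE)
    then have "t i y = e \<and> y = e"
    proof -
      have "t i y \<in> W" using W(4) i y by (simp add: Q_def)
      moreover have "mix (1/2) (t i y) y = e" using y by (simp add: s_def)
      ultimately show ?thesis
        by (intro extreme_inD[OF e]) (use y(1) in auto)
    qed
    then show ?thesis by metis
  qed
  then show thesis
    using that e W by (auto simp: extreme_in_def)
qed

lemma open_function_nbhd:
  fixes p :: "'x \<Rightarrow> real"
  assumes "open S" "p \<in> S"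
  obtains J \<epsilon> where "finite J" "\<epsilon> > 0" "\<And>q. (\<And>\<phi>. \<phi> \<in> J \<Longrightarrow> \<bar>q \<phi> - p \<phi>\<bar> < \<epsilon>) \<Longrightarrow> q \<in> S"
proof -
  have "openin (product_topology (\<lambda>i. euclideanreal) UNIV) S"
    using assms(1) by (simp only: open_fun_def)
  from product_topology_open_contains_basis[OF this assms(2)]
  have "\<exists>X. p \<in> Pi\<^sub>E UNIV X \<and> (\<forall>i. open (X i)) \<and> finite {i. X i \<noteq> UNIV} \<and> Pi\<^sub>E UNIV X \<subseteq> S"
    by (simp only: open_openin topspace_euclidean)
  then obtain X where X: "p \<in> Pi\<^sub>E UNIV X" "\<forall>i. open (X i)" "finite {i. X i \<noteq> UNIV}" "Pi\<^sub>E UNIV X \<subseteq> S"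
    by (elim exE conjE)
  define J where "J = {i. X i \<noteq> UNIV}"
  have "\<exists>\<epsilon>>0. \<forall>y. \<bar>y - p i\<bar> < \<epsilon> \<longrightarrow> y \<in> X i" for i
    using X(1,2) unfolding open_dist dist_real_def by (metis PiE_E UNIV_I)
  then obtain d where d: "\<And>i. d i > 0" "\<And>i y. \<bar>y - p i\<bar> < d i \<Longrightarrow> y \<in> X i"
    by metis
  \<comment> \<open>The number 1 keeps the minimum defined when \<open>J\<close> is empty.\<close>
  define \<epsilon> where "\<epsilon> = Min (insert 1 (d ` J))"
  have fin: "finite J" using X J_def by simp
  show thesis
  proof (rule that[OF fin])
    show "\<epsilon> > 0" using fin d by (simp add: \<epsilon>_def)
    fix q assume q: "\<And>\<phi>. \<phi> \<in> J \<Longrightarrow> \<bar>q \<phi> - p \<phi>\<bar> < \<epsilon>"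
    have "q i \<in> X i" for i
    proof (cases "i \<in> J")
      case True
      then have "\<epsilon> \<le> d i" using fin by (simp add: \<epsilon>_def)
      then show ?thesis using q[OF True] d by fastforce
    qed (simp add: J_def)
    then show "q \<in> S" using X by auto
  qed
qed

section \<open>Uniform functions and their means\<close>

lemma continuous_map_realI:
  fixes f :: "'x \<Rightarrow> real"
  assumes "\<And>x \<epsilon>. \<epsilon> > 0 \<Longrightarrow> x \<in> topspace X \<Longrightarrow> \<exists>W. openin X W \<and> x \<in> W \<and> (\<forall>y\<in>W. \<bar>f y - f x\<bar> < \<epsilon>)"
  shows "continuous_map X euclideanreal f"
proof -
  have "\<forall>x\<in>topspace X. \<forall>\<epsilon>>0. \<exists>W. openin X W \<and> x \<in> W \<and> (\<forall>y\<in>W. f y \<in> ball (f x) \<epsilon>)"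
    using assms by (simp add: dist_real_def abs_minus_commute)
  then show ?thesis
    using Met_TC.continuous_map_to_metric[of X f] by (simp add: mtopology_is_euclidean mball_eq_ball)
qed

section \<open>Uniform functions on a topological group\<close>

locale top_group =
  fixes G :: "('a, 'b) monoid_scheme" (structure) and T :: "'a topology"
  assumes top_group: "topological_group G T"

sublocale top_group \<subseteq> group G
  using top_group by (simp add: topological_group_def)

context top_group
begin

abbreviation U :: "('a \<Rightarrow> real) set" where "U \<equiv> uniform_functions G T"

lemma topspace_carrier: "topspace T = carrier G"
  using top_group by (simp add: topological_group_def)

lemma continuous_mult: "continuous_map (prod_topology T T) T (\<lambda>(x, y). x \<otimes> y)"
  using top_group by (simp add: topological_group_def)

lemma continuous_mult_compose:
  assumes "continuous_map X T f" "continuous_map X T g"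
  shows "continuous_map X T (\<lambda>x. f x \<otimes> g x)"
proof -
  have "continuous_map X (prod_topology T T) (\<lambda>x. (f x, g x))"
    using assms by (simp add: continuous_map_paired)
  from continuous_map_compose[OF this continuous_mult] show ?thesis
    by (simp add: o_def)
qed

lemma continuous_inv_compose: "continuous_map X T f \<Longrightarrow> continuous_map X T (\<lambda>x. inv (f x))"
  using top_group continuous_map_compose[of X T f T "\<lambda>x. inv x"]
  by (simp add: topological_group_def o_def)

lemma continuous_const_compose: "g \<in> carrier G \<Longrightarrow> continuous_map X T (\<lambda>x. g)"
  by (simp add: topspace_carrier continuous_map_const)

lemma continuous_id: "continuous_map X X (\<lambda>x. x)"
  using continuous_map_id[of X] by (simp add: id_def)

lemma openin_preimage:
  assumes "continuous_map T T f" "openin T V"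
  shows "openin T {y \<in> carrier G. f y \<in> V}"
  using openin_continuous_map_preimage[OF assms] by (simp add: topspace_carrier)

lemma openin_right_translate:
  assumes "openin T V" "g \<in> carrier G"
  shows "openin T {y \<in> carrier G. y \<otimes> g \<in> V}"
  by (rule openin_preimage[OF continuous_mult_compose[OF continuous_id continuous_const_compose]])
     (use assms in simp_all)

lemma uniformD:
  assumes "f \<in> U" "\<epsilon> > 0"
  obtains V where "openin T V" "\<one> \<in> V" "\<And>v x. v \<in> V \<Longrightarrow> x \<in> carrier G \<Longrightarrow> \<bar>f (v \<otimes> x) - f x\<bar> < \<epsilon>"
proof -
  have "\<exists>V. openin T V \<and> \<one> \<in> V \<and> (\<forall>v\<in>V. \<forall>x\<in>carrier G. \<bar>f (v \<otimes> x) - f x\<bar> < \<epsilon>)"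
    using assms by (simp add: uniform_functions_def)
  then obtain V where "openin T V" "\<one> \<in> V" "\<forall>v\<in>V. \<forall>x\<in>carrier G. \<bar>f (v \<otimes> x) - f x\<bar> < \<epsilon>"
    by (elim exE conjE)
  then show thesis by (intro that[of V]) auto
qed

lemma uniform_bounded:
  assumes "f \<in> U"
  obtains B where "B > 0" "\<And>x. x \<in> carrier G \<Longrightarrow> \<bar>f x\<bar> \<le> B"
proof -
  have "bounded (f ` carrier G)" using assms by (simp add: uniform_functions_def)
  then obtain B where "B > 0" "\<forall>y\<in>f ` carrier G. norm y \<le> B"
    unfolding bounded_pos by blast
  then show thesis by (intro that[of B]) auto
qed

lemma uniformI:
  assumes "\<And>x. x \<in> carrier G \<Longrightarrow> \<bar>f x\<bar> \<le> B"
    and "\<And>\<epsilon>. \<epsilon> > 0 \<Longrightarrow> \<exists>V. openin T V \<and> \<one> \<in> V \<and> (\<forall>v\<in>V. \<forall>x\<in>carrier G. \<bar>f (v \<otimes> x) - f x\<bar> < \<epsilon>)"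
  shows "f \<in> U"
  using assms unfolding uniform_functions_def bounded_iff by (auto simp: real_norm_def)

lemma openin_carrier: "openin T V \<Longrightarrow> v \<in> V \<Longrightarrow> v \<in> carrier G"
  using openin_subset topspace_carrier by blast

lemma uniform_cong:
  assumes "f \<in> U" "\<And>x. x \<in> carrier G \<Longrightarrow> f x = f' x"
  shows "f' \<in> U"
proof -
  obtain B where B: "\<And>x. x \<in> carrier G \<Longrightarrow> \<bar>f x\<bar> \<le> B"
    using uniform_bounded[OF assms(1)] by blast
  show ?thesis
  proof (rule uniformI[of _ B])
    fix \<epsilon> :: real assume "\<epsilon> > 0"
    then obtain V where "openin T V" "\<one> \<in> V" "\<And>v x. v \<in> V \<Longrightarrow> x \<in> carrier G \<Longrightarrow> \<bar>f (v \<otimes> x) - f x\<bar> < \<epsilon>"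
      using uniformD[OF assms(1)] by metis
    then show "\<exists>V. openin T V \<and> \<one> \<in> V \<and> (\<forall>v\<in>V. \<forall>x\<in>carrier G. \<bar>f' (v \<otimes> x) - f' x\<bar> < \<epsilon>)"
      using assms(2) openin_carrier by (intro exI[of _ V]) auto
  qed (use B assms(2) in simp)
qed

text \<open>A function that oscillates no more than finitely many uniform functions do is bounded,
  by comparison with its value at \<open>\<one>\<close>, and its translations are controlled on the
  intersection of finitely many neighbourhoods. The closure of \<open>U\<close> under pointwise
  operations is derived from this; the empty family gives the constants.\<close>

lemma uniform_dominated:
  assumes J: "finite J" "\<And>j. j \<in> J \<Longrightarrow> F j \<in> U"
    and dom: "\<And>x y. x \<in> carrier G \<Longrightarrow> y \<in> carrier G \<Longrightarrow>
      \<bar>f x - f y\<bar> \<le> C * (\<Sum>j\<in>J. \<bar>F j x - F j y\<bar>)"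
  shows "f \<in> U"
proof -
  define D where "D = \<bar>C\<bar> + 1"
  have D: "D > 0" by (simp add: D_def)
  have dom': "\<bar>f x - f y\<bar> \<le> D * (\<Sum>j\<in>J. \<bar>F j x - F j y\<bar>)" if "x \<in> carrier G" "y \<in> carrier G" for x y
    using dom[OF that] mult_right_mono[of C D "\<Sum>j\<in>J. \<bar>F j x - F j y\<bar>"]
    by (force simp: D_def intro: sum_nonneg)
  have "\<forall>j\<in>J. \<exists>B. \<forall>x\<in>carrier G. \<bar>F j x\<bar> \<le> B"
    using uniform_bounded[OF J(2)] by metis
  then obtain B where B: "\<And>j x. j \<in> J \<Longrightarrow> x \<in> carrier G \<Longrightarrow> \<bar>F j x\<bar> \<le> B j" by metis
  show ?thesis
  proof (rule uniformI)
    fix x assume x: "x \<in> carrier G"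
    have "(\<Sum>j\<in>J. \<bar>F j x - F j \<one>\<bar>) \<le> (\<Sum>j\<in>J. 2 * B j)"
    proof (rule sum_mono)
      fix j assume "j \<in> J"
      from B[OF this x] B[OF this one_closed] show "\<bar>F j x - F j \<one>\<bar> \<le> 2 * B j" by linarith
    qed
    then have "D * (\<Sum>j\<in>J. \<bar>F j x - F j \<one>\<bar>) \<le> D * (\<Sum>j\<in>J. 2 * B j)"
      using D by (intro mult_left_mono) auto
    with dom'[OF x one_closed] show "\<bar>f x\<bar> \<le> \<bar>f \<one>\<bar> + D * (\<Sum>j\<in>J. 2 * B j)" by linarith
  next
    fix \<epsilon> :: real assume \<epsilon>: "\<epsilon> > 0"
    define \<delta> where "\<delta> = \<epsilon> / (D * (real (card J) + 1))"
    have \<delta>: "\<delta> > 0" using \<epsilon> D by (simp add: \<delta>_def)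
    have "\<forall>j\<in>J. \<exists>V. openin T V \<and> \<one> \<in> V \<and> (\<forall>v\<in>V. \<forall>x\<in>carrier G. \<bar>F j (v \<otimes> x) - F j x\<bar> < \<delta>)"
      using uniformD[OF J(2) \<delta>] by metis
    then obtain V where V: "\<And>j. j \<in> J \<Longrightarrow> openin T (V j)" "\<And>j. j \<in> J \<Longrightarrow> \<one> \<in> V j"
      "\<And>j v x. j \<in> J \<Longrightarrow> v \<in> V j \<Longrightarrow> x \<in> carrier G \<Longrightarrow> \<bar>F j (v \<otimes> x) - F j x\<bar> < \<delta>"
      by metis
    \<comment> \<open>Intersecting with the whole space keeps \<open>W\<close> open when
      \<open>J\<close> is empty.\<close>
    define W where "W = (\<Inter>j\<in>J. V j) \<inter> topspace T"
    have "\<bar>f (v \<otimes> x) - f x\<bar> < \<epsilon>" if "v \<in> W" "x \<in> carrier G" for v x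
    proof -
      have v: "v \<in> carrier G" using that by (simp add: W_def topspace_carrier)
      have "\<bar>f (v \<otimes> x) - f x\<bar> \<le> D * (\<Sum>j\<in>J. \<bar>F j (v \<otimes> x) - F j x\<bar>)"
        using dom' v that by simp
      also have "\<dots> \<le> D * (\<Sum>j\<in>J. \<delta>)"
        using D V(3) that by (intro mult_left_mono sum_mono) (auto simp: W_def less_imp_le)
      also have "\<dots> < D * (real (card J) + 1) * \<delta>"
        using D \<delta> by (simp add: algebra_simps)
      also have "\<dots> = \<epsilon>" using D by (simp add: \<delta>_def)
      finally show ?thesis .
    qed
    moreover have "openin T W" unfolding W_def by (rule openin_INT) (use J V in auto)
    moreover have "\<one> \<in> W" using V by (auto simp: W_def topspace_carrier)
    ultimately show "\<exists>V. openin T V \<and> \<one> \<in> V \<and> (\<forall>v\<in>V. \<forall>x\<in>carrier G. \<bar>f (v \<otimes> x) - f x\<bar> < \<epsilon>)"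
      by blast
  qed
qed

lemma uniform_lipschitz:
  assumes "f \<in> U" "\<And>x y. x \<in> carrier G \<Longrightarrow> y \<in> carrier G \<Longrightarrow> \<bar>h x - h y\<bar> \<le> C * \<bar>f x - f y\<bar>"
  shows "h \<in> U"
  by (rule uniform_dominated[of "{()}" "\<lambda>_. f" h C]) (use assms in auto)

lemma uniform_lipschitz2:
  assumes "f \<in> U" "g \<in> U"
    "\<And>x y. x \<in> carrier G \<Longrightarrow> y \<in> carrier G \<Longrightarrow> \<bar>h x - h y\<bar> \<le> C * (\<bar>f x - f y\<bar> + \<bar>g x - g y\<bar>)"
  shows "h \<in> U"
  by (rule uniform_dominated[of UNIV "\<lambda>b. if b then f else g" h C])
     (use assms in \<open>auto simp: UNIV_bool add.commute\<close>)

lemma uniform_const: "(\<lambda>x. c) \<in> U"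
  by (rule uniform_dominated[of "{}"]) auto

lemma uniform_add: "f \<in> U \<Longrightarrow> g \<in> U \<Longrightarrow> (\<lambda>x. f x + g x) \<in> U"
  by (rule uniform_lipschitz2[of f g _ 1]) auto

lemma uniform_diff: "f \<in> U \<Longrightarrow> g \<in> U \<Longrightarrow> (\<lambda>x. f x - g x) \<in> U"
  by (rule uniform_lipschitz2[of f g _ 1]) auto

lemma uniform_cmult: "f \<in> U \<Longrightarrow> (\<lambda>x. c * f x) \<in> U"
  by (rule uniform_lipschitz[of f _ "\<bar>c\<bar>"]) (auto simp: abs_mult[symmetric] algebra_simps)

lemma uniform_abs: "f \<in> U \<Longrightarrow> (\<lambda>x. \<bar>f x\<bar>) \<in> U"
  by (rule uniform_lipschitz[of f _ 1]) auto

lemma uniform_sum: "finite J \<Longrightarrow> (\<And>j. j \<in> J \<Longrightarrow> F j \<in> U) \<Longrightarrow> (\<lambda>x. \<Sum>j\<in>J. F j x) \<in> U"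
  by (induction J rule: finite_induct) (auto intro: uniform_const uniform_add)

lemma uniform_mult:
  assumes "f \<in> U" "g \<in> U"
  shows "(\<lambda>x. f x * g x) \<in> U"
proof -
  obtain B where B: "B > 0" "\<And>x. x \<in> carrier G \<Longrightarrow> \<bar>f x\<bar> \<le> B"
    using uniform_bounded[OF assms(1)] by blast
  obtain C where C: "C > 0" "\<And>x. x \<in> carrier G \<Longrightarrow> \<bar>g x\<bar> \<le> C"
    using uniform_bounded[OF assms(2)] by blast
  show ?thesis
  proof (rule uniform_lipschitz2[OF assms])
    fix x y assume xy: "x \<in> carrier G" "y \<in> carrier G"
    have "\<bar>f x * g x - f y * g y\<bar> = \<bar>(f x - f y) * g x + f y * (g x - g y)\<bar>"
      by (simp add: algebra_simps)
    also have "\<dots> \<le> \<bar>f x - f y\<bar> * \<bar>g x\<bar> + \<bar>f y\<bar> * \<bar>g x - g y\<bar>"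
      by (metis abs_mult abs_triangle_ineq)
    also have "\<dots> \<le> \<bar>f x - f y\<bar> * (B + C) + (B + C) * \<bar>g x - g y\<bar>"
      using B C xy by (intro add_mono mult_left_mono mult_right_mono) (auto intro: order_trans less_imp_le add_increasing add_increasing2)
    finally show "\<bar>f x * g x - f y * g y\<bar> \<le> (B + C) * (\<bar>f x - f y\<bar> + \<bar>g x - g y\<bar>)"
      by (simp add: algebra_simps)
  qed
qed

text \<open>Since \<open>g v x = (g v g^-1) (g x)\<close>, a conjugate of the neighbourhood that
  serves \<open>f\<close> serves its translate.\<close>

lemma uniform_shift:
  assumes f: "f \<in> U" and g: "g \<in> carrier G"
  shows "(\<lambda>x. f (g \<otimes> x)) \<in> U"
proof -
  obtain B where B: "\<And>x. x \<in> carrier G \<Longrightarrow> \<bar>f x\<bar> \<le> B"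
    using uniform_bounded[OF f] by blast
  show ?thesis
  proof (rule uniformI[of _ B])
    fix \<epsilon> :: real assume "\<epsilon> > 0"
    then obtain V where V: "openin T V" "\<one> \<in> V" "\<And>v x. v \<in> V \<Longrightarrow> x \<in> carrier G \<Longrightarrow> \<bar>f (v \<otimes> x) - f x\<bar> < \<epsilon>"
      using uniformD[OF f] by metis
    define W where "W = {v \<in> carrier G. g \<otimes> v \<otimes> inv g \<in> V}"
    have "openin T W"
      unfolding W_def using g
      by (intro openin_preimage[OF _ V(1)] continuous_mult_compose continuous_const_compose continuous_id)
         simp_all
    moreover have "\<one> \<in> W" using V g by (simp add: W_def)
    moreover have "\<bar>f (g \<otimes> (v \<otimes> x)) - f (g \<otimes> x)\<bar> < \<epsilon>" if "v \<in> W" "x \<in> carrier G" for v x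
    proof -
      have "g \<otimes> (v \<otimes> x) = (g \<otimes> v \<otimes> inv g) \<otimes> (g \<otimes> x)"
        using that g by (simp add: W_def m_assoc inv_solve_left)
      then show ?thesis using V(3)[of "g \<otimes> v \<otimes> inv g" "g \<otimes> x"] that g by (simp add: W_def)
    qed
    ultimately show "\<exists>V. openin T V \<and> \<one> \<in> V \<and> (\<forall>v\<in>V. \<forall>x\<in>carrier G. \<bar>f (g \<otimes> (v \<otimes> x)) - f (g \<otimes> x)\<bar> < \<epsilon>)"
      by blast
  qed (use B g in simp)
qed

lemma uniform_continuous:
  assumes f: "f \<in> U"
  shows "continuous_map T euclideanreal f"
proof (rule continuous_map_realI)
  fix x and \<epsilon> :: real assume \<epsilon>: "\<epsilon> > 0" and "x \<in> topspace T"
  then have x: "x \<in> carrier G" by (simp add: topspace_carrier)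
  show "\<exists>W. openin T W \<and> x \<in> W \<and> (\<forall>y\<in>W. \<bar>f y - f x\<bar> < \<epsilon>)"
  proof -
    obtain V where V: "openin T V" "\<one> \<in> V" "\<And>v x. v \<in> V \<Longrightarrow> x \<in> carrier G \<Longrightarrow> \<bar>f (v \<otimes> x) - f x\<bar> < \<epsilon>"
      using uniformD[OF f \<open>\<epsilon> > 0\<close>] by metis
    have "\<bar>f y - f x\<bar> < \<epsilon>" if "y \<in> carrier G" "y \<otimes> inv x \<in> V" for y
      using V(3)[OF that(2) x] that x by (simp add: m_assoc)
    then show ?thesis
      using openin_right_translate[OF V(1), of "inv x"] V(2) x
      by (intro exI[of _ "{y \<in> carrier G. y \<otimes> inv x \<in> V}"]) auto
  qed
qed

text \<open>The value 0 outside \<open>U\<close> makes a mean determined by its values on uniform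
  functions: means that agree on \<open>U\<close> are equal as functions, and the set of means
  embeds in a product of compact intervals.\<close>

definition means :: "(('a \<Rightarrow> real) \<Rightarrow> real) set" where
  "means = {m. (\<forall>f\<in>U. \<forall>g\<in>U. m (\<lambda>x. f x + g x) = m f + m g) \<and>
     (\<forall>f\<in>U. \<forall>c. m (\<lambda>x. c * f x) = c * m f) \<and>
     (\<forall>f\<in>U. (\<forall>x\<in>carrier G. f x \<ge> 0) \<longrightarrow> m f \<ge> 0) \<and>
     m (\<lambda>x. 1) = 1 \<and> (\<forall>f. f \<notin> U \<longrightarrow> m f = 0)}"

lemma mean_add: "m \<in> means \<Longrightarrow> f \<in> U \<Longrightarrow> g \<in> U \<Longrightarrow> m (\<lambda>x. f x + g x) = m f + m g"
  by (simp add: means_def)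

lemma mean_cmult: "m \<in> means \<Longrightarrow> f \<in> U \<Longrightarrow> m (\<lambda>x. c * f x) = c * m f"
  by (simp add: means_def)

lemma mean_nonneg: "m \<in> means \<Longrightarrow> f \<in> U \<Longrightarrow> (\<And>x. x \<in> carrier G \<Longrightarrow> f x \<ge> 0) \<Longrightarrow> m f \<ge> 0"
  by (simp add: means_def)

lemma mean_one: "m \<in> means \<Longrightarrow> m (\<lambda>x. 1) = 1"
  by (simp add: means_def)

lemma mean_outside: "m \<in> means \<Longrightarrow> f \<notin> U \<Longrightarrow> m f = 0"
  by (simp add: means_def)

lemma mean_const: "m \<in> means \<Longrightarrow> m (\<lambda>x. c) = c"
  using mean_cmult[OF _ uniform_const, of m c 1] mean_one[of m] by simp

lemma mean_diff: "m \<in> means \<Longrightarrow> f \<in> U \<Longrightarrow> g \<in> U \<Longrightarrow> m (\<lambda>x. f x - g x) = m f - m g"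
  using mean_add[of m f "\<lambda>x. (-1) * g x"] mean_cmult[of m g "-1"] uniform_cmult[of g "-1"]
  by simp

lemma mean_mono:
  assumes "m \<in> means" "f \<in> U" "g \<in> U" "\<And>x. x \<in> carrier G \<Longrightarrow> f x \<le> g x"
  shows "m f \<le> m g"
  using mean_nonneg[OF assms(1) uniform_diff[OF assms(3,2)]] mean_diff[OF assms(1,3,2)] assms(4)
  by simp

lemma mean_cong:
  assumes "m \<in> means" "\<And>x. x \<in> carrier G \<Longrightarrow> f x = g x"
  shows "m f = m g"
proof (cases "f \<in> U")
  case True
  then have "g \<in> U" using uniform_cong assms(2) by blast
  then have "m f \<le> m g" "m g \<le> m f"
    using mean_mono[OF assms(1) True, of g] mean_mono[OF assms(1) _ True, of g] assms(2) by auto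
  then show ?thesis by (rule antisym)
next
  case False
  then have "g \<notin> U" using uniform_cong[of g f] assms(2) by auto
  then show ?thesis
    using mean_outside[OF assms(1) False] mean_outside[OF assms(1), of g] by simp
qed

lemma mean_sum:
  assumes m: "m \<in> means" and "finite J" "\<And>j. j \<in> J \<Longrightarrow> F j \<in> U"
  shows "m (\<lambda>x. \<Sum>j\<in>J. F j x) = (\<Sum>j\<in>J. m (F j))"
  using assms(2,3)
proof (induction J rule: finite_induct)
  case empty
  then show ?case by (simp add: mean_const[OF m])
next
  case (insert j J)
  have "m (\<lambda>x. \<Sum>j\<in>insert j J. F j x) = m (\<lambda>x. F j x + (\<Sum>j\<in>J. F j x))"
    using insert.hyps by simp
  also have "\<dots> = m (F j) + m (\<lambda>x. \<Sum>j\<in>J. F j x)"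
    using insert by (intro mean_add[OF m] uniform_sum) auto
  finally show ?case using insert by simp
qed

lemma mean_le: "m \<in> means \<Longrightarrow> f \<in> U \<Longrightarrow> (\<And>x. x \<in> carrier G \<Longrightarrow> f x \<le> B) \<Longrightarrow> m f \<le> B"
  using mean_mono[of m f "\<lambda>x. B"] uniform_const[of B] mean_const[of m B] by simp

lemma mean_ge: "m \<in> means \<Longrightarrow> f \<in> U \<Longrightarrow> (\<And>x. x \<in> carrier G \<Longrightarrow> B \<le> f x) \<Longrightarrow> B \<le> m f"
  using mean_mono[of m "\<lambda>x. B" f] uniform_const[of B] mean_const[of m B] by simp

lemma mean_abs_bound: "m \<in> means \<Longrightarrow> f \<in> U \<Longrightarrow> (\<And>x. x \<in> carrier G \<Longrightarrow> \<bar>f x\<bar> \<le> B) \<Longrightarrow> \<bar>m f\<bar> \<le> B"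
  using mean_le[of m f B] mean_ge[of m f "-B"] by (fastforce simp: abs_le_iff)

lemma mean_dist:
  assumes "m \<in> means" "f \<in> U" "g \<in> U" "\<And>x. x \<in> carrier G \<Longrightarrow> \<bar>f x - g x\<bar> \<le> B"
  shows "\<bar>m f - m g\<bar> \<le> B"
  using mean_abs_bound[OF assms(1) uniform_diff[OF assms(2,3)] assms(4)] mean_diff[OF assms(1-3)]
  by simp

lemma mix_means:
  assumes "m \<in> means" "n \<in> means" "0 \<le> c" "c \<le> 1"
  shows "mix c m n \<in> means"
  unfolding means_def mem_Collect_eq
proof (intro conjI ballI allI impI)
  fix f g assume "f \<in> U" "g \<in> U"
  then show "mix c m n (\<lambda>x. f x + g x) = mix c m n f + mix c m n g"
    by (simp add: mix_def mean_add[OF assms(1)] mean_add[OF assms(2)] algebra_simps)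
next
  fix f and d :: real assume "f \<in> U"
  then show "mix c m n (\<lambda>x. d * f x) = d * mix c m n f"
    by (simp add: mix_def mean_cmult[OF assms(1)] mean_cmult[OF assms(2)] algebra_simps)
next
  fix f assume "f \<in> U" "\<forall>x\<in>carrier G. 0 \<le> f x"
  then show "0 \<le> mix c m n f"
    using assms mean_nonneg[OF assms(1), of f] mean_nonneg[OF assms(2), of f] by (simp add: mix_def)
qed (auto simp: mix_def mean_one[OF assms(1)] mean_one[OF assms(2)]
    mean_outside[OF assms(1)] mean_outside[OF assms(2)])

lemma convex_means: "convex_family means"
  by (simp add: convex_family_def mix_means)

text \<open>Weak-star compactness: the bounds of the functions in \<open>U\<close> cut out a product
  of compact intervals, and each defining condition is closed because it involves finitely many
  coordinates.\<close>

lemma compact_means: "compact means"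
proof -
  have "\<forall>f\<in>U. \<exists>B. \<forall>x\<in>carrier G. \<bar>f x\<bar> \<le> B"
    using uniform_bounded by metis
  then obtain B where B: "\<And>f x. f \<in> U \<Longrightarrow> x \<in> carrier G \<Longrightarrow> \<bar>f x\<bar> \<le> B f" by metis
  have "compactin (product_topology (\<lambda>i. euclideanreal) UNIV)
      (Pi\<^sub>E UNIV (\<lambda>f. if f \<in> U then {- B f..B f} else {0}))"
    by (simp add: compactin_PiE)
  then have K: "compact (Pi\<^sub>E UNIV (\<lambda>f. if f \<in> U then {- B f..B f} else {0}))"
    by (simp only: euclidean_product_topology compactin_euclidean_iff)
  have sub: "means \<subseteq> Pi\<^sub>E UNIV (\<lambda>f. if f \<in> U then {- B f..B f} else {0})"
  proof
    fix m assume m: "m \<in> means"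
    have "m f \<in> (if f \<in> U then {- B f..B f} else {0})" for f
      using mean_abs_bound[OF m, of f "B f"] B mean_outside[OF m, of f] by (auto simp: abs_le_iff)
    then show "m \<in> Pi\<^sub>E UNIV (\<lambda>f. if f \<in> U then {- B f..B f} else {0})" by auto
  qed
  have ev: "continuous_on UNIV (\<lambda>m::('a \<Rightarrow> real) \<Rightarrow> real. m f)" for f
    by (rule continuous_on_eval)
  have "means = (\<Inter>f\<in>U. \<Inter>g\<in>U. {m. m (\<lambda>x. f x + g x) = m f + m g}) \<inter>
     (\<Inter>f\<in>U. \<Inter>c. {m. m (\<lambda>x. c * f x) = c * m f}) \<inter>
     (\<Inter>f\<in>{f\<in>U. \<forall>x\<in>carrier G. f x \<ge> 0}. {m. 0 \<le> m f}) \<inter>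
     {m. m (\<lambda>x. 1) = 1} \<inter> (\<Inter>f\<in>-U. {m. m f = 0})"
    unfolding means_def by auto
  moreover have "closed \<dots>"
    by (intro closed_Int closed_INT ballI closed_Collect_eq closed_Collect_le
        continuous_on_add continuous_on_mult continuous_on_const ev)
  ultimately have "closed means" by simp
  then show ?thesis
    using compact_Int_closed[OF K, of means] by (simp only: inf_absorb2[OF sub])
qed

definition point_mean :: "'a \<Rightarrow> ('a \<Rightarrow> real) \<Rightarrow> real" where
  "point_mean g = (\<lambda>f. if f \<in> U then f g else 0)"

lemma point_mean: "g \<in> carrier G \<Longrightarrow> point_mean g \<in> means"
  by (auto simp: means_def point_mean_def uniform_add uniform_cmult uniform_const)

text \<open>The group acts on means by convolution with point means, and
  \<open>orbit_fn w f g\<close> is the value at \<open>f\<close> of the translate of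
  \<open>w\<close> by \<open>g\<close>. The oscillation condition in
  \<open>uniform_functions\<close> concerns left translation, which is what makes
  \<open>orbit_fn w f\<close> uniform again.\<close>

definition orbit_fn :: "(('a \<Rightarrow> real) \<Rightarrow> real) \<Rightarrow> ('a \<Rightarrow> real) \<Rightarrow> 'a \<Rightarrow> real" where
  "orbit_fn w f g = w (\<lambda>x. f (g \<otimes> x))"

text \<open>The Arens product of functionals, which extends the convolution of measures:
  \<open>w\<close> is applied to \<open>f (g x)\<close> in the variable \<open>x\<close>, then
  \<open>m\<close> to the result in the variable \<open>g\<close>. It is affine in both factors and
  continuous in \<open>m\<close> for pointwise convergence; continuity in \<open>w\<close> is a
  separate matter that depends on \<open>m\<close>.\<close>

definition conv :: "(('a \<Rightarrow> real) \<Rightarrow> real) \<Rightarrow> (('a \<Rightarrow> real) \<Rightarrow> real) \<Rightarrow> ('a \<Rightarrow> real) \<Rightarrow> real" where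
  "conv m w f = (if f \<in> U then m (orbit_fn w f) else 0)"

lemma orbit_fn_one: "w \<in> means \<Longrightarrow> orbit_fn w f \<one> = w f"
  unfolding orbit_fn_def by (rule mean_cong) auto

lemma orbit_fn_bound:
  assumes "w \<in> means" "f \<in> U" "\<And>x. x \<in> carrier G \<Longrightarrow> \<bar>f x\<bar> \<le> B" "g \<in> carrier G"
  shows "\<bar>orbit_fn w f g\<bar> \<le> B"
  unfolding orbit_fn_def by (rule mean_abs_bound) (use assms in \<open>auto simp: uniform_shift\<close>)

lemma orbit_fn_dist:
  assumes "w \<in> means" "f \<in> U" "v \<in> carrier G" "g \<in> carrier G"
    "\<And>x. x \<in> carrier G \<Longrightarrow> \<bar>f (v \<otimes> x) - f x\<bar> \<le> \<epsilon>"
  shows "\<bar>orbit_fn w f (v \<otimes> g) - orbit_fn w f g\<bar> \<le> \<epsilon>"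
  unfolding orbit_fn_def
  by (rule mean_dist) (use assms in \<open>auto simp: uniform_shift m_assoc\<close>)

lemma orbit_fn_uniform:
  assumes w: "w \<in> means" and f: "f \<in> U"
  shows "orbit_fn w f \<in> U"
proof -
  obtain B where "\<And>x. x \<in> carrier G \<Longrightarrow> \<bar>f x\<bar> \<le> B"
    using uniform_bounded[OF f] by blast
  then show ?thesis
  proof (rule uniformI[OF orbit_fn_bound[OF w f]])
    fix \<epsilon> :: real assume "\<epsilon> > 0"
    then obtain V where V: "openin T V" "\<one> \<in> V" "\<And>v x. v \<in> V \<Longrightarrow> x \<in> carrier G \<Longrightarrow> \<bar>f (v \<otimes> x) - f x\<bar> < \<epsilon>/2"
      using uniformD[OF f, of "\<epsilon>/2"] by auto
    have "\<bar>orbit_fn w f (v \<otimes> x) - orbit_fn w f x\<bar> \<le> \<epsilon>/2" if "v \<in> V" "x \<in> carrier G" for v x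
      using orbit_fn_dist[OF w f openin_carrier[OF V(1) that(1)] that(2)] V(3) that by (meson less_imp_le)
    then have "\<bar>orbit_fn w f (v \<otimes> x) - orbit_fn w f x\<bar> < \<epsilon>" if "v \<in> V" "x \<in> carrier G" for v x
      using that \<open>\<epsilon> > 0\<close> by fastforce
    then show "\<exists>V. openin T V \<and> \<one> \<in> V \<and> (\<forall>v\<in>V. \<forall>x\<in>carrier G. \<bar>orbit_fn w f (v \<otimes> x) - orbit_fn w f x\<bar> < \<epsilon>)"
      using V by blast
  qed
qed

lemma orbit_fn_shift:
  assumes "w \<in> means" "g \<in> carrier G" "h \<in> carrier G"
  shows "orbit_fn w (\<lambda>x. f (g \<otimes> x)) h = orbit_fn w f (g \<otimes> h)"
  unfolding orbit_fn_def by (rule mean_cong) (use assms in \<open>auto simp: m_assoc\<close>)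

lemma orbit_fn_conv:
  assumes "m \<in> means" "w \<in> means" "f \<in> U" "g \<in> carrier G"
  shows "orbit_fn (conv m w) f g = m (\<lambda>h. orbit_fn w f (g \<otimes> h))"
proof -
  have "orbit_fn (conv m w) f g = m (orbit_fn w (\<lambda>x. f (g \<otimes> x)))"
    using assms by (simp add: orbit_fn_def[of "conv m w"] conv_def uniform_shift)
  also have "\<dots> = m (\<lambda>h. orbit_fn w f (g \<otimes> h))"
    by (rule mean_cong) (use assms in \<open>auto simp: orbit_fn_shift\<close>)
  finally show ?thesis .
qed

lemma conv_means:
  assumes "m \<in> means" "w \<in> means"
  shows "conv m w \<in> means"
  unfolding means_def mem_Collect_eq
proof (intro conjI ballI allI impI)
  fix f g assume fg: "f \<in> U" "g \<in> U"
  have "m (orbit_fn w (\<lambda>x. f x + g x)) = m (\<lambda>x. orbit_fn w f x + orbit_fn w g x)"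
    by (rule mean_cong[OF assms(1)]) (use fg in \<open>simp add: orbit_fn_def mean_add[OF assms(2)] uniform_shift\<close>)
  then show "conv m w (\<lambda>x. f x + g x) = conv m w f + conv m w g"
    using assms(2) fg by (simp add: conv_def uniform_add mean_add[OF assms(1)] orbit_fn_uniform)
next
  fix f and d :: real assume f: "f \<in> U"
  have "m (orbit_fn w (\<lambda>x. d * f x)) = m (\<lambda>x. d * orbit_fn w f x)"
    by (rule mean_cong[OF assms(1)]) (use f in \<open>simp add: orbit_fn_def mean_cmult[OF assms(2)] uniform_shift\<close>)
  then show "conv m w (\<lambda>x. d * f x) = d * conv m w f"
    using assms(2) f by (simp add: conv_def uniform_cmult mean_cmult[OF assms(1)] orbit_fn_uniform)
next
  fix f assume f: "f \<in> U" "\<forall>x\<in>carrier G. 0 \<le> f x"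
  have "0 \<le> orbit_fn w f x" if "x \<in> carrier G" for x
    unfolding orbit_fn_def by (rule mean_nonneg) (use assms f that in \<open>auto simp: uniform_shift\<close>)
  then show "0 \<le> conv m w f"
    using assms(2) f(1) by (simp add: conv_def mean_nonneg[OF assms(1)] orbit_fn_uniform)
next
  have "m (orbit_fn w (\<lambda>x. 1)) = m (\<lambda>x. 1)"
    by (rule mean_cong[OF assms(1)]) (simp add: orbit_fn_def mean_one[OF assms(2)])
  then show "conv m w (\<lambda>x. 1) = 1"
    by (simp add: conv_def uniform_const mean_one[OF assms(1)])
qed (simp add: conv_def)

lemma mean_eqI: "m \<in> means \<Longrightarrow> n \<in> means \<Longrightarrow> (\<And>f. f \<in> U \<Longrightarrow> m f = n f) \<Longrightarrow> m = n"
  by (rule ext) (metis mean_outside)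

lemma conv_assoc:
  assumes "m \<in> means" "n \<in> means" "w \<in> means"
  shows "conv (conv m n) w = conv m (conv n w)"
proof (rule mean_eqI)
  fix f assume f: "f \<in> U"
  have "conv (conv m n) w f = m (orbit_fn n (orbit_fn w f))"
    using assms f by (simp add: conv_def orbit_fn_uniform)
  also have "\<dots> = m (orbit_fn (conv n w) f)"
    by (rule mean_cong[OF assms(1)])
       (use assms f in \<open>simp add: orbit_fn_conv\<close>, simp add: orbit_fn_def)
  also have "\<dots> = conv m (conv n w) f"
    using f by (simp add: conv_def)
  finally show "conv (conv m n) w f = conv m (conv n w) f" .
qed (use assms in \<open>auto intro: conv_means\<close>)

lemma conv_point_mean: "g \<in> carrier G \<Longrightarrow> w \<in> means \<Longrightarrow> f \<in> U \<Longrightarrow> conv (point_mean g) w f = orbit_fn w f g"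
  by (simp add: conv_def point_mean_def orbit_fn_uniform)

lemma conv_point_mean_mult:
  assumes "g \<in> carrier G" "h \<in> carrier G" "w \<in> means"
  shows "conv (point_mean g) (conv (point_mean h) w) = conv (point_mean (g \<otimes> h)) w"
proof (rule mean_eqI)
  fix f assume f: "f \<in> U"
  have "conv (point_mean g) (conv (point_mean h) w) f = orbit_fn (conv (point_mean h) w) f g"
    using assms f by (simp add: conv_point_mean conv_means point_mean)
  also have "\<dots> = point_mean h (\<lambda>h. orbit_fn w f (g \<otimes> h))"
    using assms f by (simp add: orbit_fn_conv point_mean)
  also have "\<dots> = orbit_fn w f (g \<otimes> h)"
    using assms f by (simp add: point_mean_def uniform_shift orbit_fn_uniform)
  finally show "conv (point_mean g) (conv (point_mean h) w) f = conv (point_mean (g \<otimes> h)) w f"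
    using assms f by (simp add: conv_point_mean)
qed (use assms in \<open>auto intro!: conv_means point_mean\<close>)

lemma conv_point_mean_one: "w \<in> means \<Longrightarrow> conv (point_mean \<one>) w = w"
  by (rule mean_eqI) (auto simp: conv_point_mean orbit_fn_one intro: conv_means point_mean)

lemma conv_mix_left: "conv (mix c m n) w = mix c (conv m w) (conv n w)"
  by (rule ext) (simp add: conv_def mix_def)

lemma conv_mix_right:
  assumes "m \<in> means" "v \<in> means" "w \<in> means"
  shows "conv m (mix c v w) = mix c (conv m v) (conv m w)"
proof
  fix f show "conv m (mix c v w) f = mix c (conv m v) (conv m w) f"
  proof (cases "f \<in> U")
    case True
    have "orbit_fn (mix c v w) f = (\<lambda>x. c * orbit_fn v f x + (1 - c) * orbit_fn w f x)"
      by (simp add: orbit_fn_def mix_def fun_eq_iff)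
    then show ?thesis
      using True assms(2,3)
      by (simp add: conv_def mix_def mean_add[OF assms(1)] mean_cmult[OF assms(1)] uniform_cmult orbit_fn_uniform)
  qed (simp add: conv_def mix_def)
qed

lemma continuous_on_conv_left: "continuous_on S (\<lambda>m. conv m w)"
proof (rule continuous_on_coordinatewise_then_product)
  show "continuous_on S (\<lambda>m. conv m w f)" for f
    by (cases "f \<in> U") (simp_all add: conv_def continuous_on_eval)
qed

lemma continuous_on_conv_point:
  assumes "g \<in> carrier G" "S \<subseteq> means"
  shows "continuous_on S (conv (point_mean g))"
proof (rule continuous_on_coordinatewise_then_product)
  fix f show "continuous_on S (\<lambda>m. conv (point_mean g) m f)"
  proof (cases "f \<in> U")
    case True
    have "conv (point_mean g) m f = m (\<lambda>x. f (g \<otimes> x))" if "m \<in> S" for m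
      using True assms that by (auto simp: conv_point_mean orbit_fn_def)
    then show ?thesis
      by (simp add: continuous_on_eval cong: continuous_on_cong)
  qed (simp add: conv_def)
qed

end

section \<open>Irreducible sets of means\<close>

lemma compact_pos_lower_bound:
  fixes q :: "'x \<Rightarrow> real"
  assumes "compactin X K" "continuous_map X euclideanreal q" "\<And>x. x \<in> K \<Longrightarrow> q x > 0"
  obtains \<delta> where "\<delta> > 0" "\<And>x. x \<in> K \<Longrightarrow> \<delta> \<le> q x"
proof (cases "K = {}")
  case True
  then show thesis using that[of 1] by simp
next
  case False
  have "compact (q ` K)"
    using image_compactin[OF assms(1,2)] by simp
  then obtain s where "s \<in> q ` K" "\<forall>t\<in>q ` K. s \<le> t"
    using compact_attains_inf[of "q ` K"] False by auto
  then show thesis using that[of s] assms(3) by auto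
qed

text \<open>Compactness turns a nonnegative family without common zero on \<open>K\<close> into a
  finite subfamily whose sum has a positive lower bound there. Such a uniform bound, unlike
  pointwise positivity, is seen by a finitely additive mean.\<close>

lemma finite_separation:
  fixes q :: "'i \<Rightarrow> 'x \<Rightarrow> real"
  assumes K: "compactin X K"
    and cont: "\<And>i. i \<in> A \<Longrightarrow> continuous_map X euclideanreal (q i)"
    and nonneg: "\<And>i x. i \<in> A \<Longrightarrow> q i x \<ge> 0"
    and sep: "\<And>x. x \<in> K \<Longrightarrow> \<exists>i\<in>A. q i x > 0"
  obtains J \<delta> where "finite J" "J \<subseteq> A" "\<delta> > 0" "\<And>x. x \<in> K \<Longrightarrow> \<delta> \<le> (\<Sum>i\<in>J. q i x)"
proof -
  define W where "W i = {x \<in> topspace X. q i x \<in> {0<..}}" for i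
  have W: "openin X (W i)" if "i \<in> A" for i
    unfolding W_def by (rule openin_continuous_map_preimage[OF cont[OF that]]) simp
  have "K \<subseteq> \<Union>(W ` A)"
    using sep compactin_subset_topspace[OF K] by (fastforce simp: W_def)
  then obtain \<F> where F: "finite \<F>" "\<F> \<subseteq> W ` A" "K \<subseteq> \<Union>\<F>"
    using compactinD[OF K, of "W ` A"] W by blast
  obtain J where J: "finite J" "J \<subseteq> A" "\<F> = W ` J"
    using finite_subset_image[OF F(1,2)] by blast
  have "(\<Sum>i\<in>J. q i x) > 0" if x: "x \<in> K" for x
  proof -
    obtain i where "i \<in> J" "q i x > 0"
      using F(3) x unfolding J(3) by (auto simp: W_def)
    then show ?thesis
      by (intro sum_pos2[OF J(1), of i]) (use J(2) nonneg in auto)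
  qed
  moreover have "continuous_map X euclideanreal (\<lambda>x. \<Sum>i\<in>J. q i x)"
    using J cont by (intro continuous_map_sum) auto
  ultimately obtain \<delta> where "\<delta> > 0" "\<And>x. x \<in> K \<Longrightarrow> \<delta> \<le> (\<Sum>i\<in>J. q i x)"
    using compact_pos_lower_bound[OF K] by blast
  then show thesis using that J by blast
qed

context top_group
begin

text \<open>The vectors of values \<open>F j g\<close> form a bounded, hence totally bounded, subset
  of a finite-dimensional space. The net arises by rounding the coordinates to multiples of
  \<open>\<delta>\<close> and keeping one group element for each pattern that occurs.\<close>

lemma finite_net:
  assumes J: "finite J" "\<And>j. j \<in> J \<Longrightarrow> F j \<in> U" and \<epsilon>: "\<epsilon> > 0"
  obtains I where "finite I" "I \<subseteq> carrier G"
    "\<And>g. g \<in> carrier G \<Longrightarrow> \<exists>i\<in>I. (\<Sum>j\<in>J. \<bar>F j g - F j i\<bar>) < \<epsilon>"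
proof -
  \<comment> \<open>The summand 1 allows an empty \<open>J\<close> and makes the total error
    strictly smaller than \<open>\<epsilon>\<close>.\<close>
  define \<delta> where "\<delta> = \<epsilon> / (real (card J) + 1)"
  have \<delta>: "\<delta> > 0" using \<epsilon> by (simp add: \<delta>_def)
  have "\<forall>j\<in>J. \<exists>B. \<forall>x\<in>carrier G. \<bar>F j x\<bar> \<le> B"
    using uniform_bounded[OF J(2)] by metis
  then obtain B where B: "\<And>j x. j \<in> J \<Longrightarrow> x \<in> carrier G \<Longrightarrow> \<bar>F j x\<bar> \<le> B j" by metis
  define \<kappa> where "\<kappa> g = (\<lambda>j\<in>J. \<lfloor>F j g / \<delta>\<rfloor>)" for g
  have "\<kappa> ` carrier G \<subseteq> Pi\<^sub>E J (\<lambda>j. {- \<lceil>B j / \<delta>\<rceil>..\<lceil>B j / \<delta>\<rceil>})"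
  proof (rule image_subsetI)
    fix g assume g: "g \<in> carrier G"
    have "\<lfloor>F j g / \<delta>\<rfloor> \<in> {- \<lceil>B j / \<delta>\<rceil>..\<lceil>B j / \<delta>\<rceil>}" if "j \<in> J" for j
    proof -
      have "F j g / \<delta> \<le> B j / \<delta>" "- (B j / \<delta>) \<le> F j g / \<delta>"
        using B[OF that g] \<delta> by (auto simp: field_simps abs_le_iff)
      then show ?thesis by (auto simp: le_floor_iff floor_le_iff) linarith+
    qed
    then show "\<kappa> g \<in> Pi\<^sub>E J (\<lambda>j. {- \<lceil>B j / \<delta>\<rceil>..\<lceil>B j / \<delta>\<rceil>})"
      unfolding \<kappa>_def by (intro restrict_PiE_iff[THEN iffD2]) blast
  qed
  moreover have "finite (Pi\<^sub>E J (\<lambda>j. {- \<lceil>B j / \<delta>\<rceil>..\<lceil>B j / \<delta>\<rceil>}))"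
    using J(1) by (intro finite_PiE) auto
  ultimately have "finite (\<kappa> ` carrier G)" by (rule finite_subset)
  then obtain I where I: "I \<subseteq> carrier G" "finite I" "\<kappa> ` carrier G = \<kappa> ` I"
    using finite_subset_image[of "\<kappa> ` carrier G" \<kappa> "carrier G"] by blast
  show thesis
  proof (rule that[OF I(2,1)])
    fix g assume g: "g \<in> carrier G"
    then have "\<kappa> g \<in> \<kappa> ` I" using I(3) by blast
    then obtain i where i: "i \<in> I" "\<kappa> g = \<kappa> i" by blast
    have "\<bar>F j g - F j i\<bar> \<le> \<delta>" if "j \<in> J" for j
    proof -
      have "\<lfloor>F j g / \<delta>\<rfloor> = \<lfloor>F j i / \<delta>\<rfloor>"
        using fun_cong[OF i(2), of j] that by (simp add: \<kappa>_def)
      then have "\<bar>F j g / \<delta> - F j i / \<delta>\<bar> \<le> 1" by linarith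
      then show ?thesis using \<delta> by (simp add: diff_divide_distrib[symmetric] field_simps)
    qed
    then have "(\<Sum>j\<in>J. \<bar>F j g - F j i\<bar>) \<le> (\<Sum>j\<in>J. \<delta>)" by (rule sum_mono)
    also have "\<dots> < \<epsilon>" using \<epsilon> by (simp add: \<delta>_def field_simps)
    finally show "\<exists>i\<in>I. (\<Sum>j\<in>J. \<bar>F j g - F j i\<bar>) < \<epsilon>" using i by blast
  qed
qed

text \<open>A partition of unity subordinate to a finite cover on which the given functions hardly vary.\<close>
lemma mean_approx:
  assumes m: "m \<in> means" and J: "finite J" "\<And>j. j \<in> J \<Longrightarrow> F j \<in> U" and \<epsilon>: "\<epsilon> > 0"
  obtains I l where "finite I" "I \<subseteq> carrier G" "\<And>i. i \<in> I \<Longrightarrow> 0 \<le> l i" "sum l I = 1"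
    "\<And>j. j \<in> J \<Longrightarrow> \<bar>m (F j) - (\<Sum>i\<in>I. l i * F j i)\<bar> \<le> \<epsilon>"
proof -
  define N where "N g i = (\<Sum>j\<in>J. \<bar>F j g - F j i\<bar>)" for g i
  obtain I where I: "finite I" "I \<subseteq> carrier G" "\<And>g. g \<in> carrier G \<Longrightarrow> \<exists>i\<in>I. N g i < \<epsilon>/2"
    using finite_net[of J F, OF J half_gt_zero[OF \<epsilon>]] unfolding N_def by auto
  \<comment> \<open>Bumps of radius \<open>\<epsilon>\<close> around a net of mesh
    \<open>\<epsilon>/2\<close>: their sum \<open>s\<close> is at least \<open>\<epsilon>/2\<close>
    everywhere, so that its reciprocal is a Lipschitz function of \<open>s\<close>.\<close>
  define u where "u i g = max 0 (\<epsilon> - N g i)" for i g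
  define s where "s g = (\<Sum>i\<in>I. u i g)" for g
  have u0: "u i g \<ge> 0" for i g by (simp add: u_def)
  have uU: "u i \<in> U" for i
  proof (rule uniform_dominated[where f = "u i" and C = 1, OF J])
    fix x y
    have "\<bar>N x i - N y i\<bar> \<le> (\<Sum>j\<in>J. \<bar>F j x - F j y\<bar>)"
      unfolding N_def sum_subtractf[symmetric]
      by (rule order_trans[OF sum_abs]) (rule sum_mono, linarith)
    moreover have "\<bar>u i x - u i y\<bar> \<le> \<bar>N x i - N y i\<bar>" by (simp add: u_def)
    ultimately show "\<bar>u i x - u i y\<bar> \<le> 1 * (\<Sum>j\<in>J. \<bar>F j x - F j y\<bar>)" by simp
  qed
  have s_ge: "s g \<ge> \<epsilon>/2" if g: "g \<in> carrier G" for g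
  proof -
    obtain i where i: "i \<in> I" "N g i < \<epsilon>/2" using I(3)[OF g] by blast
    have "\<epsilon>/2 \<le> \<epsilon> - N g i" using i(2) by linarith
    also have "\<dots> \<le> u i g" by (simp add: u_def)
    also have "\<dots> \<le> s g" unfolding s_def
      by (rule member_le_sum[OF i(1)]) (use u0 I in auto)
    finally show ?thesis .
  qed
  have sU: "s \<in> U" unfolding s_def using I(1) uU by (intro uniform_sum)
  have rU: "(\<lambda>g. 1 / s g) \<in> U"
  proof (rule uniform_lipschitz[OF sU])
    fix x y assume xy: "x \<in> carrier G" "y \<in> carrier G"
    have pos: "s x > 0" "s y > 0" using s_ge[OF xy(1)] s_ge[OF xy(2)] \<epsilon> by auto
    have "(\<epsilon>/2) * (\<epsilon>/2) \<le> s x * s y"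
      using s_ge[OF xy(1)] s_ge[OF xy(2)] \<epsilon> pos by (intro mult_mono) auto
    then have "\<bar>s x - s y\<bar> / (s x * s y) \<le> \<bar>s x - s y\<bar> / ((\<epsilon>/2) * (\<epsilon>/2))"
      using \<epsilon> by (intro divide_left_mono) (auto simp: pos)
    moreover have "\<bar>1 / s x - 1 / s y\<bar> = \<bar>s x - s y\<bar> / (s x * s y)"
    proof -
      have "1 / s x - 1 / s y = (s y - s x) / (s x * s y)"
        using pos by (simp add: field_simps)
      then show ?thesis using pos by (simp add: abs_mult abs_minus_commute)
    qed
    ultimately show "\<bar>1 / s x - 1 / s y\<bar> \<le> (1 / ((\<epsilon>/2) * (\<epsilon>/2))) * \<bar>s x - s y\<bar>" by (simp add: mult.commute)
  qed
  define h where "h i g = u i g * (1 / s g)" for i g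
  have hU: "h i \<in> U" for i
    using uniform_mult[OF uU rU] by (simp add: h_def[abs_def])
  have h0: "h i g \<ge> 0" if "g \<in> carrier G" for i g
    using u0 s_ge[OF that] \<epsilon> by (simp add: h_def)
  have h1: "(\<Sum>i\<in>I. h i g) = 1" if "g \<in> carrier G" for g
    using s_ge[OF that] \<epsilon> unfolding h_def sum_distrib_right[symmetric] s_def[symmetric] by simp
  show thesis
  proof (rule that[OF I(1,2), of "\<lambda>i. m (h i)"])
    show "0 \<le> m (h i)" for i by (rule mean_nonneg[OF m hU h0])
    have "(\<Sum>i\<in>I. m (h i)) = m (\<lambda>g. \<Sum>i\<in>I. h i g)"
      by (rule mean_sum[symmetric]) (use m I hU in auto)
    also have "\<dots> = m (\<lambda>g. 1)" by (rule mean_cong[OF m]) (rule h1)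
    finally show "(\<Sum>i\<in>I. m (h i)) = 1" by (simp add: mean_one[OF m])
  next
    fix j assume j: "j \<in> J"
    have "(\<Sum>i\<in>I. m (h i) * F j i) = (\<Sum>i\<in>I. m (\<lambda>g. F j i * h i g))"
      by (simp add: mean_cmult[OF m hU] mult.commute)
    also have "\<dots> = m (\<lambda>g. \<Sum>i\<in>I. F j i * h i g)"
      by (rule mean_sum[symmetric]) (use m I hU in \<open>auto intro: uniform_cmult\<close>)
    finally have eq: "(\<Sum>i\<in>I. m (h i) * F j i) = m (\<lambda>g. \<Sum>i\<in>I. F j i * h i g)" .
    have "\<bar>m (F j) - m (\<lambda>g. \<Sum>i\<in>I. F j i * h i g)\<bar> \<le> \<epsilon>"
    proof (rule mean_dist[OF m J(2)[OF j]])
      show "(\<lambda>g. \<Sum>i\<in>I. F j i * h i g) \<in> U"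
        using I hU by (intro uniform_sum uniform_cmult)
      fix g assume g: "g \<in> carrier G"
      have "F j g - (\<Sum>i\<in>I. F j i * h i g) = (\<Sum>i\<in>I. h i g) * F j g - (\<Sum>i\<in>I. F j i * h i g)"
        by (simp add: h1[OF g])
      also have "\<dots> = (\<Sum>i\<in>I. h i g * (F j g - F j i))"
        by (simp add: sum_distrib_left sum_subtractf right_diff_distrib mult.commute)
      finally have "\<bar>F j g - (\<Sum>i\<in>I. F j i * h i g)\<bar> \<le> (\<Sum>i\<in>I. \<bar>h i g * (F j g - F j i)\<bar>)"
        by simp
      also have "\<dots> \<le> (\<Sum>i\<in>I. h i g * \<epsilon>)"
      proof (rule sum_mono)
        fix i assume "i \<in> I"
        show "\<bar>h i g * (F j g - F j i)\<bar> \<le> h i g * \<epsilon>"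
        proof (cases "u i g = 0")
          case False
          then have "N g i < \<epsilon>" by (auto simp: u_def max_def split: if_splits)
          moreover have "\<bar>F j g - F j i\<bar> \<le> N g i"
            unfolding N_def by (rule member_le_sum[OF j]) (use J in auto)
          ultimately show ?thesis
            using h0[OF g, of i] by (simp add: abs_mult mult_left_mono)
        qed (simp add: h_def)
      qed
      also have "\<dots> = \<epsilon>" by (simp add: sum_distrib_right[symmetric] h1[OF g])
      finally show "\<bar>F j g - (\<Sum>i\<in>I. F j i * h i g)\<bar> \<le> \<epsilon>" .
    qed
    then show "\<bar>m (F j) - (\<Sum>i\<in>I. m (h i) * F j i)\<bar> \<le> \<epsilon>" by (simp add: eq)
  qed
qed

section \<open>Compact convex invariant sets of means\<close>

definition invariant :: "(('a \<Rightarrow> real) \<Rightarrow> real) set \<Rightarrow> bool" where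
  "invariant V \<longleftrightarrow> (\<forall>g\<in>carrier G. \<forall>y\<in>V. conv (point_mean g) y \<in> V)"

definition convex_space :: "(('a \<Rightarrow> real) \<Rightarrow> real) set \<Rightarrow> bool" where
  "convex_space V \<longleftrightarrow> compact V \<and> V \<noteq> {} \<and> V \<subseteq> means \<and> convex_family V \<and> invariant V"

definition irreducible_space :: "(('a \<Rightarrow> real) \<Rightarrow> real) set \<Rightarrow> bool" where
  "irreducible_space V \<longleftrightarrow> convex_space V \<and> (\<forall>V'. convex_space V' \<and> V' \<subseteq> V \<longrightarrow> V' = V)"

text \<open>On any finite set of uniform functions \<open>m\<close> is approximated by convex
  combinations of point means, so \<open>conv m w\<close> is approximated by convex combinations of
  translates of \<open>w\<close>. These lie in \<open>V\<close>, and \<open>V\<close> is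
  closed.\<close>

lemma conv_in_convex_space:
  assumes V: "convex_space V" and w: "w \<in> V" and m: "m \<in> means"
  shows "conv m w \<in> V"
proof (rule ccontr)
  assume "conv m w \<notin> V"
  have wm: "w \<in> means" using V w by (auto simp: convex_space_def)
  have "open (- V)"
    using V compact_functions_imp_closed by (auto simp: convex_space_def)
  then obtain J \<epsilon> where J: "finite J" "\<epsilon> > 0"
    and sub: "\<And>q. (\<And>\<phi>. \<phi> \<in> J \<Longrightarrow> \<bar>q \<phi> - conv m w \<phi>\<bar> < \<epsilon>) \<Longrightarrow> q \<in> - V"
    using open_function_nbhd[of "- V" "conv m w"] \<open>conv m w \<notin> V\<close> by (metis ComplI)
  obtain I l where I: "finite I" "I \<subseteq> carrier G" "\<And>i. i \<in> I \<Longrightarrow> 0 \<le> l i" "sum l I = 1"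
    and app: "\<And>\<phi>. \<phi> \<in> J \<inter> U \<Longrightarrow> \<bar>m (orbit_fn w \<phi>) - (\<Sum>i\<in>I. l i * orbit_fn w \<phi> i)\<bar> \<le> \<epsilon>/2"
    using mean_approx[OF m, of "J \<inter> U" "orbit_fn w" "\<epsilon>/2"] J orbit_fn_uniform[OF wm] by auto
  define q where "q = (\<lambda>\<phi>. \<Sum>i\<in>I. l i * conv (point_mean i) w \<phi>)"
  have "q \<in> V"
    unfolding q_def
    by (rule convex_family_sum) (use V w I in \<open>auto simp: convex_space_def invariant_def\<close>)
  moreover have "q \<in> - V"
  proof (rule sub)
    fix \<phi> assume "\<phi> \<in> J"
    show "\<bar>q \<phi> - conv m w \<phi>\<bar> < \<epsilon>"
    proof (cases "\<phi> \<in> U")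
      case True
      have "q \<phi> = (\<Sum>i\<in>I. l i * orbit_fn w \<phi> i)"
        unfolding q_def using I(2) True wm by (intro sum.cong) (auto simp: conv_point_mean)
      then show ?thesis
        using app[of \<phi>] True \<open>\<phi> \<in> J\<close> J(2) by (simp add: conv_def abs_minus_commute)
    qed (use J(2) in \<open>simp add: q_def conv_def\<close>)
  qed
  ultimately show False by simp
qed

lemma convex_space_means: "convex_space means"
  using point_mean[OF one_closed] point_mean
  by (auto simp: convex_space_def compact_means convex_means invariant_def conv_means)

lemma irreducible_exists:
  obtains V where "irreducible_space V"
proof -
  define Q where "Q V \<longleftrightarrow> convex_family V \<and> invariant V" for V
  obtain V where V: "compact V" "V \<noteq> {}" "V \<subseteq> means" "Q V"
    and min: "\<And>V'. compact V' \<Longrightarrow> V' \<noteq> {} \<Longrightarrow> V' \<subseteq> V \<Longrightarrow> Q V' \<Longrightarrow> V' = V"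
  proof (rule minimal_compact_set[of means Q])
    show "compact means" "means \<noteq> {}" "Q means"
      using convex_space_means by (auto simp: convex_space_def Q_def)
    show "Q (\<Inter>\<S>)" if "\<S> \<noteq> {}" "\<And>S. S \<in> \<S> \<Longrightarrow> Q S" for \<S>
      using that convex_family_Inter[of \<S>] by (auto simp: Q_def invariant_def)
  qed auto
  have "irreducible_space V"
    using V min by (auto simp: irreducible_space_def convex_space_def Q_def)
  then show thesis by (rule that)
qed

lemma irreducible_imp_convex_space: "irreducible_space V \<Longrightarrow> convex_space V"
  by (simp add: irreducible_space_def)

lemma convex_space_image:
  assumes V: "convex_space V" and cont: "continuous_on V t" and aff: "affine_map_on V t"
    and maps: "t ` V \<subseteq> means"
    and equi: "\<And>g y. g \<in> carrier G \<Longrightarrow> y \<in> V \<Longrightarrow> conv (point_mean g) (t y) = t (conv (point_mean g) y)"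
  shows "convex_space (t ` V)"
  unfolding convex_space_def
proof (intro conjI)
  show "compact (t ` V)" "t ` V \<noteq> {}" "convex_family (t ` V)"
    using V cont aff by (auto simp: convex_space_def intro: compact_continuous_image convex_family_image)
  show "invariant (t ` V)"
    using V equi by (auto simp: invariant_def convex_space_def)
qed (rule maps)

text \<open>Right convolution with \<open>w\<close> is continuous, affine and, by associativity,
  equivariant. The image of the set of all means is therefore a convex space inside
  \<open>V\<close>, and irreducibility leaves only \<open>V\<close> itself.\<close>

lemma irreducible_conv_surj:
  assumes V: "irreducible_space V" and w: "w \<in> V" and y: "y \<in> V"
  obtains m where "m \<in> means" "conv m w = y"
proof -
  have V': "convex_space V" using V by (rule irreducible_imp_convex_space)
  have wm: "w \<in> means" using V' w by (auto simp: convex_space_def)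
  have "convex_space ((\<lambda>m. conv m w) ` means)"
  proof (rule convex_space_image[OF convex_space_means continuous_on_conv_left])
    show "affine_map_on means (\<lambda>m. conv m w)"
      by (simp add: affine_map_on_def conv_mix_left)
  qed (use wm in \<open>auto simp: conv_assoc point_mean conv_means\<close>)
  moreover have "(\<lambda>m. conv m w) ` means \<subseteq> V"
    using conv_in_convex_space[OF V' w] by blast
  ultimately have "(\<lambda>m. conv m w) ` means = V"
    using V by (auto simp: irreducible_space_def)
  then show thesis using that y by blast
qed

text \<open>The mean with density \<open>h\<close> relative to \<open>m\<close>, normalised. The
  densities \<open>h\<close> and \<open>1 - h\<close> will split a mean into two, to which
  extremality can be applied.\<close>

lemma weighted_mean:
  assumes m: "m \<in> means" and h: "h \<in> U" "\<And>x. x \<in> carrier G \<Longrightarrow> 0 \<le> h x" and c: "m h > 0"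
  shows "(\<lambda>f. if f \<in> U then m (\<lambda>x. h x * f x) / m h else 0) \<in> means"
  unfolding means_def mem_Collect_eq
proof (intro conjI ballI allI impI)
  fix f g assume fg: "f \<in> U" "g \<in> U"
  have "m (\<lambda>x. h x * (f x + g x)) = m (\<lambda>x. h x * f x) + m (\<lambda>x. h x * g x)"
    using mean_add[OF m uniform_mult[OF h(1) fg(1)] uniform_mult[OF h(1) fg(2)]]
    by (simp add: distrib_left)
  then show "(if (\<lambda>x. f x + g x) \<in> U then m (\<lambda>x. h x * (f x + g x)) / m h else 0) =
      (if f \<in> U then m (\<lambda>x. h x * f x) / m h else 0) + (if g \<in> U then m (\<lambda>x. h x * g x) / m h else 0)"
    using fg by (simp add: uniform_add add_divide_distrib)
next
  fix f and d :: real assume f: "f \<in> U"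
  have "m (\<lambda>x. h x * (d * f x)) = d * m (\<lambda>x. h x * f x)"
    using mean_cmult[OF m uniform_mult[OF h(1) f], of d] by (simp add: mult.left_commute)
  then show "(if (\<lambda>x. d * f x) \<in> U then m (\<lambda>x. h x * (d * f x)) / m h else 0) =
      d * (if f \<in> U then m (\<lambda>x. h x * f x) / m h else 0)"
    using f by (simp add: uniform_cmult)
next
  fix f assume f: "f \<in> U" "\<forall>x\<in>carrier G. 0 \<le> f x"
  have "0 \<le> m (\<lambda>x. h x * f x)"
    by (rule mean_nonneg[OF m uniform_mult[OF h(1) f(1)]]) (use h f in auto)
  then show "0 \<le> (if f \<in> U then m (\<lambda>x. h x * f x) / m h else 0)"
    using c by simp
qed (use c uniform_const in auto)

text \<open>Cutting \<open>m\<close> with a weight \<open>h\<close> writes \<open>e\<close> as a convex combination, so extremality of \<open>e\<close>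
  gives \<open>m (h a) = m h * e f\<close> for \<open>a = orbit_fn w f\<close>; taking \<open>h\<close> affine in \<open>a\<close>, the variance
  of \<open>a\<close> vanishes.\<close>
lemma extreme_concentrated:
  assumes V: "V \<subseteq> means" "\<And>n. n \<in> means \<Longrightarrow> conv n w \<in> V" and w: "w \<in> means"
    and e: "extreme_in V e" and m: "m \<in> means" "conv m w = e" and f: "f \<in> U"
  shows "m (\<lambda>g. \<bar>orbit_fn w f g - e f\<bar>) = 0"
proof -
  define a where "a = orbit_fn w f"
  have aU: "a \<in> U" unfolding a_def by (rule orbit_fn_uniform[OF w f])
  obtain B where B: "B > 0" "\<And>x. x \<in> carrier G \<Longrightarrow> \<bar>a x\<bar> \<le> B"
    using uniform_bounded[OF aU] by blast
  have ma: "m a = e f" using m(2) f by (auto simp: conv_def a_def)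
  \<comment> \<open>The factor \<open>1 / (4 * B)\<close> keeps \<open>h\<close> between 1/4 and
    3/4, so that both parts of \<open>m\<close> have positive mass.\<close>
  define h where "h x = 1/2 + (1 / (4 * B)) * a x" for x
  define c where "c = m h"
  have hU: "h \<in> U" unfolding h_def by (intro uniform_add uniform_const uniform_cmult aU)
  have h'U: "(\<lambda>x. 1 - h x) \<in> U" by (intro uniform_diff uniform_const hU)
  have hb: "1/4 \<le> h x" "h x \<le> 3/4" if "x \<in> carrier G" for x
    using B(1) B(2)[OF that] by (auto simp: h_def field_simps abs_le_iff)
  have c: "1/4 \<le> c" "c \<le> 3/4"
    unfolding c_def using mean_ge[OF m(1) hU hb(1)] mean_le[OF m(1) hU hb(2)] by auto
  have c': "m (\<lambda>x. 1 - h x) = 1 - c"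
    using mean_diff[OF m(1) uniform_const hU, of 1] mean_one[OF m(1)] by (simp add: c_def)
  define m1 where "m1 = (\<lambda>f. if f \<in> U then m (\<lambda>x. h x * f x) / m h else 0)"
  define m2 where "m2 = (\<lambda>f. if f \<in> U then m (\<lambda>x. (1 - h x) * f x) / m (\<lambda>x. 1 - h x) else 0)"
  have m1: "m1 \<in> means"
    unfolding m1_def
  proof (rule weighted_mean[OF m(1) hU])
    show "0 \<le> h x" if "x \<in> carrier G" for x using hb(1)[OF that] by simp
  qed (use c in \<open>simp add: c_def\<close>)
  have m2: "m2 \<in> means"
    unfolding m2_def
  proof (rule weighted_mean[OF m(1) h'U])
    show "0 \<le> 1 - h x" if "x \<in> carrier G" for x using hb(2)[OF that] by simp
  qed (use c c' in simp)
  have "mix c m1 m2 = m"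
  proof (rule mean_eqI)
    show "mix c m1 m2 \<in> means" using m1 m2 c by (intro mix_means) auto
    fix \<phi> assume \<phi>: "\<phi> \<in> U"
    have "mix c m1 m2 \<phi> = m (\<lambda>x. h x * \<phi> x) + m (\<lambda>x. (1 - h x) * \<phi> x)"
      using \<phi> c by (simp add: mix_def m1_def m2_def c' c_def[symmetric])
    also have "\<dots> = m (\<lambda>x. h x * \<phi> x + (1 - h x) * \<phi> x)"
      by (rule mean_add[symmetric]) (use m hU h'U \<phi> in \<open>auto intro: uniform_mult\<close>)
    also have "\<dots> = m \<phi>" by (simp add: algebra_simps)
    finally show "mix c m1 m2 \<phi> = m \<phi>" .
  qed (rule m(1))
  then have "mix c (conv m1 w) (conv m2 w) = e"
    using conv_mix_left[of c m1 m2 w] m(2) by simp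
  then have "conv m1 w = e"
    using extreme_inD[OF e _ V(2)[OF m1] V(2)[OF m2]] c by auto
  from fun_cong[OF this, of f] have "m (\<lambda>x. h x * a x) / c = e f"
    using f aU by (simp add: conv_def m1_def a_def[symmetric] c_def)
  then have ha: "m (\<lambda>x. h x * a x) = c * e f" using c by (simp add: field_simps)
  have aaU: "(\<lambda>x. a x * a x) \<in> U" by (rule uniform_mult[OF aU aU])
  have "m (\<lambda>x. h x * a x) = m (\<lambda>x. (1/2) * a x + (1 / (4 * B)) * (a x * a x))"
    by (rule arg_cong[of _ _ m]) (auto simp: h_def algebra_simps)
  also have "\<dots> = (1/2) * e f + (1 / (4 * B)) * m (\<lambda>x. a x * a x)"
    using mean_add[OF m(1) uniform_cmult[OF aU] uniform_cmult[OF aaU], of "1/2" "1 / (4 * B)"]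
    by (simp only: mean_cmult[OF m(1) aU] mean_cmult[OF m(1) aaU] ma)
  finally have 1: "c * e f = (1/2) * e f + (1 / (4 * B)) * m (\<lambda>x. a x * a x)" using ha by simp
  have "c = 1/2 + (1 / (4 * B)) * e f"
    unfolding c_def h_def
    using mean_add[OF m(1) uniform_const uniform_cmult[OF aU], of "1/2" "1 / (4 * B)"]
    by (simp only: mean_cmult[OF m(1) aU] mean_const[OF m(1)] ma)
  with 1 have "(1 / (4 * B)) * (e f * e f) = (1 / (4 * B)) * m (\<lambda>x. a x * a x)"
    by (simp add: algebra_simps)
  then have aa: "m (\<lambda>x. a x * a x) = e f * e f" using B(1) by simp
  define t where "t x = a x - e f" for x
  have tU: "t \<in> U" unfolding t_def by (intro uniform_diff uniform_const aU)
  have ttU: "(\<lambda>x. t x * t x) \<in> U" by (rule uniform_mult[OF tU tU])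
  have "m (\<lambda>x. t x * t x) = m (\<lambda>x. a x * a x + ((- 2 * e f) * a x + e f * e f))"
    by (rule arg_cong[of _ _ m]) (auto simp: t_def algebra_simps)
  also have "\<dots> = m (\<lambda>x. a x * a x) + ((- 2 * e f) * m a + e f * e f)"
    using mean_add[OF m(1) aaU uniform_add[OF uniform_cmult[OF aU] uniform_const], of "- 2 * e f" "e f * e f"]
      mean_add[OF m(1) uniform_cmult[OF aU] uniform_const, of "- 2 * e f" "e f * e f"]
    by (simp only: mean_cmult[OF m(1) aU] mean_const[OF m(1)])
  finally have tt: "m (\<lambda>x. t x * t x) = 0" by (simp add: aa ma)
  have absU: "(\<lambda>x. \<bar>t x\<bar>) \<in> U" by (rule uniform_abs[OF tU])
  \<comment> \<open>Mean square 0 gives mean absolute value 0 through the pointwise inequality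
    \<open>\<bar>t\<bar> \<le> \<epsilon> + t * t / \<epsilon>\<close>, valid for every positive
    \<open>\<epsilon>\<close>.\<close>
  have "m (\<lambda>x. \<bar>t x\<bar>) \<le> \<epsilon>" if \<epsilon>: "\<epsilon> > 0" for \<epsilon>
  proof -
    have "m (\<lambda>x. \<bar>t x\<bar>) \<le> m (\<lambda>x. \<epsilon> + (1/\<epsilon>) * (t x * t x))"
    proof (rule mean_mono[OF m(1) absU])
      show "(\<lambda>x. \<epsilon> + (1/\<epsilon>) * (t x * t x)) \<in> U"
        by (intro uniform_add uniform_const uniform_cmult ttU)
      fix x
      have "0 \<le> (\<epsilon> - \<bar>t x\<bar>)\<^sup>2 + \<epsilon> * \<bar>t x\<bar>" using \<epsilon> by simp
      then have "\<epsilon> * \<bar>t x\<bar> \<le> \<epsilon> * \<epsilon> + t x * t x"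
        by (simp add: power2_eq_square algebra_simps abs_mult_self_eq)
      then show "\<bar>t x\<bar> \<le> \<epsilon> + (1/\<epsilon>) * (t x * t x)"
        using \<epsilon> by (simp add: field_simps)
    qed
    also have "\<dots> = \<epsilon>"
      using mean_add[OF m(1) uniform_const uniform_cmult[OF ttU], of \<epsilon> "1/\<epsilon>"]
      by (simp only: mean_cmult[OF m(1) ttU] mean_const[OF m(1)] tt mult_zero_right add_0_right)
    finally show ?thesis .
  qed
  then have "m (\<lambda>x. \<bar>t x\<bar>) \<le> 0" by (rule field_le_epsilon[of _ 0, simplified])
  moreover have "0 \<le> m (\<lambda>x. \<bar>t x\<bar>)" by (rule mean_nonneg[OF m(1) absU]) simp
  ultimately show ?thesis by (simp add: t_def a_def)
qed

text \<open>Right convolution with \<open>x\<close> commutes with the group action, so its average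
  \<open>s\<close> with the identity maps \<open>V\<close> onto a convex space inside
  \<open>V\<close>, hence onto \<open>V\<close>. Writing \<open>x = s y\<close> exhibits
  \<open>x\<close> as the midpoint of \<open>y * x\<close> and \<open>y\<close>, and extremality
  makes both equal to \<open>x\<close>.\<close>

lemma extreme_idempotent:
  assumes V: "irreducible_space V" and x: "extreme_in V x"
  shows "conv x x = x"
proof -
  have V': "convex_space V" using V by (rule irreducible_imp_convex_space)
  have Vm: "V \<subseteq> means" using V' by (simp add: convex_space_def)
  have xV: "x \<in> V" using x by (simp add: extreme_in_def)
  have xm: "x \<in> means" using xV Vm by blast
  define s where "s y = mix (1/2) (conv y x) y" for y
  have sV: "s y \<in> V" if "y \<in> V" for y
    unfolding s_def using V' that conv_in_convex_space[OF V' xV] Vm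
    by (intro convex_familyD) (auto simp: convex_space_def)
  have "convex_space (s ` V)"
  proof (rule convex_space_image[OF V'])
    show "continuous_on V s"
      unfolding s_def by (intro continuous_on_mix continuous_on_conv_left continuous_on_id)
    show "affine_map_on V s"
      by (simp add: affine_map_on_def s_def conv_mix_left mix_mix)
    show "s ` V \<subseteq> means" using sV Vm by blast
    fix g y assume "g \<in> carrier G" "y \<in> V"
    then show "conv (point_mean g) (s y) = s (conv (point_mean g) y)"
      unfolding s_def using xm Vm
      by (subst conv_mix_right) (auto simp: point_mean conv_means conv_assoc)
  qed
  then have "s ` V = V"
    using V sV by (auto simp: irreducible_space_def)
  then obtain y where y: "y \<in> V" "s y = x" using xV by (metis imageE)
  have "conv y x = x \<and> y = x"
    using extreme_inD[OF x y(2)[unfolded s_def]] y(1) conv_in_convex_space[OF V' xV] Vm by auto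
  then show ?thesis by blast
qed

lemma point_mean_cancel:
  assumes "g \<in> carrier G" "v \<in> means" "w \<in> means"
    "conv (point_mean g) v = conv (point_mean g) w"
  shows "v = w"
proof -
  have "conv (point_mean (inv g)) (conv (point_mean g) u) = u" if "u \<in> means" for u
    using assms(1) that by (simp add: conv_point_mean_mult conv_point_mean_one)
  then show ?thesis using assms by metis
qed

text \<open>Averaging \<open>x\<close> with a translate stays in the irreducible space, whose extreme point \<open>x\<close> is
  reached by the orbit of the average because the group is compact.\<close>
theorem compact_group_invariant_mean:
  assumes "compact_space T"
  obtains x where "x \<in> means" "\<And>g. g \<in> carrier G \<Longrightarrow> conv (point_mean g) x = x"
proof -
  obtain V where V: "irreducible_space V" using irreducible_exists by blast
  have V': "convex_space V" using V by (rule irreducible_imp_convex_space)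
  have Vm: "V \<subseteq> means" using V' by (simp add: convex_space_def)
  obtain x where x: "extreme_in V x"
    using extreme_exists[of V] V' by (auto simp: convex_space_def)
  have xV: "x \<in> V" using x by (simp add: extreme_in_def)
  have xm: "x \<in> means" using xV Vm by blast
  have "conv (point_mean g) x = x" if g: "g \<in> carrier G" for g
  proof -
    have gx: "conv (point_mean g) x \<in> V"
      by (rule conv_in_convex_space[OF V' xV point_mean[OF g]])
    define w where "w = mix (1/2) x (conv (point_mean g) x)"
    have w: "w \<in> V" unfolding w_def
      by (rule convex_familyD) (use V' xV gx in \<open>auto simp: convex_space_def\<close>)
    have wm: "w \<in> means" using w Vm by blast
    obtain m where m: "m \<in> means" "conv m w = x"
      using irreducible_conv_surj[OF V w xV] by blast
    have conc: "m (\<lambda>h. \<bar>orbit_fn w f h - x f\<bar>) = 0" if "f \<in> U" for f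
      using extreme_concentrated[OF Vm conv_in_convex_space[OF V' w] wm x m that] .
    \<comment> \<open>If no translate of \<open>w\<close> were equal to \<open>x\<close>, finitely
      many of the deviations in \<open>conc\<close> would have a sum bounded below on the compact
      group, although each has mean 0.\<close>
    have "\<exists>k\<in>carrier G. \<forall>f\<in>U. orbit_fn w f k = x f"
    proof (rule ccontr)
      assume none: "\<not> ?thesis"
      have cont: "continuous_map T euclideanreal (\<lambda>h. \<bar>orbit_fn w f h - x f\<bar>)" if "f \<in> U" for f
        by (intro uniform_continuous uniform_abs uniform_diff uniform_const orbit_fn_uniform wm that)
      obtain J \<delta> where J: "finite J" "J \<subseteq> U" "\<delta> > 0"
        "\<And>h. h \<in> carrier G \<Longrightarrow> \<delta> \<le> (\<Sum>f\<in>J. \<bar>orbit_fn w f h - x f\<bar>)"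
      proof (rule finite_separation[of T "carrier G" U "\<lambda>f h. \<bar>orbit_fn w f h - x f\<bar>"])
        show "compactin T (carrier G)"
          using assms by (simp add: compact_space_def topspace_carrier)
        show "\<exists>f\<in>U. 0 < \<bar>orbit_fn w f h - x f\<bar>" if "h \<in> carrier G" for h
          using none that by auto
      qed (use cont in auto)
      have fU: "(\<lambda>h. \<bar>orbit_fn w f h - x f\<bar>) \<in> U" if "f \<in> J" for f
        using J(2) that by (intro uniform_abs uniform_diff uniform_const orbit_fn_uniform wm) auto
      have "\<delta> \<le> m (\<lambda>h. \<Sum>f\<in>J. \<bar>orbit_fn w f h - x f\<bar>)"
        by (rule mean_ge[OF m(1) uniform_sum[OF J(1) fU] J(4)])
      also have "\<dots> = (\<Sum>f\<in>J. m (\<lambda>h. \<bar>orbit_fn w f h - x f\<bar>))"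
        by (rule mean_sum[OF m(1) J(1) fU])
      also have "\<dots> = 0" using conc J(2) by (intro sum.neutral) auto
      finally show False using J(3) by simp
    qed
    then obtain k where k: "k \<in> carrier G" "\<And>f. f \<in> U \<Longrightarrow> orbit_fn w f k = x f" by blast
    have "conv (point_mean k) w = x"
      by (rule mean_eqI) (use k wm xm in \<open>auto simp: conv_point_mean intro: conv_means point_mean\<close>)
    \<comment> \<open>The translate of the midpoint is the midpoint of the translates, so
      extremality gives \<open>k x = x\<close> and \<open>k g x = x\<close>; cancelling
      \<open>k\<close> leaves \<open>g x = x\<close>.\<close>
    moreover have "conv (point_mean k) w =
        mix (1/2) (conv (point_mean k) x) (conv (point_mean k) (conv (point_mean g) x))"
      unfolding w_def by (rule conv_mix_right) (use k xm gx Vm in \<open>auto intro: point_mean\<close>)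
    ultimately have "conv (point_mean k) x = x \<and> conv (point_mean k) (conv (point_mean g) x) = x"
      using extreme_inD[OF x, of "1/2" "conv (point_mean k) x"] conv_in_convex_space[OF V' xV point_mean[OF k(1)]]
        conv_in_convex_space[OF V' gx point_mean[OF k(1)]] by auto
    then show ?thesis
      using point_mean_cancel[OF k(1), of "conv (point_mean g) x" x] xm gx Vm by auto
  qed
  then show thesis using that xm by blast
qed

end

section \<open>Compact subgroups and bi-invariant measures\<close>

lemma continuous_map_compose': "continuous_map X Y p \<Longrightarrow> continuous_map Y Z f \<Longrightarrow> continuous_map X Z (\<lambda>x. f (p x))"
  using continuous_map_compose[of X Y p Z f] by (simp add: o_def)

lemma continuous_map_Re_Im:
  assumes "continuous_map X euclidean f"
  shows "continuous_map X euclideanreal (\<lambda>x. Re (f x))" "continuous_map X euclideanreal (\<lambda>x. Im (f x))"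
  by (rule continuous_map_compose'[OF assms], simp add: continuous_on_Re continuous_on_id,
      rule continuous_map_compose'[OF assms], simp add: continuous_on_Im continuous_on_id)

context top_group
begin

lemma subgroup_top_group:
  assumes P: "subgroup P G"
  shows "topological_group (G\<lparr>carrier := P\<rparr>) (subtopology T P)"
  unfolding topological_group_def
proof (intro conjI)
  have sub: "P \<subseteq> topspace T" using subgroup.subset[OF P] by (simp add: topspace_carrier)
  show "group (G\<lparr>carrier := P\<rparr>)" by (rule subgroup.subgroup_is_group[OF P is_group])
  show tP: "topspace (subtopology T P) = carrier (G\<lparr>carrier := P\<rparr>)"
    using sub by auto
  have incl: "continuous_map (subtopology T P) T (\<lambda>x. x)"
    by (rule continuous_map_from_subtopology[OF continuous_id])
  have "continuous_map (prod_topology (subtopology T P) (subtopology T P)) T (\<lambda>p. fst p \<otimes> snd p)"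
    by (intro continuous_mult_compose continuous_map_compose'[OF continuous_map_fst incl]
        continuous_map_compose'[OF continuous_map_snd incl])
  then show "continuous_map (prod_topology (subtopology T P) (subtopology T P)) (subtopology T P)
      (\<lambda>(x, y). x \<otimes>\<^bsub>G\<lparr>carrier := P\<rparr>\<^esub> y)"
    using subgroup.m_closed[OF P] sub
    by (intro continuous_map_into_subtopology) (auto simp: case_prod_unfold)
  have "continuous_map (subtopology T P) (subtopology T P) (\<lambda>x. inv x)"
    using subgroup.m_inv_closed[OF P]
    by (intro continuous_map_into_subtopology continuous_inv_compose incl) auto
  then show "continuous_map (subtopology T P) (subtopology T P) (\<lambda>x. inv\<^bsub>G\<lparr>carrier := P\<rparr>\<^esub> x)"
    by (rule continuous_map_eq) (use m_inv_consistent[OF P] in auto)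
qed

text \<open>The compact set \<open>D = L^-1 C\<close> contains \<open>C\<close> and every
  \<open>x\<close> such that \<open>v x\<close> lies in \<open>C\<close> for some \<open>v\<close>
  in \<open>L\<close>. Over \<open>D\<close> the tube lemma provides one neighbourhood of
  \<open>\<one>\<close> for all points, and outside \<open>D\<close> both \<open>f x\<close> and
  \<open>f (v x)\<close> vanish.\<close>

lemma compactly_supported_uniform:
  fixes f :: "'a \<Rightarrow> real"
  assumes lc: "locally_compact_space T" and f: "f \<in> compactly_supported T"
  shows "f \<in> U"
proof -
  obtain C where C: "compactin T C" "\<And>x. x \<in> carrier G - C \<Longrightarrow> f x = 0"
    and cont: "continuous_map T euclideanreal f"
    using f by (auto simp: compactly_supported_def topspace_carrier)
  have CG: "C \<subseteq> carrier G" using compactin_subset_topspace[OF C(1)] by (simp add: topspace_carrier)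
  obtain V0 L where V0: "openin T V0" "compactin T L" "\<one> \<in> V0" "V0 \<subseteq> L"
    using lc unfolding locally_compact_space_def topspace_carrier by (meson one_closed)
  define D where "D = (\<lambda>p. inv (fst p) \<otimes> snd p) ` (L \<times> C)"
  have "continuous_map (prod_topology T T) T (\<lambda>p. inv (fst p) \<otimes> snd p)"
    by (intro continuous_mult_compose continuous_inv_compose continuous_map_fst continuous_map_snd)
  then have D: "compactin T D"
    unfolding D_def by (rule image_compactin[rotated]) (simp add: compactin_Times V0 C)
  obtain B where B: "\<And>x. x \<in> carrier G \<Longrightarrow> \<bar>f x\<bar> \<le> B"
  proof -
    have "compact (f ` C)" using image_compactin[OF C(1) cont] by simp
    then have "bounded (f ` C)" by (rule compact_imp_bounded)
    then obtain b where b: "\<forall>y\<in>f ` C. \<bar>y\<bar> \<le> b"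
      unfolding bounded_iff real_norm_def by (elim exE)
    have "\<bar>f x\<bar> \<le> max b 0" if "x \<in> carrier G" for x
      using b C(2)[of x] that by (cases "x \<in> C") (auto simp: le_max_iff_disj)
    then show thesis by (rule that)
  qed
  show ?thesis
  proof (rule uniformI[OF B])
    fix \<epsilon> :: real assume \<epsilon>: "\<epsilon> > 0"
    define W where "W = {p \<in> topspace (prod_topology T T). f (fst p \<otimes> snd p) - f (snd p) \<in> {-\<epsilon><..<\<epsilon>}}"
    have "continuous_map (prod_topology T T) euclideanreal (\<lambda>p. f (fst p \<otimes> snd p) - f (snd p))"
      by (intro continuous_map_diff continuous_map_compose'[OF _ cont] continuous_mult_compose
          continuous_map_fst continuous_map_snd)
    then have W: "openin (prod_topology T T) W"
      unfolding W_def by (rule openin_continuous_map_preimage) simp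
    have DW: "{\<one>} \<times> D \<subseteq> W"
      using compactin_subset_topspace[OF D] \<epsilon> by (auto simp: W_def topspace_carrier)
    then obtain V V' where V: "openin T V" "\<one> \<in> V" "D \<subseteq> V'" "V \<times> V' \<subseteq> W"
      using tube_lemma_right[OF W D, of \<one>] by (auto simp: topspace_carrier)
    have "\<bar>f (v \<otimes> x) - f x\<bar> < \<epsilon>" if v: "v \<in> V \<inter> V0" and x: "x \<in> carrier G" for v x
    proof (cases "x \<in> D")
      case True
      then have "(v, x) \<in> W" using V v by blast
      then show ?thesis by (auto simp: W_def)
    next
      case False
      have vG: "v \<in> carrier G" using v openin_carrier[OF V(1)] by blast
      have "x \<notin> C"
      proof
        assume "x \<in> C"
        then have "inv \<one> \<otimes> x \<in> D"
          unfolding D_def using V0 by (intro image_eqI[of _ _ "(\<one>, x)"]) auto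
        then show False using False x by simp
      qed
      moreover have "v \<otimes> x \<notin> C"
      proof
        assume "v \<otimes> x \<in> C"
        then have "inv v \<otimes> (v \<otimes> x) \<in> D"
          unfolding D_def using V0 v by (intro image_eqI[of _ _ "(v, v \<otimes> x)"]) auto
        then show False using False x vG by (simp add: m_assoc[symmetric])
      qed
      ultimately show ?thesis using C(2)[of x] C(2)[of "v \<otimes> x"] x vG \<epsilon> by simp
    qed
    then show "\<exists>V. openin T V \<and> \<one> \<in> V \<and> (\<forall>v\<in>V. \<forall>x\<in>carrier G. \<bar>f (v \<otimes> x) - f x\<bar> < \<epsilon>)"
      using V V0 by (intro exI[of _ "V \<inter> V0"]) auto
  qed
qed

lemma compact_continuous_uniform:
  fixes f :: "'a \<Rightarrow> real"
  assumes "compact_space T" "continuous_map T euclideanreal f"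
  shows "f \<in> U"
proof (rule compactly_supported_uniform)
  show "locally_compact_space T" by (rule compact_imp_locally_compact_space[OF assms(1)])
  have "compactin T (topspace T)" using assms(1) by (simp only: compact_space_def)
  moreover have "\<forall>x\<in>topspace T - topspace T. f x = 0" by simp
  ultimately show "f \<in> compactly_supported T"
    unfolding compactly_supported_def using assms(2) by blast
qed

text \<open>By the tube lemma over the compact group, \<open>H z\<close> approaches
  \<open>H y\<close> uniformly as \<open>z\<close> approaches \<open>y\<close>, and a mean does not
  increase uniform distances.\<close>

lemma mean_parameter_continuous:
  fixes H :: "'y \<Rightarrow> 'a \<Rightarrow> real"
  assumes cs: "compact_space T" and m: "m \<in> means"
    and H: "continuous_map (prod_topology Y T) euclideanreal (\<lambda>p. H (fst p) (snd p))"
  shows "continuous_map Y euclideanreal (\<lambda>y. m (H y))"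
proof (rule continuous_map_realI)
  fix y and \<epsilon> :: real assume \<epsilon>: "\<epsilon> > 0" and y: "y \<in> topspace Y"
  have HU: "H z \<in> U" if "z \<in> topspace Y" for z
  proof (rule compact_continuous_uniform[OF cs])
    have "continuous_map T (prod_topology Y T) (\<lambda>x. (z, x))"
      using that by (simp add: continuous_map_paired continuous_id)
    from continuous_map_compose'[OF this H] show "continuous_map T euclideanreal (H z)" by simp
  qed
  define W where "W = {p \<in> topspace (prod_topology Y T). H (fst p) (snd p) - H y (snd p) \<in> {-(\<epsilon>/2)<..<\<epsilon>/2}}"
  have "continuous_map (prod_topology Y T) euclideanreal (\<lambda>p. H (fst p) (snd p) - H y (snd p))"
    by (intro continuous_map_diff H continuous_map_compose'[OF continuous_map_snd uniform_continuous[OF HU[OF y]]])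
  then have W: "openin (prod_topology Y T) W"
    unfolding W_def by (rule openin_continuous_map_preimage) simp
  have yW: "{y} \<times> topspace T \<subseteq> W" using y \<epsilon> by (auto simp: W_def)
  obtain N N' where N: "openin Y N" "y \<in> N" "topspace T \<subseteq> N'" "N \<times> N' \<subseteq> W"
    using tube_lemma_right[OF W cs[unfolded compact_space_def] y yW] by (elim exE conjE)
  have "\<bar>m (H z) - m (H y)\<bar> < \<epsilon>" if z: "z \<in> N" for z
  proof -
    have zY: "z \<in> topspace Y" using openin_subset[OF N(1)] z by blast
    have "\<bar>m (H z) - m (H y)\<bar> \<le> \<epsilon>/2"
    proof (rule mean_dist[OF m HU[OF zY] HU[OF y]])
      fix x assume "x \<in> carrier G"
      then have "(z, x) \<in> W" using N z by (auto simp: topspace_carrier)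
      then have "- (\<epsilon>/2) < H z x - H y x" "H z x - H y x < \<epsilon>/2" by (auto simp: W_def)
      then show "\<bar>H z x - H y x\<bar> \<le> \<epsilon>/2" by linarith
    qed
    then show ?thesis using \<epsilon> by linarith
  qed
  then show "\<exists>W. openin Y W \<and> y \<in> W \<and> (\<forall>z\<in>W. \<bar>m (H z) - m (H y)\<bar> < \<epsilon>)" using N by blast
qed

end

section \<open>Cut-off functions and integrals of measures carried by a compact set\<close>

lemma cutoff_exists:
  assumes "locally_compact_space X" "Hausdorff_space X" "compactin X C"
  obtains \<phi> :: "'x \<Rightarrow> real" where "\<phi> \<in> compactly_supported X"
    "\<And>x. x \<in> topspace X \<Longrightarrow> 0 \<le> \<phi> x \<and> \<phi> x \<le> 1" "\<And>x. x \<in> C \<Longrightarrow> \<phi> x = 1"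
proof -
  obtain W L where W: "openin X W" "compactin X L" "closedin X L" "C \<subseteq> W" "W \<subseteq> L"
    using assms locally_compact_space_compact_closed_compact[of X] by meson
  have "completely_regular_space X"
    using locally_compact_regular_imp_completely_regular_space assms by blast
  moreover have "closedin X (topspace X - W)" using W by blast
  moreover have "disjnt C (topspace X - W)" using W by (auto simp: disjnt_def)
  ultimately obtain f where f: "continuous_map X (top_of_set {0..1::real}) f"
    "f ` (topspace X - W) \<subseteq> {0}" "f ` C \<subseteq> {1}"
    using Urysohn_completely_regular_compact_closed[of 0 1 X C "topspace X - W"] assms(3) by auto
  have "f x = 0" if "x \<in> topspace X - L" for x
    using f(2) W(5) that by blast
  then have "f \<in> compactly_supported X"
    unfolding compactly_supported_def
    using f(1) W(2) by (auto simp: continuous_map_in_subtopology)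
  then show thesis
    by (rule that) (use f in \<open>auto simp: continuous_map_in_subtopology\<close>)
qed

text \<open>For a measure carried by the compact set \<open>C\<close> the limit defining the integral is attained.\<close>
lemma measure_integral_compact:
  assumes X: "locally_compact_space X" "Hausdorff_space X" and C: "compactin X C"
    and L: "\<And>\<phi>::'x \<Rightarrow> real. \<phi> \<in> compactly_supported X \<Longrightarrow> (\<And>x. x \<in> C \<Longrightarrow> \<phi> x = 1) \<Longrightarrow>
      \<mu> (\<lambda>x. complex_of_real (\<phi> x) * h x) = L"
  shows "measure_integral X \<mu> h = L"
  unfolding measure_integral_def
proof (rule the_equality)
  show "\<forall>\<epsilon>>0. \<exists>C. compactin X C \<and>
     (\<forall>\<phi>::'x \<Rightarrow> real. \<phi> \<in> compactly_supported X \<longrightarrow>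
        (\<forall>x\<in>topspace X. 0 \<le> \<phi> x \<and> \<phi> x \<le> 1) \<longrightarrow> (\<forall>x\<in>C. \<phi> x = 1) \<longrightarrow>
        norm (\<mu> (\<lambda>x. complex_of_real (\<phi> x) * h x) - L) < \<epsilon>)"
    using C L by (intro allI impI exI[of _ C]) simp
next
  fix L' assume L': "\<forall>\<epsilon>>0. \<exists>C. compactin X C \<and>
     (\<forall>\<phi>::'x \<Rightarrow> real. \<phi> \<in> compactly_supported X \<longrightarrow>
        (\<forall>x\<in>topspace X. 0 \<le> \<phi> x \<and> \<phi> x \<le> 1) \<longrightarrow> (\<forall>x\<in>C. \<phi> x = 1) \<longrightarrow>
        norm (\<mu> (\<lambda>x. complex_of_real (\<phi> x) * h x) - L') < \<epsilon>)"
  have "norm (L - L') < \<epsilon>" if \<epsilon>: "\<epsilon> > 0" for \<epsilon>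
  proof -
    obtain C' where C': "compactin X C'" "\<forall>\<phi>::'x \<Rightarrow> real. \<phi> \<in> compactly_supported X \<longrightarrow>
        (\<forall>x\<in>topspace X. 0 \<le> \<phi> x \<and> \<phi> x \<le> 1) \<longrightarrow> (\<forall>x\<in>C'. \<phi> x = 1) \<longrightarrow>
        norm (\<mu> (\<lambda>x. complex_of_real (\<phi> x) * h x) - L') < \<epsilon>"
      using L' \<epsilon> by blast
    \<comment> \<open>A cut-off equal to one on both compact sets compares the two candidate
      limits.\<close>
    obtain \<phi> :: "'x \<Rightarrow> real" where \<phi>: "\<phi> \<in> compactly_supported X"
      "\<And>x. x \<in> topspace X \<Longrightarrow> 0 \<le> \<phi> x \<and> \<phi> x \<le> 1" "\<And>x. x \<in> C \<union> C' \<Longrightarrow> \<phi> x = 1"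
      using cutoff_exists[OF X compactin_Un[OF C C'(1)]] by blast
    have "\<mu> (\<lambda>x. complex_of_real (\<phi> x) * h x) = L"
      by (rule L) (use \<phi> in auto)
    moreover have "norm (\<mu> (\<lambda>x. complex_of_real (\<phi> x) * h x) - L') < \<epsilon>"
      using C'(2) \<phi> by simp
    ultimately show ?thesis by simp
  qed
  then show "L' = L"
    by (metis less_irrefl right_minus_eq zero_less_norm_iff)
qed

text \<open>\<open>m\<close> is the normalised Haar integral of \<open>K\<close>, recorded as a mean
  on the uniform functions of \<open>K\<close>; by compactness these include all continuous
  functions on \<open>K\<close> (\<open>K_uniform\<close>). Invariance is stated on the left, and
  inverses in later formulas turn right translations into left ones.\<close>

locale compact_subgroup = top_group +
  fixes K :: "'a set" and m :: "('a \<Rightarrow> real) \<Rightarrow> real"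
  assumes K_subgroup: "subgroup K G" and K_compact: "compactin T K"
    and haar_mean: "m \<in> top_group.means (G\<lparr>carrier := K\<rparr>) (subtopology T K)"
    and haar_left: "\<And>k f. k \<in> K \<Longrightarrow> f \<in> uniform_functions (G\<lparr>carrier := K\<rparr>) (subtopology T K) \<Longrightarrow>
      m (\<lambda>x. f (k \<otimes> x)) = m f"

sublocale compact_subgroup \<subseteq> K: top_group "G\<lparr>carrier := K\<rparr>" "subtopology T K"
  by (rule top_group.intro[OF subgroup_top_group[OF K_subgroup]])

text \<open>With \<open>K\<close> regarded as a compact group in its own right, the fixed mean given
  by \<open>compact_group_invariant_mean\<close> serves as the Haar integral.\<close>

lemma (in top_group) compact_subgroup_exists:
  assumes K: "subgroup K G" "compactin T K"
  obtains m where "compact_subgroup G T K m"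
proof -
  interpret K: top_group "G\<lparr>carrier := K\<rparr>" "subtopology T K"
    by (rule top_group.intro[OF subgroup_top_group[OF K(1)]])
  have "compact_space (subtopology T K)"
    using K(2) by (simp add: compact_space_subtopology)
  then obtain m where m: "m \<in> K.means" "\<And>k. k \<in> K \<Longrightarrow> K.conv (K.point_mean k) m = m"
    using K.compact_group_invariant_mean by auto
  have "m (\<lambda>x. f (k \<otimes> x)) = m f" if "k \<in> K" "f \<in> K.U" for k f
    using fun_cong[OF m(2)[OF that(1)], of f] that m(1)
    by (simp add: K.conv_point_mean K.orbit_fn_def)
  then have "compact_subgroup G T K m"
    using K m top_group_axioms by (simp add: compact_subgroup_def compact_subgroup_axioms_def)
  then show thesis by (rule that)
qed

section \<open>Integration over the compact subgroup and its double cosets\<close>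

context compact_subgroup
begin

lemma K_sub: "k \<in> K \<Longrightarrow> k \<in> carrier G"
  using subgroup.mem_carrier[OF K_subgroup] .

lemma compact_space_K: "compact_space (subtopology T K)"
  using K_compact by (simp add: compact_space_subtopology)

lemma incl_K: "continuous_map (subtopology T K) T (\<lambda>x. x)"
  by (rule continuous_map_from_subtopology[OF continuous_id])

lemma K_uniform: "continuous_map (subtopology T K) euclideanreal f \<Longrightarrow> f \<in> K.U"
  by (rule K.compact_continuous_uniform[OF compact_space_K])

lemma K_uniform_restrict: "continuous_map T euclideanreal f \<Longrightarrow> f \<in> K.U"
  by (intro K_uniform continuous_map_from_subtopology)

lemma haar_cong: "(\<And>k. k \<in> K \<Longrightarrow> f k = f' k) \<Longrightarrow> m f = m f'"
  by (rule K.mean_cong[OF haar_mean]) simp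

text \<open>Finitely many translates of \<open>f\<close> have a sum bounded below by a positive
  number on \<open>K\<close>, and each translate has the same integral as \<open>f\<close>.\<close>

lemma haar_positive:
  assumes f: "f \<in> K.U" "\<And>k. k \<in> K \<Longrightarrow> 0 \<le> f k" "0 < f \<one>"
  shows "0 < m f"
proof -
  have one: "\<one> \<in> K" by (rule subgroup.one_closed[OF K_subgroup])
  have shU: "(\<lambda>k. f (j \<otimes> k)) \<in> K.U" if "j \<in> K" for j
    using K.uniform_shift[OF f(1), of j] that by simp
  \<comment> \<open>The truncation at 0 is there because \<open>finite_separation\<close> asks for
    nonnegativity everywhere, while \<open>f\<close> is nonnegative on \<open>K\<close>.\<close>
  obtain J \<delta> where J: "finite J" "J \<subseteq> K" "\<delta> > 0" "\<And>k. k \<in> K \<Longrightarrow> \<delta> \<le> (\<Sum>j\<in>J. max 0 (f (j \<otimes> k)))"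
  proof (rule finite_separation[of "subtopology T K" K K "\<lambda>j k. max 0 (f (j \<otimes> k))"])
    show "compactin (subtopology T K) K" using K_compact by (simp add: compactin_subtopology)
    show "continuous_map (subtopology T K) euclideanreal (\<lambda>k. max 0 (f (j \<otimes> k)))" if "j \<in> K" for j
      by (intro continuous_map_real_max continuous_map_const[THEN iffD2] K.uniform_continuous shU that) simp
    \<comment> \<open>The translate by \<open>inv k\<close> takes the value \<open>f \<one>\<close>
      at \<open>k\<close>.\<close>
    show "\<exists>j\<in>K. 0 < max 0 (f (j \<otimes> k))" if "k \<in> K" for k
      using f(3) that subgroup.m_inv_closed[OF K_subgroup that] K_sub[OF that]
      by (intro bexI[of _ "inv k"]) auto
  qed auto
  have "\<delta> \<le> m (\<lambda>k. \<Sum>j\<in>J. f (j \<otimes> k))"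
  proof (rule K.mean_ge[OF haar_mean K.uniform_sum[OF J(1)]])
    show "(\<lambda>k. f (j \<otimes> k)) \<in> K.U" if "j \<in> J" for j using shU J(2) that by blast
    fix k assume k: "k \<in> carrier (G\<lparr>carrier := K\<rparr>)"
    have "max 0 (f (j \<otimes> k)) = f (j \<otimes> k)" if "j \<in> J" for j
      using f(2)[of "j \<otimes> k"] k J(2) that subgroup.m_closed[OF K_subgroup, of j k] by auto
    then show "\<delta> \<le> (\<Sum>j\<in>J. f (j \<otimes> k))" using J(4)[of k] k by simp
  qed
  also have "\<dots> = (\<Sum>j\<in>J. m (\<lambda>k. f (j \<otimes> k)))"
    by (rule K.mean_sum[OF haar_mean J(1)]) (use shU J(2) in blast)
  also have "\<dots> = (\<Sum>j\<in>J. m f)"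
    using haar_left f(1) J(2) by (intro sum.cong) auto
  also have "\<dots> = real (card J) * m f" by simp
  finally have pos: "0 < real (card J) * m f" using J(3) by linarith
  show ?thesis
    by (rule ccontr) (use pos mult_nonneg_nonpos[of "real (card J)" "m f"] in auto)
qed

text \<open>Integration against haar * g * haar, a bi-\<open>K\<close>-invariant probability measure
  on the double coset \<open>K g K\<close>. The inverse on \<open>k'\<close> converts right
  translation of \<open>F\<close> by an element of \<open>K\<close> into left translation in
  \<open>k'\<close>, where \<open>haar_left\<close> applies.\<close>

definition double_coset_mean :: "'a \<Rightarrow> ('a \<Rightarrow> real) \<Rightarrow> real" where
  "double_coset_mean g F = m (\<lambda>k. m (\<lambda>k'. F (k \<otimes> g \<otimes> inv k')))"

lemma double_coset_cont:
  assumes F: "continuous_map T euclideanreal F" and g: "g \<in> carrier G"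
  shows double_coset_inner: "k \<in> carrier G \<Longrightarrow> (\<lambda>k'. F (k \<otimes> g \<otimes> inv k')) \<in> K.U"
    and double_coset_outer: "(\<lambda>k. m (\<lambda>k'. F (k \<otimes> g \<otimes> inv k'))) \<in> K.U"
proof -
  show "(\<lambda>k'. F (k \<otimes> g \<otimes> inv k')) \<in> K.U" if "k \<in> carrier G"
    using that g by (intro K_uniform continuous_map_compose'[OF _ F] continuous_mult_compose
        continuous_inv_compose incl_K continuous_const_compose) auto
  show "(\<lambda>k. m (\<lambda>k'. F (k \<otimes> g \<otimes> inv k'))) \<in> K.U"
    using g by (intro K_uniform K.mean_parameter_continuous[OF compact_space_K haar_mean]
        continuous_map_compose'[OF _ F] continuous_mult_compose continuous_inv_compose
        continuous_const_compose continuous_map_compose'[OF continuous_map_fst incl_K]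
        continuous_map_compose'[OF continuous_map_snd incl_K]) auto
qed

lemma double_coset_add:
  assumes F: "continuous_map T euclideanreal F" "continuous_map T euclideanreal F'" and g: "g \<in> carrier G"
  shows "double_coset_mean g (\<lambda>x. F x + F' x) = double_coset_mean g F + double_coset_mean g F'"
proof -
  have "double_coset_mean g (\<lambda>x. F x + F' x) =
      m (\<lambda>k. m (\<lambda>k'. F (k \<otimes> g \<otimes> inv k')) + m (\<lambda>k'. F' (k \<otimes> g \<otimes> inv k')))"
    unfolding double_coset_mean_def
    by (intro haar_cong K.mean_add[OF haar_mean] double_coset_inner F g K_sub)
  also have "\<dots> = double_coset_mean g F + double_coset_mean g F'"
    unfolding double_coset_mean_def by (intro K.mean_add[OF haar_mean] double_coset_outer F g)
  finally show ?thesis .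
qed

lemma double_coset_cmult:
  assumes F: "continuous_map T euclideanreal F" and g: "g \<in> carrier G"
  shows "double_coset_mean g (\<lambda>x. c * F x) = c * double_coset_mean g F"
proof -
  have "double_coset_mean g (\<lambda>x. c * F x) = m (\<lambda>k. c * m (\<lambda>k'. F (k \<otimes> g \<otimes> inv k')))"
    unfolding double_coset_mean_def
    by (intro haar_cong K.mean_cmult[OF haar_mean] double_coset_inner F g K_sub)
  also have "\<dots> = c * double_coset_mean g F"
    unfolding double_coset_mean_def by (intro K.mean_cmult[OF haar_mean] double_coset_outer F g)
  finally show ?thesis .
qed

lemma double_coset_bound:
  assumes F: "continuous_map T euclideanreal F" and g: "g \<in> carrier G"
    and B: "\<And>x. x \<in> carrier G \<Longrightarrow> \<bar>F x\<bar> \<le> B"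
  shows "\<bar>double_coset_mean g F\<bar> \<le> B"
  unfolding double_coset_mean_def
  by (rule K.mean_abs_bound[OF haar_mean double_coset_outer[OF F g]],
      rule K.mean_abs_bound[OF haar_mean double_coset_inner[OF F g]])
     (use g B K_sub in auto)

lemma double_coset_cong:
  assumes "\<And>k k'. k \<in> K \<Longrightarrow> k' \<in> K \<Longrightarrow> F (k \<otimes> g \<otimes> inv k') = F' (k \<otimes> g \<otimes> inv k')"
  shows "double_coset_mean g F = double_coset_mean g F'"
  unfolding double_coset_mean_def by (intro haar_cong assms)

lemma double_coset_left:
  assumes F: "continuous_map T euclideanreal F" and g: "g \<in> carrier G" and k: "k \<in> K"
  shows "double_coset_mean g (\<lambda>x. F (k \<otimes> x)) = double_coset_mean g F"
proof -
  have "double_coset_mean g (\<lambda>x. F (k \<otimes> x)) = m (\<lambda>j. m (\<lambda>k'. F ((k \<otimes> j) \<otimes> g \<otimes> inv k')))"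
    unfolding double_coset_mean_def
    by (intro haar_cong arg_cong[of _ _ F]) (use g k K_sub in \<open>simp add: m_assoc\<close>)
  also have "\<dots> = double_coset_mean g F"
    unfolding double_coset_mean_def by (rule haar_left[OF k double_coset_outer[OF F g]])
  finally show ?thesis .
qed

lemma double_coset_right:
  assumes F: "continuous_map T euclideanreal F" and g: "g \<in> carrier G" and k: "k \<in> K"
  shows "double_coset_mean g (\<lambda>x. F (x \<otimes> k)) = double_coset_mean g F"
  unfolding double_coset_mean_def
proof (rule haar_cong)
  fix j assume j: "j \<in> K"
  have "m (\<lambda>k'. F (j \<otimes> g \<otimes> inv k' \<otimes> k)) = m (\<lambda>k'. F (j \<otimes> g \<otimes> inv (inv k \<otimes> k')))"
    by (intro haar_cong arg_cong[of _ _ F]) (use g k j K_sub in \<open>simp add: m_assoc inv_mult_group\<close>)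
  also have "\<dots> = m (\<lambda>k'. F (j \<otimes> g \<otimes> inv k'))"
    using haar_left[OF subgroup.m_inv_closed[OF K_subgroup k] double_coset_inner[OF F g K_sub[OF j]]] .
  finally show "m (\<lambda>k'. F (j \<otimes> g \<otimes> inv k' \<otimes> k)) = m (\<lambda>k'. F (j \<otimes> g \<otimes> inv k'))" .
qed

section \<open>Double coset integrals as bi-invariant Radon measures, and their convolution\<close>

definition double_coset_measure :: "'a \<Rightarrow> ('a \<Rightarrow> complex) \<Rightarrow> complex" where
  "double_coset_measure g f =
     Complex (double_coset_mean g (\<lambda>x. Re (f x))) (double_coset_mean g (\<lambda>x. Im (f x)))"

lemma double_coset_measure_cong:
  assumes "\<And>k k'. k \<in> K \<Longrightarrow> k' \<in> K \<Longrightarrow> f (k \<otimes> g \<otimes> inv k') = f' (k \<otimes> g \<otimes> inv k')"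
  shows "double_coset_measure g f = double_coset_measure g f'"
  unfolding double_coset_measure_def using assms
  by (intro arg_cong2[of _ _ _ _ Complex] double_coset_cong) auto

lemma double_coset_measure_bi_invariant:
  assumes g: "g \<in> carrier G"
  shows "double_coset_measure g \<in> bi_invariant_measures G T K"
proof -
  have RI: "continuous_map T euclideanreal (\<lambda>x. Re (f x))" "continuous_map T euclideanreal (\<lambda>x. Im (f x))"
    if "f \<in> compactly_supported T" for f
    using that continuous_map_Re_Im by (auto simp: compactly_supported_def)
  show ?thesis
    unfolding bi_invariant_measures_def bounded_measures_def mem_Collect_eq
  proof (intro conjI ballI allI)
    fix f h :: "'a \<Rightarrow> complex" assume fh: "f \<in> compactly_supported T" "h \<in> compactly_supported T"
    show "double_coset_measure g (\<lambda>x. f x + h x) = double_coset_measure g f + double_coset_measure g h"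
      by (simp add: double_coset_measure_def double_coset_add RI fh g complex_eq_iff)
  next
    fix f :: "'a \<Rightarrow> complex" and c assume f: "f \<in> compactly_supported T"
    have "double_coset_mean g (\<lambda>x. Re (c * f x)) =
        double_coset_mean g (\<lambda>x. Re c * Re (f x) + (- Im c) * Im (f x))" by simp
    also have "\<dots> = Re c * double_coset_mean g (\<lambda>x. Re (f x)) + (- Im c) * double_coset_mean g (\<lambda>x. Im (f x))"
      using RI[OF f] g by (subst double_coset_add) (simp_all only: double_coset_cmult continuous_map_real_mult_left)
    finally have 1: "double_coset_mean g (\<lambda>x. Re (c * f x)) =
        Re c * double_coset_mean g (\<lambda>x. Re (f x)) + (- Im c) * double_coset_mean g (\<lambda>x. Im (f x))" .
    have "double_coset_mean g (\<lambda>x. Im (c * f x)) =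
        double_coset_mean g (\<lambda>x. Re c * Im (f x) + Im c * Re (f x))" by simp
    also have "\<dots> = Re c * double_coset_mean g (\<lambda>x. Im (f x)) + Im c * double_coset_mean g (\<lambda>x. Re (f x))"
      using RI[OF f] g by (subst double_coset_add) (simp_all only: double_coset_cmult continuous_map_real_mult_left)
    finally show "double_coset_measure g (\<lambda>x. c * f x) = c * double_coset_measure g f"
      using 1 by (simp only: double_coset_measure_def complex_eq_iff complex.sel times_complex.sel) simp
  next
    show "\<exists>B. \<forall>f\<in>compactly_supported T. norm (double_coset_measure g f) \<le> B * (SUP x\<in>topspace T. norm (f x))"
    proof (intro exI[of _ 2] ballI)
      fix f :: "'a \<Rightarrow> complex" assume f: "f \<in> compactly_supported T"
      define S where "S = (SUP x\<in>topspace T. norm (f x))"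
      obtain C where C: "compactin T C" "\<And>x. x \<in> topspace T - C \<Longrightarrow> f x = 0"
        and cont: "continuous_map T euclidean f"
        using f by (auto simp: compactly_supported_def)
      have "compact ((\<lambda>x. norm (f x)) ` C)"
        using image_compactin[OF C(1) continuous_map_norm[OF cont]] by simp
      \<comment> \<open>The value 0 accounts for the points outside \<open>C\<close>.\<close>
      then have "bdd_above (insert 0 ((\<lambda>x. norm (f x)) ` C))"
        by (simp add: bounded_imp_bdd_above compact_imp_bounded)
      then have bdd: "bdd_above ((\<lambda>x. norm (f x)) ` topspace T)"
      proof (rule bdd_above_mono, intro image_subsetI)
        show "norm (f x) \<in> insert 0 ((\<lambda>x. norm (f x)) ` C)" if "x \<in> topspace T" for x
          using C(2)[of x] that by (cases "x \<in> C") auto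
      qed
      have S: "norm (f x) \<le> S" if "x \<in> carrier G" for x
        unfolding S_def using that bdd by (intro cSUP_upper) (auto simp: topspace_carrier)
      have "\<bar>double_coset_mean g (\<lambda>x. Re (f x))\<bar> \<le> S"
        by (rule double_coset_bound[OF RI(1)[OF f] g]) (meson S abs_Re_le_cmod order_trans)
      moreover have "\<bar>double_coset_mean g (\<lambda>x. Im (f x))\<bar> \<le> S"
        by (rule double_coset_bound[OF RI(2)[OF f] g]) (meson S abs_Im_le_cmod order_trans)
      \<comment> \<open>Real and imaginary parts are bounded by \<open>S\<close> separately; this is
        the origin of the constant 2.\<close>
      moreover have "norm (double_coset_measure g f) \<le>
          \<bar>double_coset_mean g (\<lambda>x. Re (f x))\<bar> + \<bar>double_coset_mean g (\<lambda>x. Im (f x))\<bar>"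
        using cmod_le[of "double_coset_measure g f"] by (simp add: double_coset_measure_def)
      ultimately show "norm (double_coset_measure g f) \<le> 2 * S" by linarith
    qed
  next
    fix k and f :: "'a \<Rightarrow> complex" assume k: "k \<in> K" and f: "f \<in> compactly_supported T"
    show "double_coset_measure g (\<lambda>x. f (k \<otimes> x)) = double_coset_measure g f"
      using double_coset_left[OF RI(1)[OF f] g k] double_coset_left[OF RI(2)[OF f] g k]
      by (simp add: double_coset_measure_def)
    show "double_coset_measure g (\<lambda>x. f (x \<otimes> k)) = double_coset_measure g f"
      using double_coset_right[OF RI(1)[OF f] g k] double_coset_right[OF RI(2)[OF f] g k]
      by (simp add: double_coset_measure_def)
  qed
qed

lemma double_coset_compact:
  assumes "g \<in> carrier G"
  shows "compactin T ((\<lambda>p. fst p \<otimes> g \<otimes> inv (snd p)) ` (K \<times> K))"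
proof (rule image_compactin)
  show "compactin (prod_topology T T) (K \<times> K)" by (simp add: compactin_Times K_compact)
  show "continuous_map (prod_topology T T) T (\<lambda>p. fst p \<otimes> g \<otimes> inv (snd p))"
    using assms by (intro continuous_mult_compose continuous_inv_compose continuous_const_compose
        continuous_map_fst continuous_map_snd)
qed

text \<open>The two measures are carried by the compact sets \<open>K g K\<close> and
  \<open>K h K\<close>. Every cut-off equal to one on the product of these sets gives the same
  value, so the limit that defines \<open>measure_integral\<close> is attained.\<close>

lemma convolution_double_coset:
  assumes lc: "locally_compact_space T" "Hausdorff_space T" and g: "g \<in> carrier G" "h \<in> carrier G"
  shows "convolution G T (double_coset_measure g) (double_coset_measure h) f =
    double_coset_measure g (\<lambda>x. double_coset_measure h (\<lambda>y. f (x \<otimes> y)))"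
  unfolding convolution_def push_forward_def
proof (rule measure_integral_compact)
  define D where "D g = (\<lambda>p. fst p \<otimes> g \<otimes> inv (snd p)) ` (K \<times> K)" for g
  have DI: "k \<otimes> g \<otimes> inv k' \<in> D g" if "k \<in> K" "k' \<in> K" for k k' g
    unfolding D_def using that by (intro image_eqI[of _ _ "(k, k')"]) auto
  show "locally_compact_space (prod_topology T T)" "Hausdorff_space (prod_topology T T)"
    using lc by (simp_all add: locally_compact_space_prod_topology Hausdorff_space_prod_topology)
  show "compactin (prod_topology T T) (D g \<times> D h)"
    using double_coset_compact[OF g(1)] double_coset_compact[OF g(2)] by (simp add: compactin_Times D_def)
  fix \<phi> :: "'a \<times> 'a \<Rightarrow> real" assume \<phi>: "\<And>x. x \<in> D g \<times> D h \<Longrightarrow> \<phi> x = 1"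
  show "product_measure (double_coset_measure g) (double_coset_measure h)
      (\<lambda>x. complex_of_real (\<phi> x) * f (case x of (x, y) \<Rightarrow> x \<otimes> y)) =
    double_coset_measure g (\<lambda>x. double_coset_measure h (\<lambda>y. f (x \<otimes> y)))"
    unfolding product_measure_def
    by (intro double_coset_measure_cong) (simp add: \<phi> DI)
qed

text \<open>The left side is the convolution of the two measures, evaluated at a right-invariant function.\<close>
lemma double_coset_mean_mult:
  assumes F: "continuous_map T euclideanreal F"
    and inv_F: "\<And>x k. x \<in> carrier G \<Longrightarrow> k \<in> K \<Longrightarrow> F (x \<otimes> k) = F x"
    and g: "g \<in> carrier G" "h \<in> carrier G"
  shows "double_coset_mean g (\<lambda>x. double_coset_mean h (\<lambda>y. F (x \<otimes> y))) =
    m (\<lambda>k. m (\<lambda>k'. F (k \<otimes> g \<otimes> k' \<otimes> h)))"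
proof -
  have inner: "double_coset_mean h (\<lambda>y. F (k \<otimes> g \<otimes> inv j \<otimes> y)) = m (\<lambda>k'. F (k \<otimes> g \<otimes> k' \<otimes> h))"
    if k: "k \<in> K" "j \<in> K" for k j
  proof -
    have kj: "k \<in> carrier G" "j \<in> carrier G" using k K_sub by auto
    have jK: "inv j \<in> K" using k subgroup.m_inv_closed[OF K_subgroup] by blast
    \<comment> \<open>The last factor \<open>inv i'\<close> lies in \<open>K\<close> and disappears
      by right invariance of \<open>F\<close>; afterwards \<open>inv j\<close> is absorbed by left
      invariance of the Haar integral in the variable \<open>i\<close>.\<close>
    have "m (\<lambda>i'. F (k \<otimes> g \<otimes> inv j \<otimes> (i \<otimes> h \<otimes> inv i'))) = F (k \<otimes> g \<otimes> (inv j \<otimes> i) \<otimes> h)"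
      if i: "i \<in> K" for i
    proof -
      have "m (\<lambda>i'. F (k \<otimes> g \<otimes> inv j \<otimes> (i \<otimes> h \<otimes> inv i'))) = m (\<lambda>i'. F (k \<otimes> g \<otimes> (inv j \<otimes> i) \<otimes> h))"
      proof (rule haar_cong)
        fix i' assume i': "i' \<in> K"
        have "k \<otimes> g \<otimes> inv j \<otimes> (i \<otimes> h \<otimes> inv i') = (k \<otimes> g \<otimes> (inv j \<otimes> i) \<otimes> h) \<otimes> inv i'"
          using g kj K_sub[OF i] K_sub[OF i'] by (simp add: m_assoc)
        then show "F (k \<otimes> g \<otimes> inv j \<otimes> (i \<otimes> h \<otimes> inv i')) = F (k \<otimes> g \<otimes> (inv j \<otimes> i) \<otimes> h)"
          using inv_F[OF _ subgroup.m_inv_closed[OF K_subgroup i']] g kj K_sub[OF i] by simp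
      qed
      then show ?thesis by (simp add: K.mean_const[OF haar_mean])
    qed
    then have "double_coset_mean h (\<lambda>y. F (k \<otimes> g \<otimes> inv j \<otimes> y)) = m (\<lambda>i. F (k \<otimes> g \<otimes> (inv j \<otimes> i) \<otimes> h))"
      unfolding double_coset_mean_def by (intro haar_cong)
    also have "\<dots> = m (\<lambda>k'. F (k \<otimes> g \<otimes> k' \<otimes> h))"
    proof (rule haar_left[OF jK])
      show "(\<lambda>k'. F (k \<otimes> g \<otimes> k' \<otimes> h)) \<in> K.U"
        using g kj by (intro K_uniform continuous_map_compose'[OF _ F] continuous_mult_compose
            incl_K continuous_const_compose) auto
    qed
    finally show ?thesis .
  qed
  have "double_coset_mean g (\<lambda>x. double_coset_mean h (\<lambda>y. F (x \<otimes> y))) =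
      m (\<lambda>k. m (\<lambda>j. m (\<lambda>k'. F (k \<otimes> g \<otimes> k' \<otimes> h))))"
    unfolding double_coset_mean_def[of g] by (intro haar_cong inner)
  then show ?thesis by (simp add: K.mean_const[OF haar_mean])
qed

text \<open>Convolutions commute as functionals on compactly supported functions, whereas
  \<open>F\<close> is any right invariant continuous function. The two convolutions are carried by
  the compact sets \<open>K g K h K\<close> and \<open>K h K g K\<close>, so \<open>F\<close> may be
  multiplied by a cut-off \<open>\<psi>\<close> equal to one on both.\<close>

theorem gelfand_mean_commute:
  assumes lc: "locally_compact_space T" "Hausdorff_space T" and gp: "gelfand_pair G T K"
    and F: "continuous_map T euclideanreal F"
    and inv_F: "\<And>x k. x \<in> carrier G \<Longrightarrow> k \<in> K \<Longrightarrow> F (x \<otimes> k) = F x"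
    and g: "g \<in> carrier G" "h \<in> carrier G"
  shows "m (\<lambda>k. m (\<lambda>k'. F (k \<otimes> g \<otimes> k' \<otimes> h))) = m (\<lambda>k. m (\<lambda>k'. F (k \<otimes> h \<otimes> k' \<otimes> g)))"
proof -
  define D where "D g = (\<lambda>p. fst p \<otimes> g \<otimes> inv (snd p)) ` (K \<times> K)" for g
  have DI: "k \<otimes> g \<otimes> inv k' \<in> D g" if "k \<in> K" "k' \<in> K" for k k' g
    unfolding D_def using that by (intro image_eqI[of _ _ "(k, k')"]) auto
  have D: "compactin T (D g)" if "g \<in> carrier G" for g
    unfolding D_def by (rule double_coset_compact[OF that])
  define E where "E g h = (\<lambda>p. fst p \<otimes> snd p) ` (D g \<times> D h)" for g h
  have E: "compactin T (E g h)" if "g \<in> carrier G" "h \<in> carrier G" for g h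
    unfolding E_def
  proof (rule image_compactin)
    show "compactin (prod_topology T T) (D g \<times> D h)" using D that by (simp add: compactin_Times)
    show "continuous_map (prod_topology T T) T (\<lambda>p. fst p \<otimes> snd p)"
      by (intro continuous_mult_compose continuous_map_fst continuous_map_snd)
  qed
  have EI: "x \<otimes> y \<in> E g h" if "x \<in> D g" "y \<in> D h" for x y g h
    unfolding E_def using that by (intro image_eqI[of _ _ "(x, y)"]) auto
  obtain \<psi> :: "'a \<Rightarrow> real" where \<psi>: "\<psi> \<in> compactly_supported T" "\<And>x. x \<in> E g h \<union> E h g \<Longrightarrow> \<psi> x = 1"
    using cutoff_exists[OF lc compactin_Un[OF E[OF g] E[OF g(2,1)]]] by metis
  define f where "f x = complex_of_real (\<psi> x * F x)" for x
  have f: "f \<in> compactly_supported T"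
  proof -
    have "continuous_map T euclideanreal \<psi> \<and> (\<exists>C. compactin T C \<and> (\<forall>x\<in>topspace T - C. \<psi> x = 0))"
      using \<psi>(1) unfolding compactly_supported_def mem_Collect_eq .
    then obtain C where C: "continuous_map T euclideanreal \<psi>" "compactin T C" "\<forall>x\<in>topspace T - C. \<psi> x = 0"
      by (elim exE conjE)
    have "continuous_map T euclidean (\<lambda>x. complex_of_real (\<psi> x * F x))"
      by (rule continuous_map_compose'[OF continuous_map_real_mult[OF C(1) F]])
         (simp add: continuous_on_of_real continuous_on_id)
    moreover have "\<forall>x\<in>topspace T - C. complex_of_real (\<psi> x * F x) = 0" using C(3) by simp
    ultimately show ?thesis
      unfolding compactly_supported_def f_def[abs_def] using C(2) by blast
  qed
  have Re_conv: "Re (convolution G T (double_coset_measure a) (double_coset_measure b) f) =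
      m (\<lambda>k. m (\<lambda>k'. F (k \<otimes> a \<otimes> k' \<otimes> b)))"
    if ab: "a \<in> carrier G" "b \<in> carrier G" "E a b \<subseteq> E g h \<union> E h g" for a b
  proof -
    have "Re (convolution G T (double_coset_measure a) (double_coset_measure b) f) =
        double_coset_mean a (\<lambda>x. double_coset_mean b (\<lambda>y. Re (f (x \<otimes> y))))"
      by (simp add: convolution_double_coset[OF lc ab(1,2)] double_coset_measure_def)
    also have "\<dots> = double_coset_mean a (\<lambda>x. double_coset_mean b (\<lambda>y. F (x \<otimes> y)))"
    proof (intro double_coset_cong)
      fix k k' j j' assume K: "k \<in> K" "k' \<in> K" "j \<in> K" "j' \<in> K"
      have "k \<otimes> a \<otimes> inv k' \<otimes> (j \<otimes> b \<otimes> inv j') \<in> E a b"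
        by (intro EI DI K)
      then show "Re (f (k \<otimes> a \<otimes> inv k' \<otimes> (j \<otimes> b \<otimes> inv j'))) = F (k \<otimes> a \<otimes> inv k' \<otimes> (j \<otimes> b \<otimes> inv j'))"
        using \<psi>(2) ab(3) by (auto simp: f_def)
    qed
    also have "\<dots> = m (\<lambda>k. m (\<lambda>k'. F (k \<otimes> a \<otimes> k' \<otimes> b)))"
      by (rule double_coset_mean_mult[OF F inv_F ab(1,2)])
    finally show ?thesis .
  qed
  have "convolution G T (double_coset_measure g) (double_coset_measure h) f =
      convolution G T (double_coset_measure h) (double_coset_measure g) f"
    using gp f double_coset_measure_bi_invariant[OF g(1)] double_coset_measure_bi_invariant[OF g(2)]
    unfolding gelfand_pair_def by blast
  then show ?thesis
    using Re_conv[OF g] Re_conv[OF g(2,1)] by simp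
qed

end

section \<open>The stabiliser of an extreme mean\<close>

lemma continuous_on_functions_realI:
  fixes q :: "('x \<Rightarrow> real) \<Rightarrow> real"
  assumes "\<And>y0 \<epsilon>. y0 \<in> S \<Longrightarrow> \<epsilon> > 0 \<Longrightarrow> \<exists>J \<delta>. finite J \<and> \<delta> > 0 \<and>
    (\<forall>y\<in>S. (\<forall>\<phi>\<in>J. \<bar>y \<phi> - y0 \<phi>\<bar> < \<delta>) \<longrightarrow> \<bar>q y - q y0\<bar> < \<epsilon>)"
  shows "continuous_on S q"
  unfolding continuous_on_def
proof (intro ballI tendstoI)
  fix y0 and \<epsilon> :: real assume y0: "y0 \<in> S" and \<epsilon>: "\<epsilon> > 0"
  obtain J \<delta> where J: "finite J" "\<delta> > 0"
    "\<forall>y\<in>S. (\<forall>\<phi>\<in>J. \<bar>y \<phi> - y0 \<phi>\<bar> < \<delta>) \<longrightarrow> \<bar>q y - q y0\<bar> < \<epsilon>"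
    using assms[OF y0 \<epsilon>] by (elim exE conjE)
  have "\<forall>\<^sub>F y in at y0 within S. \<bar>y \<phi> - y0 \<phi>\<bar> < \<delta>" for \<phi>
  proof -
    have "((\<lambda>y. y \<phi>) \<longlongrightarrow> y0 \<phi>) (at y0 within S)"
      using continuous_on_eval[of S \<phi>] y0 by (simp add: continuous_on_def)
    from tendstoD[OF this J(2)] show ?thesis by (simp add: dist_real_def)
  qed
  then have "\<forall>\<^sub>F y in at y0 within S. \<forall>\<phi>\<in>J. \<bar>y \<phi> - y0 \<phi>\<bar> < \<delta>"
    using J(1) by (intro eventually_ball_finite) auto
  moreover have "\<forall>\<^sub>F y in at y0 within S. y \<in> S"
    by (simp add: eventually_at_filter)
  ultimately show "\<forall>\<^sub>F y in at y0 within S. dist (q y) (q y0) < \<epsilon>"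
    by eventually_elim (use J(3) in \<open>simp add: dist_real_def\<close>)
qed

lemma eq_if_close:
  fixes a b c :: real
  assumes "\<And>\<epsilon>. \<epsilon> > 0 \<Longrightarrow> \<bar>a - b\<bar> \<le> c * \<epsilon>"
  shows "a = b"
proof (rule ccontr)
  assume "a \<noteq> b"
  define d where "d = \<bar>a - b\<bar>"
  define D where "D = \<bar>c\<bar> + 1"
  have D: "D > 0" and d: "d > 0" using \<open>a \<noteq> b\<close> by (simp_all add: D_def d_def)
  have "d \<le> c * (d / (2 * D))" using d D unfolding d_def by (intro assms) simp
  also have "\<dots> \<le> D * (d / (2 * D))"
    using d D by (intro mult_right_mono) (auto simp: D_def)
  also have "\<dots> = d / 2" using D by simp
  finally show False using d by linarith
qed

context top_group
begin

lemma mean_deviation: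
  assumes "w \<in> means" "f \<in> U" "q \<in> U" "\<And>x. x \<in> carrier G \<Longrightarrow> \<bar>f x - c\<bar> \<le> q x"
  shows "\<bar>w f - c\<bar> \<le> w q"
proof -
  have cU: "(\<lambda>x. c) \<in> U" by (rule uniform_const)
  have "w (\<lambda>x. f x - c) \<le> w q"
    by (rule mean_mono[OF assms(1) uniform_diff[OF assms(2) cU] assms(3)]) (use assms(4) in \<open>auto simp: abs_le_iff\<close>)
  moreover have "w (\<lambda>x. c - f x) \<le> w q"
    by (rule mean_mono[OF assms(1) uniform_diff[OF cU assms(2)] assms(3)]) (use assms(4) in \<open>auto simp: abs_le_iff\<close>)
  ultimately show ?thesis
    by (simp add: mean_diff[OF assms(1,2) cU] mean_diff[OF assms(1) cU assms(2)] mean_const[OF assms(1)] abs_le_iff)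
qed

text \<open>Translating a mean amounts to right translation of its orbit functions; hence these are
  right invariant under the stabiliser of the mean.\<close>

lemma orbit_fn_conv_point:
  assumes "w \<in> means" "f \<in> U" "g \<in> carrier G" "h \<in> carrier G"
  shows "orbit_fn (conv (point_mean h) w) f g = orbit_fn w f (g \<otimes> h)"
  using assms by (simp add: orbit_fn_conv point_mean) (simp add: point_mean_def uniform_shift orbit_fn_uniform)

section \<open>Stabilisers, and amenability from a mean carried by a subgroup\<close>

definition stabilizer :: "(('a \<Rightarrow> real) \<Rightarrow> real) \<Rightarrow> 'a set" where
  "stabilizer x = {g \<in> carrier G. conv (point_mean g) x = x}"

lemma stabilizer_subgroup:
  assumes x: "x \<in> means"
  shows "subgroup (stabilizer x) G"
proof
  show "stabilizer x \<subseteq> carrier G" by (auto simp: stabilizer_def)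
  show "\<one> \<in> stabilizer x" using x by (simp add: stabilizer_def conv_point_mean_one)
  show "g \<otimes> h \<in> stabilizer x" if "g \<in> stabilizer x" "h \<in> stabilizer x" for g h
    using that x conv_point_mean_mult[of g h x] by (simp add: stabilizer_def)
  show "inv g \<in> stabilizer x" if "g \<in> stabilizer x" for g
    using that x conv_point_mean_mult[of "inv g" g x] by (simp add: stabilizer_def conv_point_mean_one)
qed

text \<open>Sup-convolution of \<open>f\<close> with a steep bump at the identity.\<close>
lemma uniform_extension:
  assumes lc: "locally_compact_space T" "Hausdorff_space T" and P: "subgroup P G"
    and f: "f \<in> uniform_functions (G\<lparr>carrier := P\<rparr>) (subtopology T P)" and \<epsilon>: "\<epsilon> > 0"
  obtains \<Phi> where "\<Phi> \<in> U" "\<And>p. p \<in> P \<Longrightarrow> \<bar>\<Phi> p - f p\<bar> \<le> \<epsilon>"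
proof -
  interpret P: top_group "G\<lparr>carrier := P\<rparr>" "subtopology T P"
    by (rule top_group.intro[OF subgroup_top_group[OF P]])
  have PG: "p \<in> carrier G" if "p \<in> P" for p using subgroup.mem_carrier[OF P that] .
  have oneP: "\<one> \<in> P" by (rule subgroup.one_closed[OF P])
  obtain V' where V': "openin (subtopology T P) V'" "\<one>\<^bsub>G\<lparr>carrier := P\<rparr>\<^esub> \<in> V'"
    "\<And>v x. v \<in> V' \<Longrightarrow> x \<in> carrier (G\<lparr>carrier := P\<rparr>) \<Longrightarrow> \<bar>f (v \<otimes>\<^bsub>G\<lparr>carrier := P\<rparr>\<^esub> x) - f x\<bar> < \<epsilon>"
    using P.uniformD[OF f \<epsilon>] by metis
  obtain V where V: "openin T V" "V' = V \<inter> P"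
    using V'(1) unfolding openin_subtopology by (elim exE conjE)
  have oneV: "\<one> \<in> V" using V'(2) V(2) by simp
  have fV: "\<bar>f (v \<otimes> p) - f p\<bar> < \<epsilon>" if "v \<in> V" "v \<in> P" "p \<in> P" for v p
    using V'(3)[of v p] V(2) that by simp
  obtain B where B: "B > 0" "\<And>p. p \<in> carrier (G\<lparr>carrier := P\<rparr>) \<Longrightarrow> \<bar>f p\<bar> \<le> B"
    using P.uniform_bounded[OF f] by metis
  obtain \<psi> :: "'a \<Rightarrow> real" where \<psi>: "\<psi> \<in> U" "\<And>x. x \<in> carrier G \<Longrightarrow> 0 \<le> \<psi> x \<and> \<psi> x \<le> 1"
    "\<psi> \<one> = 1" "\<And>x. x \<in> carrier G - V \<Longrightarrow> \<psi> x = 0"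
  proof -
    have c1: "compactin T {\<one>}" by (simp add: topspace_carrier)
    \<comment> \<open>\<open>a\<close> supplies compact support and \<open>b\<close> vanishes
      outside \<open>V\<close>; their product has both properties.\<close>
    obtain a :: "'a \<Rightarrow> real" where a: "a \<in> compactly_supported T"
      "\<And>x. x \<in> topspace T \<Longrightarrow> 0 \<le> a x \<and> a x \<le> 1" "\<And>x. x \<in> {\<one>} \<Longrightarrow> a x = 1"
      using cutoff_exists[OF lc c1] by metis
    have "completely_regular_space T"
      using locally_compact_regular_imp_completely_regular_space lc by blast
    moreover have "closedin T (topspace T - V)" using V by blast
    moreover have "disjnt {\<one>} (topspace T - V)" using oneV by (auto simp: disjnt_def)
    ultimately obtain b where b: "continuous_map T (top_of_set {0..1::real}) b"
      "b ` (topspace T - V) \<subseteq> {0}" "b ` {\<one>} \<subseteq> {1}"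
      using Urysohn_completely_regular_compact_closed[of 0 1 T "{\<one>}" "topspace T - V"] c1 by auto
    have b': "continuous_map T euclideanreal b" "\<And>x. x \<in> topspace T \<Longrightarrow> 0 \<le> b x \<and> b x \<le> 1"
      using b(1) by (auto simp: continuous_map_in_subtopology)
    have "continuous_map T euclideanreal a \<and> (\<exists>C. compactin T C \<and> (\<forall>x\<in>topspace T - C. a x = 0))"
      using a(1) unfolding compactly_supported_def mem_Collect_eq .
    then obtain C where C: "continuous_map T euclideanreal a" "compactin T C" "\<forall>x\<in>topspace T - C. a x = 0"
      by (elim exE conjE)
    have "(\<lambda>x. a x * b x) \<in> compactly_supported T"
      unfolding compactly_supported_def mem_Collect_eq
      by (intro conjI continuous_map_real_mult C(1) b'(1) exI[of _ C] C(2)) (use C(3) in simp)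
    then have "(\<lambda>x. a x * b x) \<in> U" by (rule compactly_supported_uniform[OF lc(1)])
    then show thesis
    proof (rule that)
      show "0 \<le> a x * b x \<and> a x * b x \<le> 1" if "x \<in> carrier G" for x
        using a(2)[of x] b'(2)[of x] that by (simp add: topspace_carrier mult_le_one)
      show "a \<one> * b \<one> = 1" using a(3) b(3) by simp
      show "a x * b x = 0" if "x \<in> carrier G - V" for x
        using b(2) that by (auto simp: topspace_carrier)
    qed
  qed
  \<comment> \<open>The penalty \<open>2 * B\<close> matches the largest possible oscillation of
    \<open>f\<close>. For \<open>g\<close> in \<open>P\<close>, an index \<open>p\<close> with
    \<open>g \<otimes> inv p\<close> outside \<open>V\<close> contributes at most
    \<open>- B\<close>, which is below \<open>f g\<close>; for the other \<open>p\<close> the values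
    \<open>f p\<close> and \<open>f g\<close> differ by less than \<open>\<epsilon>\<close>.\<close>
  define r where "r g p = f p - (2 * B) * (1 - \<psi> (g \<otimes> inv p))" for g p
  define \<Phi> where "\<Phi> g = (SUP p\<in>P. r g p)" for g
  have quot: "g \<otimes> inv p \<in> carrier G" if "g \<in> carrier G" "p \<in> P" for g p
    using that PG by simp
  have r_le: "r g p \<le> B" and r_ge: "- (3 * B) \<le> r g p" if gp: "g \<in> carrier G" "p \<in> P" for g p
  proof -
    have "0 \<le> (2 * B) * (1 - \<psi> (g \<otimes> inv p))" "(2 * B) * (1 - \<psi> (g \<otimes> inv p)) \<le> 2 * B"
      using \<psi>(2)[OF quot[OF gp]] B(1) by (auto intro!: mult_left_le)
    moreover have "\<bar>f p\<bar> \<le> B" using B(2) gp(2) by simp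
    ultimately show "r g p \<le> B" "- (3 * B) \<le> r g p" unfolding r_def by linarith+
  qed
  have bdd: "bdd_above (r g ` P)" if "g \<in> carrier G" for g
    using r_le[OF that] by (auto intro!: bdd_aboveI[of _ B])
  have upper: "r g p \<le> \<Phi> g" if "g \<in> carrier G" "p \<in> P" for g p
    unfolding \<Phi>_def by (rule cSUP_upper[OF that(2) bdd[OF that(1)]])
  have least: "\<Phi> g \<le> c" if "\<And>p. p \<in> P \<Longrightarrow> r g p \<le> c" for g c
    unfolding \<Phi>_def by (rule cSUP_least) (use oneP that in auto)
  have \<Phi>_le: "\<Phi> g \<le> \<Phi> h + (2 * B) * \<eta>"
    if "g \<in> carrier G" "h \<in> carrier G" "\<And>p. p \<in> P \<Longrightarrow> \<bar>\<psi> (g \<otimes> inv p) - \<psi> (h \<otimes> inv p)\<bar> \<le> \<eta>" for g h \<eta>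
  proof (rule least)
    fix p assume p: "p \<in> P"
    have "(2 * B) * (\<psi> (g \<otimes> inv p) - \<psi> (h \<otimes> inv p)) \<le> (2 * B) * \<eta>"
      using that(3)[OF p] B(1) by (intro mult_left_mono) auto
    moreover have "r g p = r h p + (2 * B) * (\<psi> (g \<otimes> inv p) - \<psi> (h \<otimes> inv p))"
      by (simp add: r_def algebra_simps)
    ultimately show "r g p \<le> \<Phi> h + (2 * B) * \<eta>" using upper[OF that(2) p] by linarith
  qed
  have "\<Phi> \<in> U"
  proof (rule uniformI)
    fix g assume g: "g \<in> carrier G"
    have "\<Phi> g \<le> B" by (rule least) (rule r_le[OF g])
    moreover have "- (3 * B) \<le> \<Phi> g" using upper[OF g oneP] r_ge[OF g oneP] by linarith
    ultimately show "\<bar>\<Phi> g\<bar> \<le> 3 * B" using B(1) by linarith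
  next
    fix \<eta> :: real assume \<eta>: "\<eta> > 0"
    \<comment> \<open>\<open>\<Phi>\<close> varies by at most \<open>2 * B\<close> times the
      variation of \<open>\<psi>\<close>; the further factor 2 gives a strict inequality.\<close>
    define \<eta>' where "\<eta>' = \<eta> / (4 * B)"
    have \<eta>': "\<eta>' > 0" "(2 * B) * \<eta>' < \<eta>" using \<eta> B(1) by (auto simp: \<eta>'_def)
    obtain W where W: "openin T W" "\<one> \<in> W" "\<And>v x. v \<in> W \<Longrightarrow> x \<in> carrier G \<Longrightarrow> \<bar>\<psi> (v \<otimes> x) - \<psi> x\<bar> < \<eta>'"
      using uniformD[OF \<psi>(1) \<eta>'(1)] by metis
    have "\<bar>\<Phi> (v \<otimes> g) - \<Phi> g\<bar> < \<eta>" if v: "v \<in> W" and g: "g \<in> carrier G" for v g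
    proof -
      have vG: "v \<in> carrier G" by (rule openin_carrier[OF W(1) v])
      have d: "\<bar>\<psi> (v \<otimes> g \<otimes> inv p) - \<psi> (g \<otimes> inv p)\<bar> \<le> \<eta>'" if "p \<in> P" for p
        using W(3)[OF v quot[OF g that]] vG g PG[OF that] by (simp add: m_assoc)
      have "\<Phi> (v \<otimes> g) \<le> \<Phi> g + (2 * B) * \<eta>'"
        by (rule \<Phi>_le) (use vG g d in auto)
      moreover have "\<Phi> g \<le> \<Phi> (v \<otimes> g) + (2 * B) * \<eta>'"
        by (rule \<Phi>_le) (use vG g d in \<open>auto simp: abs_minus_commute\<close>)
      ultimately show ?thesis using \<eta>'(2) by linarith
    qed
    then show "\<exists>V. openin T V \<and> \<one> \<in> V \<and> (\<forall>v\<in>V. \<forall>x\<in>carrier G. \<bar>\<Phi> (v \<otimes> x) - \<Phi> x\<bar> < \<eta>)"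
      using W by blast
  qed
  moreover have "\<bar>\<Phi> q - f q\<bar> \<le> \<epsilon>" if q: "q \<in> P" for q
  proof -
    have "r q q = f q" using PG[OF q] by (simp add: r_def \<psi>(3))
    then have "f q \<le> \<Phi> q" using upper[OF PG[OF q] q] by simp
    moreover have "\<Phi> q \<le> f q + \<epsilon>"
    proof (rule least)
      fix p assume p: "p \<in> P"
      define v where "v = q \<otimes> inv p"
      have v: "v \<in> P" unfolding v_def
        using q subgroup.m_closed[OF P] subgroup.m_inv_closed[OF P p] by blast
      have q_eq: "q = v \<otimes> p" using PG[OF p] PG[OF q] by (simp add: v_def m_assoc)
      show "r q p \<le> f q + \<epsilon>"
      proof (cases "v \<in> V")
        case True
        have "0 \<le> (2 * B) * (1 - \<psi> v)" using \<psi>(2)[OF PG[OF v]] B(1) by simp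
        then show ?thesis
          using fV[OF True v p] unfolding r_def v_def[symmetric] q_eq[symmetric] by linarith
      next
        case False
        have "\<bar>f p\<bar> \<le> B" "\<bar>f q\<bar> \<le> B" using B(2) p q by auto
        moreover have "r q p = f p - 2 * B"
          using \<psi>(4)[of v] False PG[OF v] by (simp add: r_def v_def[symmetric])
        ultimately show ?thesis using \<epsilon> by linarith
      qed
    qed
    ultimately show ?thesis by linarith
  qed
  ultimately show thesis by (rule that)
qed

text \<open>The hypothesis \<open>conc\<close> expresses that \<open>x\<close> is carried by
  \<open>P\<close>. Consequently any \<open>\<Phi>\<close> in \<open>U\<close> that agrees with
  \<open>f\<close> on \<open>P\<close> up to \<open>\<epsilon>\<close> has \<open>x \<Phi>\<close>
  within \<open>\<epsilon>\<close> of \<open>n f\<close> (fact \<open>close\<close>), and linearity,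
  positivity and invariance pass from \<open>x\<close> to \<open>n\<close> through approximate
  extensions with an error that tends to 0.\<close>

lemma amenable_subgroupI:
  assumes lc: "locally_compact_space T" "Hausdorff_space T" and P: "subgroup P G"
    and x: "x \<in> means" "\<And>p. p \<in> P \<Longrightarrow> conv (point_mean p) x = x"
    and conc: "\<And>\<Phi>. \<Phi> \<in> U \<Longrightarrow> (\<And>p. p \<in> P \<Longrightarrow> 0 \<le> \<Phi> p) \<Longrightarrow> 0 \<le> x \<Phi>"
  shows "amenable_subgroup G T P"
proof -
  interpret P: top_group "G\<lparr>carrier := P\<rparr>" "subtopology T P"
    by (rule top_group.intro[OF subgroup_top_group[OF P]])
  have PG: "p \<in> carrier G" if "p \<in> P" for p using subgroup.mem_carrier[OF P that] .
  have mono: "x \<Phi> \<le> x \<Psi> + c" if "\<Phi> \<in> U" "\<Psi> \<in> U" "\<And>p. p \<in> P \<Longrightarrow> \<Phi> p \<le> \<Psi> p + c" for \<Phi> \<Psi> c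
  proof -
    have "0 \<le> x (\<lambda>g. \<Psi> g + c - \<Phi> g)"
      by (rule conc) (use that in \<open>auto intro!: uniform_diff uniform_add uniform_const\<close>)
    then show ?thesis
      using mean_diff[OF x(1) uniform_add[OF that(2) uniform_const] that(1), of c]
        mean_add[OF x(1) that(2) uniform_const, of c] mean_const[OF x(1), of c] by simp
  qed
  \<comment> \<open>The infimum over majorants on \<open>P\<close> assigns a value without choosing
    an extension of \<open>f\<close>.\<close>
  define n where "n f = (INF \<Phi>\<in>{\<Phi> \<in> U. \<forall>p\<in>P. f p \<le> \<Phi> p}. x \<Phi>)" for f
  have close: "\<bar>n f - x \<Phi>\<bar> \<le> \<epsilon>"
    if \<Phi>: "\<Phi> \<in> U" "\<And>p. p \<in> P \<Longrightarrow> \<bar>\<Phi> p - f p\<bar> \<le> \<epsilon>" for f \<Phi> \<epsilon>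
  proof -
    define A where "A = {\<Phi> \<in> U. \<forall>p\<in>P. f p \<le> \<Phi> p}"
    have mem: "(\<lambda>g. \<Phi> g + \<epsilon>) \<in> A"
      using \<Phi>(2) by (force simp: A_def abs_le_iff intro: uniform_add[OF \<Phi>(1) uniform_const])
    have low: "x \<Phi> - \<epsilon> \<le> x \<Psi>" if "\<Psi> \<in> A" for \<Psi>
    proof -
      have "\<Psi> \<in> U" "\<And>p. p \<in> P \<Longrightarrow> f p \<le> \<Psi> p" using that by (auto simp: A_def)
      then have "x \<Phi> \<le> x \<Psi> + \<epsilon>"
        using \<Phi>(2) by (intro mono[OF \<Phi>(1)]) (auto simp: abs_le_iff, force)
      then show ?thesis by simp
    qed
    have "n f \<le> x (\<lambda>g. \<Phi> g + \<epsilon>)"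
      unfolding n_def A_def[symmetric] by (rule cINF_lower[OF _ mem]) (auto intro!: bdd_belowI low)
    also have "\<dots> = x \<Phi> + \<epsilon>"
      using mean_add[OF x(1) \<Phi>(1) uniform_const, of \<epsilon>] mean_const[OF x(1), of \<epsilon>] by simp
    finally have "n f \<le> x \<Phi> + \<epsilon>" .
    moreover have "x \<Phi> - \<epsilon> \<le> n f"
      unfolding n_def A_def[symmetric] by (rule cINF_greatest) (use mem low in auto)
    ultimately show ?thesis by linarith
  qed
  have ext: "\<exists>\<Phi>\<in>U. (\<forall>p\<in>P. \<bar>\<Phi> p - f p\<bar> \<le> \<epsilon>)" if "f \<in> P.U" "\<epsilon> > 0" for f \<epsilon>
    using uniform_extension[OF lc P that] by metis
  have "left_invariant_mean (G\<lparr>carrier := P\<rparr>) (subtopology T P) n"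
    unfolding left_invariant_mean_def
  proof (intro conjI ballI allI impI)
    fix f g assume fg: "f \<in> P.U" "g \<in> P.U"
    have "\<bar>n (\<lambda>x. f x + g x) - (n f + n g)\<bar> \<le> 4 * \<epsilon>" if \<epsilon>: "\<epsilon> > 0" for \<epsilon>
    proof -
      obtain \<Phi> \<Psi> where \<Phi>: "\<Phi> \<in> U" "\<And>p. p \<in> P \<Longrightarrow> \<bar>\<Phi> p - f p\<bar> \<le> \<epsilon>"
        and \<Psi>: "\<Psi> \<in> U" "\<And>p. p \<in> P \<Longrightarrow> \<bar>\<Psi> p - g p\<bar> \<le> \<epsilon>"
        using ext[OF fg(1) \<epsilon>] ext[OF fg(2) \<epsilon>] by metis
      have "\<bar>n (\<lambda>x. f x + g x) - x (\<lambda>h. \<Phi> h + \<Psi> h)\<bar> \<le> 2 * \<epsilon>"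
      proof (rule close[OF uniform_add[OF \<Phi>(1) \<Psi>(1)]])
        fix p assume "p \<in> P"
        from \<Phi>(2)[OF this] \<Psi>(2)[OF this] show "\<bar>\<Phi> p + \<Psi> p - (f p + g p)\<bar> \<le> 2 * \<epsilon>" by linarith
      qed
      then show ?thesis
        using close[OF \<Phi>] close[OF \<Psi>] mean_add[OF x(1) \<Phi>(1) \<Psi>(1)] by linarith
    qed
    then show "n (\<lambda>x. f x + g x) = n f + n g" by (rule eq_if_close)
  next
    fix f and c :: real assume f: "f \<in> P.U"
    have "\<bar>n (\<lambda>x. c * f x) - c * n f\<bar> \<le> (2 * \<bar>c\<bar>) * \<epsilon>" if \<epsilon>: "\<epsilon> > 0" for \<epsilon>
    proof -
      obtain \<Phi> where \<Phi>: "\<Phi> \<in> U" "\<And>p. p \<in> P \<Longrightarrow> \<bar>\<Phi> p - f p\<bar> \<le> \<epsilon>"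
        using ext[OF f \<epsilon>] by metis
      have "\<bar>n (\<lambda>x. c * f x) - x (\<lambda>h. c * \<Phi> h)\<bar> \<le> \<bar>c\<bar> * \<epsilon>"
      proof (rule close[OF uniform_cmult[OF \<Phi>(1)]])
        fix p assume "p \<in> P"
        then have "\<bar>c\<bar> * \<bar>\<Phi> p - f p\<bar> \<le> \<bar>c\<bar> * \<epsilon>" by (intro mult_left_mono \<Phi>(2)) auto
        then show "\<bar>c * \<Phi> p - c * f p\<bar> \<le> \<bar>c\<bar> * \<epsilon>"
          by (simp add: abs_mult[symmetric] right_diff_distrib)
      qed
      moreover have "\<bar>c * n f - c * x \<Phi>\<bar> \<le> \<bar>c\<bar> * \<epsilon>"
        using mult_left_mono[OF close[OF \<Phi>], of "\<bar>c\<bar>"] by (simp add: abs_mult[symmetric] right_diff_distrib)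
      ultimately show ?thesis
        unfolding mean_cmult[OF x(1) \<Phi>(1)] by linarith
    qed
    then show "n (\<lambda>x. c * f x) = c * n f" by (rule eq_if_close)
  next
    fix f assume f: "f \<in> P.U" "\<forall>p\<in>carrier (G\<lparr>carrier := P\<rparr>). 0 \<le> f p"
    have "0 \<le> n f + \<epsilon>" if \<epsilon>: "\<epsilon> > 0" for \<epsilon>
    proof -
      obtain \<Phi> where \<Phi>: "\<Phi> \<in> U" "\<And>p. p \<in> P \<Longrightarrow> \<bar>\<Phi> p - f p\<bar> \<le> \<epsilon>/2"
        using ext[OF f(1) half_gt_zero[OF \<epsilon>]] by metis
      have "x (\<lambda>g. 0) \<le> x \<Phi> + \<epsilon>/2"
      proof (rule mono[OF uniform_const \<Phi>(1)])
        fix p assume p: "p \<in> P"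
        then have "0 \<le> f p" using f(2) by simp
        then show "0 \<le> \<Phi> p + \<epsilon>/2" using \<Phi>(2)[OF p] by linarith
      qed
      then show ?thesis using close[OF \<Phi>] mean_const[OF x(1), of 0] by linarith
    qed
    then show "0 \<le> n f" by (meson field_le_epsilon)
  next
    have "\<bar>n (\<lambda>x. 1) - 1\<bar> \<le> 1 * \<epsilon>" if \<epsilon>: "\<epsilon> > 0" for \<epsilon>
    proof -
      have "\<bar>n (\<lambda>x. 1) - x (\<lambda>x. 1)\<bar> \<le> \<epsilon>"
        by (rule close[OF uniform_const]) (use \<epsilon> in simp)
      then show ?thesis by (simp only: mean_one[OF x(1)] mult_1)
    qed
    then show "n (\<lambda>x. 1) = 1" by (rule eq_if_close)
  next
    fix f q assume f: "f \<in> P.U" and "q \<in> carrier (G\<lparr>carrier := P\<rparr>)"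
    then have q: "q \<in> P" by simp
    have "\<bar>n (\<lambda>x. f (q \<otimes> x)) - n f\<bar> \<le> 2 * \<epsilon>" if \<epsilon>: "\<epsilon> > 0" for \<epsilon>
    proof -
      obtain \<Phi> where \<Phi>: "\<Phi> \<in> U" "\<And>p. p \<in> P \<Longrightarrow> \<bar>\<Phi> p - f p\<bar> \<le> \<epsilon>"
        using ext[OF f \<epsilon>] by metis
      have "\<bar>n (\<lambda>x. f (q \<otimes> x)) - x (\<lambda>h. \<Phi> (q \<otimes> h))\<bar> \<le> \<epsilon>"
        using subgroup.m_closed[OF P q] by (intro close uniform_shift \<Phi> PG[OF q])
      moreover have "x (\<lambda>h. \<Phi> (q \<otimes> h)) = x \<Phi>"
        using fun_cong[OF x(2)[OF q], of \<Phi>] \<Phi>(1) x(1) PG[OF q]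
        by (simp add: conv_point_mean orbit_fn_def)
      ultimately show ?thesis using close[OF \<Phi>] by linarith
    qed
    then have "n (\<lambda>x. f (q \<otimes> x)) = n f" by (rule eq_if_close)
    then show "n (\<lambda>x. f (q \<otimes>\<^bsub>G\<lparr>carrier := P\<rparr>\<^esub> x)) = n f" by simp
  qed
  then show ?thesis
    using P P.top_group by (auto simp: amenable_subgroup_def amenable_group_def)
qed

end

section \<open>The Haar mean acting on means of the whole group\<close>

context compact_subgroup
begin

text \<open>The image of the Haar integral under the inclusion of \<open>K\<close>, set to 0 outside
  \<open>U\<close> as membership in \<open>means\<close> demands.\<close>

definition haar_G :: "('a \<Rightarrow> real) \<Rightarrow> real" where
  "haar_G f = (if f \<in> U then m f else 0)"

lemma uniform_K: "f \<in> U \<Longrightarrow> f \<in> K.U"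
  by (rule K_uniform_restrict[OF uniform_continuous])

lemma haar_G_means: "haar_G \<in> means"
  unfolding means_def mem_Collect_eq
proof (intro conjI ballI allI impI)
  fix f g assume "f \<in> U" "g \<in> U"
  then show "haar_G (\<lambda>x. f x + g x) = haar_G f + haar_G g"
    using K.mean_add[OF haar_mean uniform_K uniform_K] by (simp add: haar_G_def uniform_add)
next
  fix f and c :: real assume "f \<in> U"
  then show "haar_G (\<lambda>x. c * f x) = c * haar_G f"
    using K.mean_cmult[OF haar_mean uniform_K] by (simp add: haar_G_def uniform_cmult)
next
  fix f assume f: "f \<in> U" "\<forall>x\<in>carrier G. 0 \<le> f x"
  have "0 \<le> m f" by (rule K.mean_nonneg[OF haar_mean uniform_K[OF f(1)]]) (use f(2) K_sub in auto)
  then show "0 \<le> haar_G f" by (simp add: haar_G_def)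
qed (simp_all add: haar_G_def uniform_const K.mean_one[OF haar_mean])

lemma conv_haar: "y \<in> means \<Longrightarrow> f \<in> U \<Longrightarrow> conv haar_G y f = m (orbit_fn y f)"
  by (simp add: conv_def haar_G_def orbit_fn_uniform)

lemma orbit_fn_conv_haar:
  "y \<in> means \<Longrightarrow> f \<in> U \<Longrightarrow> g \<in> carrier G \<Longrightarrow> orbit_fn (conv haar_G y) f g = m (\<lambda>k. orbit_fn y f (g \<otimes> k))"
  by (simp add: orbit_fn_conv haar_G_means) (simp add: haar_G_def uniform_shift orbit_fn_uniform)

lemma conv_haar_fixed:
  assumes "k \<in> K" "y \<in> means"
  shows "conv (point_mean k) (conv haar_G y) = conv haar_G y"
proof (rule mean_eqI)
  fix f assume f: "f \<in> U"
  have "conv (point_mean k) (conv haar_G y) f = m (\<lambda>j. orbit_fn y f (k \<otimes> j))"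
    using assms f K_sub by (simp add: conv_point_mean conv_means haar_G_means orbit_fn_conv_haar)
  also have "\<dots> = m (orbit_fn y f)"
    by (rule haar_left[OF assms(1) uniform_K[OF orbit_fn_uniform[OF assms(2) f]]])
  finally show "conv (point_mean k) (conv haar_G y) f = conv haar_G y f"
    using assms f by (simp add: conv_haar)
qed (use assms K_sub in \<open>auto intro!: conv_means haar_G_means point_mean\<close>)

text \<open>Continuity in the right factor rests on the compactness of \<open>K\<close>: finitely
  many sets \<open>W i\<close> cover \<open>K\<close>, and on each of them orbit functions vary
  little, uniformly in the mean. Control of \<open>y\<close> at the finitely many translates
  \<open>f (i x)\<close> therefore suffices.\<close>

lemma continuous_on_conv_haar:
  assumes S: "S \<subseteq> means"
  shows "continuous_on S (conv haar_G)"
proof (rule continuous_on_coordinatewise_then_product)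
  fix f show "continuous_on S (\<lambda>y. conv haar_G y f)"
  proof (cases "f \<in> U")
    case f: True
    show ?thesis
    proof (rule continuous_on_functions_realI)
      fix y0 and \<epsilon> :: real assume y0: "y0 \<in> S" and \<epsilon>: "\<epsilon> > 0"
      have y0m: "y0 \<in> means" using y0 S by blast
      have "\<epsilon>/4 > 0" using \<epsilon> by simp
      then obtain V where V: "openin T V" "\<one> \<in> V"
        "\<And>v x. v \<in> V \<Longrightarrow> x \<in> carrier G \<Longrightarrow> \<bar>f (v \<otimes> x) - f x\<bar> < \<epsilon>/4"
        using uniformD[OF f] by metis
      define W where "W i = {y \<in> carrier G. y \<otimes> inv i \<in> V}" for i
      have opW: "openin T (W i)" if "i \<in> K" for i
        unfolding W_def by (rule openin_right_translate[OF V(1)]) (use K_sub[OF that] in simp)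
      have "K \<subseteq> \<Union>(W ` K)" using K_sub V(2) by (auto simp: W_def)
      then obtain \<F> where F: "finite \<F>" "\<F> \<subseteq> W ` K" "K \<subseteq> \<Union>\<F>"
        using compactinD[OF K_compact, of "W ` K"] opW by blast
      obtain I where I: "finite I" "I \<subseteq> K" "\<F> = W ` I"
        using finite_subset_image[OF F(1,2)] by blast
      have "\<bar>conv haar_G y f - conv haar_G y0 f\<bar> < \<epsilon>"
        if y: "y \<in> S" and yI: "\<forall>\<phi>\<in>(\<lambda>i x. f (i \<otimes> x)) ` I. \<bar>y \<phi> - y0 \<phi>\<bar> < \<epsilon>/4" for y
      proof -
        have ym: "y \<in> means" using y S by blast
        \<comment> \<open>One quarter of \<open>\<epsilon>\<close> is spent on each of the passages
          from \<open>k\<close> to \<open>i\<close>, from \<open>y\<close> to \<open>y0\<close>, and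
          from \<open>i\<close> back to \<open>k\<close>.\<close>
        have "\<bar>m (orbit_fn y f) - m (orbit_fn y0 f)\<bar> \<le> 3 * \<epsilon> / 4"
        proof (rule K.mean_dist[OF haar_mean])
          show "orbit_fn y f \<in> K.U" "orbit_fn y0 f \<in> K.U"
            using ym y0m f by (auto intro: uniform_K orbit_fn_uniform)
          fix k assume "k \<in> carrier (G\<lparr>carrier := K\<rparr>)"
          then have k: "k \<in> K" by simp
          then obtain i where i: "i \<in> I" "k \<in> W i" using F(3) unfolding I(3) by blast
          have iG: "i \<in> carrier G" using i I(2) K_sub by blast
          define v where "v = k \<otimes> inv i"
          have v: "v \<in> V" "v \<in> carrier G" "k = v \<otimes> i"
            using i(2) iG K_sub[OF k] by (auto simp: W_def v_def m_assoc)
          have near: "\<bar>f (v \<otimes> x) - f x\<bar> \<le> \<epsilon>/4" if "x \<in> carrier G" for x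
            using V(3)[OF v(1) that] by simp
          have "\<bar>orbit_fn y f k - orbit_fn y f i\<bar> \<le> \<epsilon>/4" "\<bar>orbit_fn y0 f k - orbit_fn y0 f i\<bar> \<le> \<epsilon>/4"
            unfolding v(3) using orbit_fn_dist[OF ym f v(2) iG near] orbit_fn_dist[OF y0m f v(2) iG near] by auto
          moreover have "\<bar>orbit_fn y f i - orbit_fn y0 f i\<bar> < \<epsilon>/4"
            using yI i(1) by (auto simp: orbit_fn_def)
          ultimately show "\<bar>orbit_fn y f k - orbit_fn y0 f k\<bar> \<le> 3 * \<epsilon> / 4" by linarith
        qed
        then show ?thesis using f ym y0m \<epsilon> by (simp add: conv_haar)
      qed
      then show "\<exists>J \<delta>. finite J \<and> \<delta> > 0 \<and>
          (\<forall>y\<in>S. (\<forall>\<phi>\<in>J. \<bar>y \<phi> - y0 \<phi>\<bar> < \<delta>) \<longrightarrow> \<bar>conv haar_G y f - conv haar_G y0 f\<bar> < \<epsilon>)"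
        using I(1) \<epsilon> by (intro exI[of _ "(\<lambda>i x. f (i \<otimes> x)) ` I"] exI[of _ "\<epsilon>/4"]) auto
    qed
  qed (simp add: conv_def)
qed

text \<open>The operators \<open>y \<mapsto> haar_G * g * y\<close> commute on \<open>K\<close>-fixed means because \<open>(G, K)\<close> is a Gelfand
  pair; the means that all of them send to a common fixed point form an invariant convex set.\<close>
theorem gelfand_haar_constant:
  assumes lc: "locally_compact_space T" "Hausdorff_space T" and gp: "gelfand_pair G T K"
    and V: "irreducible_space V"
  obtains e where "\<And>y. y \<in> V \<Longrightarrow> conv haar_G y = e"
proof -
  have V': "convex_space V" using V by (rule irreducible_imp_convex_space)
  have Vm: "V \<subseteq> means" and Vc: "compact V" "V \<noteq> {}" "convex_family V"
    using V' by (auto simp: convex_space_def)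
  define t where "t g y = conv haar_G (conv (point_mean g) y)" for g y
  \<comment> \<open>The means in \<open>W\<close> are fixed by \<open>K\<close>, so their orbit
    functions are right \<open>K\<close>-invariant, as \<open>gelfand_mean_commute\<close> requires.
    For this reason the fixed point is sought in \<open>W\<close> and not directly in
    \<open>V\<close>.\<close>
  define W where "W = conv haar_G ` V"
  have WV: "W \<subseteq> V" unfolding W_def using conv_in_convex_space[OF V' _ haar_G_means] by blast
  have Wm: "W \<subseteq> means" using WV Vm by blast
  have tcont: "continuous_on V (t g)" if g: "g \<in> carrier G" for g
    unfolding t_def
  proof (rule continuous_on_compose2[OF continuous_on_conv_haar])
    show "continuous_on V (conv (point_mean g))" by (rule continuous_on_conv_point[OF g Vm])
    show "conv (point_mean g) ` V \<subseteq> means" using Vm g by (auto intro: conv_means point_mean)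
  qed simp
  have tmix: "t g (mix c p q) = mix c (t g p) (t g q)" if "g \<in> carrier G" "p \<in> V" "q \<in> V" for g p q c
  proof -
    have "p \<in> means" "q \<in> means" using that Vm by auto
    then show ?thesis
      using that(1) unfolding t_def
      by (simp add: conv_mix_right point_mean haar_G_means conv_means)
  qed
  have tV: "t g y \<in> W" if "g \<in> carrier G" "y \<in> V" for g y
    unfolding t_def W_def using conv_in_convex_space[OF V' that(2) point_mean[OF that(1)]] by blast
  have tm: "t g y \<in> means" if "g \<in> carrier G" "y \<in> V" for g y
    using tV[OF that] Wm by blast
  have tt: "t g (t h y) f = m (\<lambda>k. m (\<lambda>k'. orbit_fn y f (k \<otimes> g \<otimes> k' \<otimes> h)))"
    if "g \<in> carrier G" "h \<in> carrier G" "y \<in> V" "f \<in> U" for g h y f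
  proof -
    have ym: "y \<in> means" using that Vm by blast
    have thy_m: "t h y \<in> means" by (rule tm[OF that(2,3)])
    have "t g (t h y) f = m (orbit_fn (conv (point_mean g) (t h y)) f)"
      unfolding t_def[of g] by (rule conv_haar[OF conv_means[OF point_mean[OF that(1)] thy_m] that(4)])
    also have "\<dots> = m (\<lambda>k. m (\<lambda>k'. orbit_fn y f (k \<otimes> g \<otimes> k' \<otimes> h)))"
    proof (rule haar_cong)
      fix k assume k: "k \<in> K"
      have "orbit_fn (conv (point_mean g) (t h y)) f k = orbit_fn (t h y) f (k \<otimes> g)"
        by (rule orbit_fn_conv_point[OF thy_m that(4) K_sub[OF k] that(1)])
      also have "\<dots> = m (\<lambda>k'. orbit_fn (conv (point_mean h) y) f (k \<otimes> g \<otimes> k'))"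
        unfolding t_def using that k K_sub ym
        by (intro orbit_fn_conv_haar conv_means point_mean) auto
      also have "\<dots> = m (\<lambda>k'. orbit_fn y f (k \<otimes> g \<otimes> k' \<otimes> h))"
        using that k K_sub ym by (intro haar_cong orbit_fn_conv_point) auto
      finally show "orbit_fn (conv (point_mean g) (t h y)) f k = m (\<lambda>k'. orbit_fn y f (k \<otimes> g \<otimes> k' \<otimes> h))" .
    qed
    finally show ?thesis .
  qed
  obtain e where e: "e \<in> W" "\<And>g. g \<in> carrier G \<Longrightarrow> t g e = e"
  proof (rule markov_kakutani[of W "carrier G" t])
    show "compact W" "W \<noteq> {}"
      unfolding W_def using Vc continuous_on_conv_haar[OF Vm] by (auto intro: compact_continuous_image)
    have "affine_map_on V (conv haar_G)"
      unfolding affine_map_on_def using Vm by (auto intro!: conv_mix_right haar_G_means)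
    then show "convex_family W" unfolding W_def by (rule convex_family_image[OF Vc(3)])
    fix g assume g: "g \<in> carrier G"
    show "continuous_on W (t g)" by (rule continuous_on_subset[OF tcont[OF g] WV])
    show "affine_map_on W (t g)"
      unfolding affine_map_on_def by (intro ballI allI tmix[OF g] subsetD[OF WV])
    show "t g y \<in> W" if "y \<in> W" for y by (rule tV[OF g subsetD[OF WV that]])
    fix h y assume h: "h \<in> carrier G" and y: "y \<in> W"
    have yV: "y \<in> V" and ym: "y \<in> means" using y WV Vm by auto
    have fixed: "conv (point_mean k) y = y" if "k \<in> K" for k
      using y conv_haar_fixed[OF that] Vm unfolding W_def by blast
    show "t g (t h y) = t h (t g y)"
    proof (rule mean_eqI)
      show "t g (t h y) \<in> means" by (rule tm[OF g subsetD[OF WV tV[OF h yV]]])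
      show "t h (t g y) \<in> means" by (rule tm[OF h subsetD[OF WV tV[OF g yV]]])
      fix f assume f: "f \<in> U"
      have "m (\<lambda>k. m (\<lambda>k'. orbit_fn y f (k \<otimes> g \<otimes> k' \<otimes> h))) = m (\<lambda>k. m (\<lambda>k'. orbit_fn y f (k \<otimes> h \<otimes> k' \<otimes> g)))"
      proof (rule gelfand_mean_commute[OF lc gp _ _ g h])
        show "continuous_map T euclideanreal (orbit_fn y f)"
          by (rule uniform_continuous[OF orbit_fn_uniform[OF ym f]])
        show "orbit_fn y f (z \<otimes> k) = orbit_fn y f z" if "z \<in> carrier G" "k \<in> K" for z k
          using orbit_fn_conv_point[OF ym f that(1) K_sub[OF that(2)]] fixed[OF that(2)] by simp
      qed
      then show "t g (t h y) f = t h (t g y) f"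
        by (simp only: tt[OF g h yV f] tt[OF h g yV f])
    qed
  qed auto
  \<comment> \<open>\<open>N\<close> contains the fixed point \<open>e\<close>; once irreducibility
    makes it all of \<open>V\<close>, the restriction to \<open>K\<close>-fixed means is
    removed.\<close>
  define N where "N = {y \<in> V. \<forall>g\<in>carrier G. t g y = e}"
  have "convex_space N"
    unfolding convex_space_def
  proof (intro conjI)
    have "closed {y \<in> V. t g y f = e f}" if "g \<in> carrier G" for g f
      by (rule continuous_closed_preimage_constant[OF continuous_on_product_then_coordinatewise[OF tcont[OF that]]
            compact_functions_imp_closed[OF Vc(1)]])
    then have "closed (\<Inter>g\<in>carrier G. \<Inter>f. {y \<in> V. t g y f = e f})"
      by (intro closed_INT ballI) auto
    then have "compact (V \<inter> (\<Inter>g\<in>carrier G. \<Inter>f. {y \<in> V. t g y f = e f}))"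
      by (rule compact_Int_closed[OF Vc(1)])
    moreover have "V \<inter> (\<Inter>g\<in>carrier G. \<Inter>f. {y \<in> V. t g y f = e f}) = N"
      by (auto simp: N_def fun_eq_iff)
    ultimately show "compact N" by simp
    show "N \<noteq> {}" using e WV by (auto simp: N_def)
    show "N \<subseteq> means" using Vm by (auto simp: N_def)
    have "mix c e e = e" for c by (simp add: mix_def fun_eq_iff algebra_simps)
    then show "convex_family N"
      unfolding convex_family_def N_def using tmix convex_familyD[OF Vc(3)] by auto
    show "invariant N"
      unfolding invariant_def
    proof (intro ballI)
      fix h y assume h: "h \<in> carrier G" and y: "y \<in> N"
      then have yV: "y \<in> V" and ym: "y \<in> means" using Vm by (auto simp: N_def)
      \<comment> \<open>Translating \<open>y\<close> by \<open>h\<close> replaces the index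
        \<open>g\<close> by \<open>g \<otimes> h\<close>; the set \<open>N\<close> is invariant
        because its definition ranges over all indices.\<close>
      have "t g (conv (point_mean h) y) = t (g \<otimes> h) y" if "g \<in> carrier G" for g
        unfolding t_def using conv_point_mean_mult[OF that h ym] by simp
      moreover have "t (g \<otimes> h) y = e" if "g \<in> carrier G" for g
        using y that h by (simp add: N_def)
      ultimately show "conv (point_mean h) y \<in> N"
        using conv_in_convex_space[OF V' yV point_mean[OF h]] by (simp add: N_def)
    qed
  qed
  moreover have "N \<subseteq> V" by (auto simp: N_def)
  ultimately have "N = V" using V by (auto simp: irreducible_space_def)
  have "conv haar_G y = e" if "y \<in> V" for y
  proof -
    have "t \<one> y = e" using that \<open>N = V\<close> one_closed by (auto simp: N_def)
    then show ?thesis using that Vm unfolding t_def by (auto simp: conv_point_mean_one)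
  qed
  then show thesis by (rule that)
qed

text \<open>Both main points test a mean against a function built from finitely many orbit functions
  of \<open>x\<close>: a bump at \<open>h\<close> that vanishes on \<open>K\<close> yields
  \<open>G = K P\<close>, and a function of \<open>x\<close>-mean 0 that stays away from 0 outside a
  neighbourhood of \<open>P\<close> yields positivity of \<open>x\<close> on functions that are
  nonnegative on \<open>P\<close>.\<close>

theorem gelfand_decomposition:
  assumes lc: "locally_compact_space T" "Hausdorff_space T" and gp: "gelfand_pair G T K"
  shows "\<exists>P. cocompact_subgroup G T P \<and> amenable_subgroup G T P \<and> carrier G = K <#> P"
proof -
  obtain V where V: "irreducible_space V" using irreducible_exists by blast
  have V': "convex_space V" using V by (rule irreducible_imp_convex_space)
  have Vm: "V \<subseteq> means" using V' by (simp add: convex_space_def)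
  obtain e where e: "\<And>y. y \<in> V \<Longrightarrow> conv haar_G y = e"
    using gelfand_haar_constant[OF lc gp V] by metis
  obtain x where x: "extreme_in V x"
    using extreme_exists[of V] V' by (auto simp: convex_space_def)
  have xV: "x \<in> V" using x by (simp add: extreme_in_def)
  have xm: "x \<in> means" using xV Vm by blast
  have conc: "x (\<lambda>g. \<bar>orbit_fn x f g - x f\<bar>) = 0" if "f \<in> U" for f
    by (rule extreme_concentrated[OF Vm conv_in_convex_space[OF V' xV] xm x xm extreme_idempotent[OF V x] that])
  have aU: "orbit_fn x f \<in> U" if "f \<in> U" for f by (rule orbit_fn_uniform[OF xm that])
  have devU: "(\<lambda>g. \<bar>orbit_fn x f g - c\<bar>) \<in> U" if "f \<in> U" for f c
    by (intro uniform_abs uniform_diff uniform_const aU that)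
  have conc_sum: "x (\<lambda>g. \<Sum>f\<in>J. \<bar>orbit_fn x f g - x f\<bar>) = 0" if "finite J" "J \<subseteq> U" for J
  proof -
    have "x (\<lambda>g. \<Sum>f\<in>J. \<bar>orbit_fn x f g - x f\<bar>) = (\<Sum>f\<in>J. x (\<lambda>g. \<bar>orbit_fn x f g - x f\<bar>))"
      by (rule mean_sum[OF xm that(1)]) (use devU that(2) in blast)
    also have "\<dots> = 0" using conc that(2) by (intro sum.neutral) auto
    finally show ?thesis .
  qed
  \<comment> \<open>If \<open>h x\<close> lay outside \<open>K x\<close>, the bump
    \<open>\<Psi>\<close> would have Haar average 0 along \<open>K x\<close> and a positive one
    along \<open>K h x\<close>, although both averages are its value under the same mean
    \<open>e\<close>.\<close>
  have orbit: "\<exists>k\<in>K. conv (point_mean h) x = conv (point_mean k) x" if h: "h \<in> carrier G" for h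
  proof (rule ccontr)
    assume none: "\<not> ?thesis"
    have sep: "\<exists>f\<in>U. 0 < \<bar>orbit_fn x f k - orbit_fn x f h\<bar>" if k: "k \<in> K" for k
    proof (rule ccontr)
      assume "\<not> ?thesis"
      then have "orbit_fn x f k = orbit_fn x f h" if "f \<in> U" for f using that by auto
      then have "conv (point_mean h) x = conv (point_mean k) x"
        using h K_sub[OF k] xm by (intro mean_eqI) (auto simp: conv_point_mean intro: conv_means point_mean)
      then show False using none k by blast
    qed
    obtain J \<delta> where J: "finite J" "J \<subseteq> U" "\<delta> > 0"
      "\<And>k. k \<in> K \<Longrightarrow> \<delta> \<le> (\<Sum>f\<in>J. \<bar>orbit_fn x f k - orbit_fn x f h\<bar>)"
    proof (rule finite_separation[of T K U "\<lambda>f k. \<bar>orbit_fn x f k - orbit_fn x f h\<bar>"])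
      show "continuous_map T euclideanreal (\<lambda>k. \<bar>orbit_fn x f k - orbit_fn x f h\<bar>)" if "f \<in> U" for f
        by (rule uniform_continuous[OF devU[OF that]])
      show "\<exists>f\<in>U. 0 < \<bar>orbit_fn x f k - orbit_fn x f h\<bar>" if "k \<in> K" for k by (rule sep[OF that])
    qed (use K_compact in simp_all)
    \<comment> \<open>A bump at \<open>h\<close> for the pseudometric given by the orbit functions
      of \<open>J\<close>: by the choice of \<open>\<delta>\<close> it vanishes on \<open>K\<close>,
      and its value at \<open>h\<close> is \<open>\<delta>\<close>.\<close>
    define \<Psi> where "\<Psi> g = max 0 (\<delta> - (\<Sum>f\<in>J. \<bar>orbit_fn x f g - orbit_fn x f h\<bar>))" for g
    have dist: "\<bar>\<Psi> a - \<Psi> b\<bar> \<le> (\<Sum>f\<in>J. \<bar>orbit_fn x f a - orbit_fn x f b\<bar>)" for a b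
    proof -
      have "\<bar>(\<Sum>f\<in>J. \<bar>orbit_fn x f a - orbit_fn x f h\<bar>) - (\<Sum>f\<in>J. \<bar>orbit_fn x f b - orbit_fn x f h\<bar>)\<bar>
          \<le> (\<Sum>f\<in>J. \<bar>orbit_fn x f a - orbit_fn x f b\<bar>)"
        unfolding sum_subtractf[symmetric]
        by (rule order_trans[OF sum_abs]) (rule sum_mono, linarith)
      moreover have "\<bar>max 0 (\<delta> - u) - max 0 (\<delta> - v)\<bar> \<le> \<bar>u - v\<bar>" for u v by linarith
      ultimately show ?thesis unfolding \<Psi>_def by (rule order_trans[rotated])
    qed
    have \<Psi>U: "\<Psi> \<in> U"
    proof (rule uniform_dominated[where f = \<Psi> and C = 1, OF J(1)])
      show "orbit_fn x f \<in> U" if "f \<in> J" for f using aU J(2) that by blast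
      show "\<bar>\<Psi> a - \<Psi> b\<bar> \<le> 1 * (\<Sum>f\<in>J. \<bar>orbit_fn x f a - orbit_fn x f b\<bar>)" for a b
        using dist by simp
    qed
    \<comment> \<open>Since \<open>x\<close> is concentrated where its orbit functions take their
      value at \<open>\<one>\<close>, averaging \<open>\<Psi> (a \<otimes> g)\<close> over
      \<open>g\<close> returns \<open>\<Psi> a\<close>. Concentration is applied to the translated
      functions \<open>f (a \<otimes> y)\<close>.\<close>
    have \<Psi>_orbit: "orbit_fn x \<Psi> a = \<Psi> a" if a: "a \<in> carrier G" for a
    proof -
      have sumU: "(\<lambda>g. \<Sum>f\<in>J. \<bar>orbit_fn x (\<lambda>y. f (a \<otimes> y)) g - x (\<lambda>y. f (a \<otimes> y))\<bar>) \<in> U"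
        by (rule uniform_sum[OF J(1)]) (use devU J(2) uniform_shift a in blast)
      have "\<bar>x (\<lambda>g. \<Psi> (a \<otimes> g)) - \<Psi> a\<bar> \<le>
          x (\<lambda>g. \<Sum>f\<in>J. \<bar>orbit_fn x (\<lambda>y. f (a \<otimes> y)) g - x (\<lambda>y. f (a \<otimes> y))\<bar>)"
      proof (rule mean_deviation[OF xm uniform_shift[OF \<Psi>U a] sumU])
        fix g assume g: "g \<in> carrier G"
        have "(\<Sum>f\<in>J. \<bar>orbit_fn x (\<lambda>y. f (a \<otimes> y)) g - x (\<lambda>y. f (a \<otimes> y))\<bar>) =
            (\<Sum>f\<in>J. \<bar>orbit_fn x f (a \<otimes> g) - orbit_fn x f a\<bar>)"
          using xm a g by (intro sum.cong) (auto simp: orbit_fn_shift orbit_fn_def[of x _ a])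
        then show "\<bar>\<Psi> (a \<otimes> g) - \<Psi> a\<bar> \<le> (\<Sum>f\<in>J. \<bar>orbit_fn x (\<lambda>y. f (a \<otimes> y)) g - x (\<lambda>y. f (a \<otimes> y))\<bar>)"
          using dist[of "a \<otimes> g" a] by simp
      qed
      also have "\<dots> = (\<Sum>f\<in>J. x (\<lambda>g. \<bar>orbit_fn x (\<lambda>y. f (a \<otimes> y)) g - x (\<lambda>y. f (a \<otimes> y))\<bar>))"
        by (rule mean_sum[OF xm J(1)]) (use devU J(2) uniform_shift a in blast)
      also have "\<dots> = 0"
        using J(2) a by (intro sum.neutral ballI conc uniform_shift) auto
      finally show ?thesis by (simp add: orbit_fn_def)
    qed
    have hx: "conv (point_mean h) x \<in> V" by (rule conv_in_convex_space[OF V' xV point_mean[OF h]])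
    have "conv haar_G x \<Psi> = m (\<lambda>k. 0)"
      unfolding conv_haar[OF xm \<Psi>U]
    proof (rule haar_cong)
      fix k assume k: "k \<in> K"
      have "\<Psi> k = 0" using J(4)[OF k] by (simp add: \<Psi>_def)
      then show "orbit_fn x \<Psi> k = 0" using \<Psi>_orbit[OF K_sub[OF k]] by simp
    qed
    also have "\<dots> = 0" by (rule K.mean_const[OF haar_mean])
    finally have 0: "conv haar_G x \<Psi> = 0" .
    have "conv haar_G (conv (point_mean h) x) \<Psi> = m (\<lambda>k. \<Psi> (k \<otimes> h))"
      unfolding conv_haar[OF subsetD[OF Vm hx] \<Psi>U]
    proof (rule haar_cong)
      fix k assume k: "k \<in> K"
      have "orbit_fn (conv (point_mean h) x) \<Psi> k = orbit_fn x \<Psi> (k \<otimes> h)"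
        by (rule orbit_fn_conv_point[OF xm \<Psi>U K_sub[OF k] h])
      then show "orbit_fn (conv (point_mean h) x) \<Psi> k = \<Psi> (k \<otimes> h)"
        using \<Psi>_orbit K_sub[OF k] h by simp
    qed
    moreover have "0 < m (\<lambda>k. \<Psi> (k \<otimes> h))"
    proof (rule haar_positive)
      show "(\<lambda>k. \<Psi> (k \<otimes> h)) \<in> K.U"
        using h by (intro K_uniform continuous_map_compose'[OF _ uniform_continuous[OF \<Psi>U]]
            continuous_mult_compose incl_K continuous_const_compose)
      show "0 \<le> \<Psi> (k \<otimes> h)" for k by (simp add: \<Psi>_def)
      show "0 < \<Psi> (\<one> \<otimes> h)" using J(3) h by (simp add: \<Psi>_def)
    qed
    ultimately show False using 0 e[OF xV] e[OF hx] by simp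
  qed
  define P where "P = stabilizer x"
  have P: "subgroup P G" unfolding P_def by (rule stabilizer_subgroup[OF xm])
  have PG: "p \<in> carrier G" if "p \<in> P" for p using subgroup.mem_carrier[OF P that] .
  have decomp: "\<exists>k\<in>K. \<exists>p\<in>P. g = k \<otimes> p" if g: "g \<in> carrier G" for g
  proof -
    obtain k where k: "k \<in> K" "conv (point_mean g) x = conv (point_mean k) x"
      using orbit[OF g] by blast
    have kG: "k \<in> carrier G" by (rule K_sub[OF k(1)])
    have "conv (point_mean (inv k \<otimes> g)) x = conv (point_mean (inv k)) (conv (point_mean k) x)"
      using conv_point_mean_mult[OF inv_closed[OF kG] g xm] unfolding k(2) by (rule sym)
    also have "\<dots> = x"
      unfolding conv_point_mean_mult[OF inv_closed[OF kG] kG xm] l_inv[OF kG] by (rule conv_point_mean_one[OF xm])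
    finally have "inv k \<otimes> g \<in> P" using kG g by (simp add: P_def stabilizer_def)
    moreover have "g = k \<otimes> (inv k \<otimes> g)" using kG g by (simp add: m_assoc[symmetric])
    ultimately show ?thesis using k(1) by blast
  qed
  have orbit_mult: "orbit_fn x f (g \<otimes> p) = orbit_fn x f g" if "f \<in> U" "g \<in> carrier G" "p \<in> P" for f g p
    using orbit_fn_conv_point[OF xm that(1,2) PG[OF that(3)]] that(3) by (simp add: P_def stabilizer_def)
  have "carrier G = K <#> P"
    using decomp K_sub PG by (auto simp: set_mult_def)
  moreover have "cocompact_subgroup G T P"
  proof -
    \<comment> \<open>By \<open>G = K P\<close> every coset has a representative in
      \<open>K\<close>, so the coset space is a continuous image of the compact set
      \<open>K\<close>.\<close>
    have "g <# P \<in> (\<lambda>g. g <# P) ` K" if g: "g \<in> carrier G" for g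
    proof -
      obtain k p where kp: "k \<in> K" "p \<in> P" "g = k \<otimes> p" using decomp[OF g] by blast
      have "g <# P = k <# (p <# P)"
        unfolding kp(3) by (rule lcos_m_assoc[symmetric])
          (use kp K_sub PG subgroup.subset[OF P] in auto)
      also have "p <# P = P" by (rule coset_join3[OF PG[OF kp(2)] P kp(2)])
      finally show ?thesis using kp(1) by blast
    qed
    then have "topspace (coset_space G T P) = (\<lambda>g. g <# P) ` K"
      using K_sub by (auto simp: coset_space_def topspace_quotient_topology topspace_carrier)
    moreover have "compactin (coset_space G T P) ((\<lambda>g. g <# P) ` K)"
      unfolding coset_space_def
      by (rule image_compactin[OF K_compact quotient_imp_continuous_map[OF quotient_map_quotient_topology]])
    ultimately have "compact_space (coset_space G T P)" by (simp only: compact_space_def)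
    with P show ?thesis unfolding cocompact_subgroup_def by (rule conjI)
  qed
  moreover have "amenable_subgroup G T P"
  proof (rule amenable_subgroupI[OF lc P xm])
    show "conv (point_mean p) x = x" if "p \<in> P" for p using that by (simp add: P_def stabilizer_def)
    fix \<Phi> assume \<Phi>: "\<Phi> \<in> U" "\<And>p. p \<in> P \<Longrightarrow> 0 \<le> \<Phi> p"
    obtain B where B: "B > 0" "\<And>g. g \<in> carrier G \<Longrightarrow> \<bar>\<Phi> g\<bar> \<le> B"
      using uniform_bounded[OF \<Phi>(1)] by metis
    have "0 \<le> x \<Phi> + \<epsilon>" if \<epsilon>: "\<epsilon> > 0" for \<epsilon>
    proof -
      have "\<exists>V. openin T V \<and> \<one> \<in> V \<and> (\<forall>v\<in>V. \<forall>g\<in>carrier G. \<bar>\<Phi> (v \<otimes> g) - \<Phi> g\<bar> < \<epsilon>)"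
        using \<Phi>(1) \<epsilon> by (simp add: uniform_functions_def)
      then obtain V0 where V0: "openin T V0" "\<one> \<in> V0"
        "\<forall>v\<in>V0. \<forall>g\<in>carrier G. \<bar>\<Phi> (v \<otimes> g) - \<Phi> g\<bar> < \<epsilon>"
        by (elim exE conjE)
      \<comment> \<open>\<open>W\<close> is the neighbourhood \<open>V0 P\<close> of
        \<open>P\<close>. On it \<open>\<Phi>\<close> exceeds \<open>- \<epsilon>\<close>, and it is
        stable under right multiplication by \<open>P\<close>, so that for \<open>g = k p\<close>
        membership in \<open>W\<close> can be tested on \<open>k\<close>.\<close>
      define W where "W = (\<Union>p\<in>P. {g \<in> carrier G. g \<otimes> inv p \<in> V0})"
      have W: "openin T W"
        unfolding W_def using PG by (intro openin_Union) (auto intro!: openin_right_translate V0(1))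
      have comp: "compactin T (K \<inter> (topspace T - W))"
        using compact_Int_closedin[OF K_compact, of "topspace T - W"] W by blast
      have sep: "\<exists>f\<in>U. 0 < \<bar>orbit_fn x f k - x f\<bar>" if k: "k \<in> K \<inter> (topspace T - W)" for k
      proof (rule ccontr)
        assume "\<not> ?thesis"
        then have eq: "orbit_fn x f k = x f" if "f \<in> U" for f using that by auto
        have kG: "k \<in> carrier G" using k K_sub by blast
        have "conv (point_mean k) x = x"
          by (rule mean_eqI) (use eq kG xm in \<open>auto simp: conv_point_mean intro: conv_means point_mean\<close>)
        then have "k \<in> P" using kG by (simp add: P_def stabilizer_def)
        then have "k \<in> W" using kG V0(2) by (auto simp: W_def intro!: bexI[of _ k])
        then show False using k by blast
      qed
      obtain J \<delta> where J: "finite J" "J \<subseteq> U" "\<delta> > 0"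
        "\<And>k. k \<in> K \<inter> (topspace T - W) \<Longrightarrow> \<delta> \<le> (\<Sum>f\<in>J. \<bar>orbit_fn x f k - x f\<bar>)"
      proof (rule finite_separation[of T "K \<inter> (topspace T - W)" U "\<lambda>f k. \<bar>orbit_fn x f k - x f\<bar>"])
        show "continuous_map T euclideanreal (\<lambda>k. \<bar>orbit_fn x f k - x f\<bar>)" if "f \<in> U" for f
          by (rule uniform_continuous[OF devU[OF that]])
        show "\<exists>f\<in>U. 0 < \<bar>orbit_fn x f k - x f\<bar>" if "k \<in> K \<inter> (topspace T - W)" for k
          by (rule sep[OF that])
      qed (use comp in simp_all)
      \<comment> \<open>\<open>D\<close> is right invariant under \<open>P\<close>, is at least
        \<open>\<delta>\<close> outside \<open>W\<close>, and has \<open>x\<close>-mean 0. Adding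
        \<open>(B / \<delta>) * D\<close> thus compensates the lower bound \<open>- B\<close> of
        \<open>\<Phi>\<close> outside \<open>W\<close> without changing the mean.\<close>
      define D where "D g = (\<Sum>f\<in>J. \<bar>orbit_fn x f g - x f\<bar>)" for g
      have DU: "D \<in> U"
        unfolding D_def by (rule uniform_sum[OF J(1)]) (use devU J(2) in blast)
      have D0: "0 \<le> D g" for g by (simp add: D_def sum_nonneg)
      have "0 \<le> x (\<lambda>g. \<Phi> g + (\<epsilon> + (B / \<delta>) * D g))"
      proof (rule mean_nonneg[OF xm])
        show "(\<lambda>g. \<Phi> g + (\<epsilon> + (B / \<delta>) * D g)) \<in> U"
          by (intro uniform_add uniform_const uniform_cmult DU \<Phi>(1))
        fix g assume g: "g \<in> carrier G"
        show "0 \<le> \<Phi> g + (\<epsilon> + (B / \<delta>) * D g)"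
        proof (cases "g \<in> W")
          case True
          then obtain p where p: "p \<in> P" "g \<otimes> inv p \<in> V0" by (auto simp: W_def)
          have "g \<otimes> inv p \<otimes> p = g" using PG[OF p(1)] g by (simp add: m_assoc)
          then have "\<bar>\<Phi> g - \<Phi> p\<bar> < \<epsilon>" using bspec[OF bspec[OF V0(3) p(2)] PG[OF p(1)]] by simp
          moreover have "0 \<le> (B / \<delta>) * D g" using B(1) J(3) D0 by simp
          ultimately show ?thesis using \<Phi>(2)[OF p(1)] by linarith
        next
          case False
          obtain k p where kp: "k \<in> K" "p \<in> P" "g = k \<otimes> p" using decomp[OF g] by blast
          have kG: "k \<in> carrier G" by (rule K_sub[OF kp(1)])
          have "k \<notin> W"
          proof
            assume "k \<in> W"
            then obtain q where q: "q \<in> P" "k \<otimes> inv q \<in> V0" by (auto simp: W_def)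
            have "g \<otimes> inv (q \<otimes> p) = k \<otimes> inv q"
              using kG PG[OF q(1)] PG[OF kp(2)] unfolding kp(3) by (simp add: inv_mult_group m_assoc inv_solve_left)
                 (simp add: m_assoc[symmetric])
            then have "g \<in> W" using q g subgroup.m_closed[OF P q(1) kp(2)] by (auto simp: W_def intro!: bexI[of _ "q \<otimes> p"])
            then show False using False by blast
          qed
          then have "\<delta> \<le> D k" using J(4)[of k] kp(1) kG by (simp add: D_def topspace_carrier)
          also have "D k = D g"
            unfolding D_def kp(3) using J(2) kG kp(2) by (intro sum.cong) (auto simp: orbit_mult)
          finally have "(B / \<delta>) * \<delta> \<le> (B / \<delta>) * D g" using B(1) J(3) by (intro mult_left_mono) auto
          then have "B \<le> (B / \<delta>) * D g" using J(3) by simp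
          then show ?thesis using B(2)[OF g] \<epsilon> by linarith
        qed
      qed
      also have "x (\<lambda>g. \<Phi> g + (\<epsilon> + (B / \<delta>) * D g)) = x \<Phi> + (\<epsilon> + (B / \<delta>) * x D)"
        using mean_add[OF xm \<Phi>(1) uniform_add[OF uniform_const uniform_cmult[OF DU]], of \<epsilon> "B / \<delta>"]
          mean_add[OF xm uniform_const uniform_cmult[OF DU], of \<epsilon> "B / \<delta>"]
        by (simp only: mean_const[OF xm] mean_cmult[OF xm DU])
      also have "x D = 0" unfolding D_def by (rule conc_sum[OF J(1,2)])
      finally show ?thesis by simp
    qed
    then show "0 \<le> x \<Phi>" by (meson field_le_epsilon)
  qed
  ultimately show ?thesis by blast
qed

end

theorem mainTheorem1:
  fixes G :: "('a, 'b) monoid_scheme" and T :: "'a topology" and K :: "'a set"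
  assumes "locally_compact_group G T"
    and "subgroup K G" and "compactin T K"
    and "gelfand_pair G T K"
  shows "\<exists>P. cocompact_subgroup G T P \<and> amenable_subgroup G T P \<and> carrier G = K <#>\<^bsub>G\<^esub> P"
proof -
  have tg: "topological_group G T" "Hausdorff_space T" "locally_compact_space T"
    using assms(1) by (simp_all add: locally_compact_group_def)
  interpret top_group G T by (rule top_group.intro[OF tg(1)])
  obtain m where "compact_subgroup G T K m"
    using compact_subgroup_exists[OF assms(2,3)] by metis
  then show ?thesis
    by (rule compact_subgroup.gelfand_decomposition[OF _ tg(3,2) assms(4)])
qed

end
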